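(* Let $\{x_{kl} : k,l=1,2,\ldots\}$ be a collection of independent, identically distributed complex random variables on a probability space, with $\mathbb{E}[x_{kl}]=0$, $\mathbb{E}[x_{kl}^2]=0$ and $\mathbb{E}[|x_{kl}|^2]=1$. Let $c>0$ and let $p(n)$, $n\ge 1$, be positive integers with $\lim_{n\to\infty} p(n)/n=c$. Let $X_n=(x_{kl})_{1\le k\le p(n),\,1\le l\le n}$, let $\rho_n = X_nX_n^\dagger/\mathrm{Tr}(X_nX_n^\dagger)$, and let $$\mu_n=\frac{1}{p(n)}\sum_{j=1}^{p(n)}\delta_{c n\lambda_j(\rho_n)}.$$ Then $$\mathbb{P}\big(\mu_n\to\nu_c \text{ in distribution (weakly) as } n\to\infty\big)=1,$$ where $\nu_c$ is the Marchenko-Pastur law with parameter $c$.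
   Context: $X^\dagger$ denotes the conjugate transpose of $X$. For a Hermitian matrix $A$, $\lambda_j(A)$ denotes its $j$-th largest eigenvalue (counted with multiplicity). $\delta_x$ is the Dirac measure at $x$. The matrix $\rho_n$ is a random $p(n)\times p(n)$ density matrix (positive semidefinite with trace 1); it is defined whenever $\mathrm{Tr}(X_nX_n^\dagger)\neq 0$, which holds almost surely for all large $n$. For $c>0$, the Marchenko-Pastur law of parameter $c$ is the probability measure $\nu_c=(1-1/c)\,\mathbb{I}_{[1,\infty)}(c)\,\delta_0+\kappa_c$, where $$d\kappa_c(x)=\frac{1}{2\pi c x}\sqrt{(x_+-x)(x-x_-)}\;\mathbb{I}_{[x_-,x_+]}(x)\,dx,\qquad x_\pm=(\sqrt{c}\pm1)^2,$$ and $\mathbb{I}_A$ denotes the indicator function of the set $A$. *)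

theory Defs
  imports "HOL-Probability.Probability" "Jordan_Normal_Form.Schur_Decomposition"
begin

text \<open>Matrices are those of \<^theory>\<open>Jordan_Normal_Form.Matrix\<close>, whose entries are indexed from 0;
  \<^const>\<open>mat_adjoint\<close> is the conjugate transpose.\<close>

definition mat_trace :: "complex mat \<Rightarrow> complex" where
  "mat_trace A = (\<Sum>i<dim_row A. A $$ (i, i))"

definition eigenvalues_desc :: "complex mat \<Rightarrow> real list" where
  "eigenvalues_desc A = rev (sorted_list_of_multiset (image_mset Re (proots (char_poly A))))"

text \<open>The \<open>j\<close>-th largest eigenvalue (\<open>1 \<le> j \<le> n\<close>) of a Hermitian \<open>n \<times> n\<close> matrix, counted with
  multiplicity. The eigenvalues of a Hermitian matrix are real, so taking real parts only
  changes the type.\<close>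

definition hermitian_eigenvalue :: "nat \<Rightarrow> complex mat \<Rightarrow> real" where
  "hermitian_eigenvalue j A = eigenvalues_desc A ! (j - 1)"

lemma length_eigenvalues_desc:
  assumes "A \<in> carrier_mat n n"
  shows "length (eigenvalues_desc A) = n"
proof -
  have "length (eigenvalues_desc A) = size (mset (eigenvalues_desc A))"
    by (simp only: size_mset)
  also have "mset (eigenvalues_desc A) = image_mset Re (proots (char_poly A))"
    by (simp add: eigenvalues_desc_def)
  finally show ?thesis
    using degree_monic_char_poly[OF assms] by (simp add: size_proots_complex)
qed

text \<open>The \<open>p \<times> n\<close> matrix with entries \<open>x k l\<close>, where \<open>1 \<le> k \<le> p\<close> and \<open>1 \<le> l \<le> n\<close>.\<close>

definition array_matrix :: "(nat \<Rightarrow> nat \<Rightarrow> complex) \<Rightarrow> nat \<Rightarrow> nat \<Rightarrow> complex mat" where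
  "array_matrix x p n = Matrix.mat p n (\<lambda>(i, j). x (Suc i) (Suc j))"

text \<open>If the trace of \<open>X X\<^sup>\<dagger>\<close> vanishes, the value below is the zero matrix because \<open>1 / 0 = 0\<close>.\<close>

definition density_matrix :: "complex mat \<Rightarrow> complex mat" where
  "density_matrix X =
     (1 / mat_trace (X * mat_adjoint X)) \<cdot>\<^sub>m (X * mat_adjoint X)"

text \<open>The measure \<open>(1/p) \<Sum>\<^sub>j \<delta>\<^bsub>y j\<^esub>\<close>, with \<open>j\<close> ranging over \<open>1, \<dots>, p\<close>.\<close>

definition empirical_measure :: "nat \<Rightarrow> (nat \<Rightarrow> real) \<Rightarrow> real measure" where
  "empirical_measure p y = measure_of UNIV (sets borel)
     (\<lambda>A. ennreal (1 / real p) * (\<Sum>j=1..p. emeasure (return borel (y j)) A))"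

definition marchenko_pastur_density :: "real \<Rightarrow> real \<Rightarrow> real" where
  "marchenko_pastur_density c x =
     (let x_minus = (sqrt c - 1)\<^sup>2; x_plus = (sqrt c + 1)\<^sup>2
      in 1 / (2 * pi * c * x) * sqrt ((x_plus - x) * (x - x_minus))
           * indicator {x_minus..x_plus} x)"

definition marchenko_pastur :: "real \<Rightarrow> real measure" where
  "marchenko_pastur c = measure_of UNIV (sets borel)
     (\<lambda>A. ennreal ((1 - 1 / c) * indicator {1..} c) * emeasure (return borel 0) A
          + emeasure (density lborel (\<lambda>x. ennreal (marchenko_pastur_density c x))) A)"

text \<open>The set functions in the two definitions above are measures, so
  \<^const>\<open>measure_of\<close> does not fall back to the zero measure.\<close>

lemma emeasure_empirical_measure:
  assumes "A \<in> sets borel"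
  shows "emeasure (empirical_measure p y) A =
           ennreal (1 / real p) * (\<Sum>j=1..p. emeasure (return borel (y j)) A)"
proof (rule emeasure_measure_of[OF empirical_measure_def])
  show "countably_additive (sets (empirical_measure p y))
    (\<lambda>A. ennreal (1 / real p) * (\<Sum>j=1..p. emeasure (return borel (y j)) A))"
    unfolding countably_additive_def
  proof (intro allI impI)
    fix B :: "nat \<Rightarrow> real set"
    assume B: "range B \<subseteq> sets (empirical_measure p y)" "disjoint_family B"
    have "range B \<subseteq> sets borel"
      using B(1) sets.sigma_sets_eq[of "borel :: real measure"]
      by (simp add: empirical_measure_def)
    hence "(\<Sum>i. emeasure (return borel z) (B i)) = emeasure (return borel z) (\<Union>i. B i)" for z
      by (intro suminf_emeasure B(2)) simp
    thus "(\<Sum>i. ennreal (1 / real p) * (\<Sum>j=1..p. emeasure (return borel (y j)) (B i))) =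
        ennreal (1 / real p) * (\<Sum>j=1..p. emeasure (return borel (y j)) (\<Union>i. B i))"
      by (simp add: suminf_sum)
  qed
qed (use assms sets.sigma_sets_eq[of "borel :: real measure"] in
      \<open>auto simp: positive_def empirical_measure_def\<close>)

lemma emeasure_marchenko_pastur:
  assumes "A \<in> sets borel"
  shows "emeasure (marchenko_pastur c) A =
           ennreal ((1 - 1 / c) * indicator {1..} c) * emeasure (return borel 0) A
           + emeasure (density lborel (\<lambda>x. ennreal (marchenko_pastur_density c x))) A"
    (is "_ = ?\<mu> A")
proof (rule emeasure_measure_of[OF marchenko_pastur_def])
  show "countably_additive (sets (marchenko_pastur c)) ?\<mu>"
    unfolding countably_additive_def
  proof (intro allI impI)
    fix B :: "nat \<Rightarrow> real set"
    assume B: "range B \<subseteq> sets (marchenko_pastur c)" "disjoint_family B"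
    have B': "range B \<subseteq> sets borel"
      using B(1) sets.sigma_sets_eq[of "borel :: real measure"]
      by (simp add: marchenko_pastur_def)
    hence "(\<Sum>i. emeasure (return borel 0) (B i)) = emeasure (return borel 0) (\<Union>i. B i)"
      by (intro suminf_emeasure B(2)) simp
    moreover have "(\<Sum>i. emeasure (density lborel f) (B i)) = emeasure (density lborel f) (\<Union>i. B i)"
      for f :: "real \<Rightarrow> ennreal"
      using B' by (intro suminf_emeasure B(2)) simp
    ultimately show "(\<Sum>i. ?\<mu> (B i)) = ?\<mu> (\<Union>i. B i)"
      by (simp flip: suminf_add)
  qed
qed (use assms sets.sigma_sets_eq[of "borel :: real measure"] in
      \<open>auto simp: positive_def marchenko_pastur_def\<close>)

end

theory Submission
  imports Defs "HOL-Library.Discrete_Functions" "HOL-Real_Asymp.Real_Asymp"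
begin

text \<open>On \<open>[0, \<infinity>)\<close>, weak convergence of probability measures amounts to convergence of the
  integrals of \<open>1 / (x + t)\<close> for countably many \<open>t > 0\<close>; these are normalized traces of
  resolvents, hence measurable in the matrix entries. For \<open>G = (X X\<^sup>\<dagger> + n t)\<^sup>-\<^sup>1\<close> the rank-one
  update formula gives the exact identity \<open>p - n t tr G = \<Sum>\<^sub>l \<xi>\<^sub>l / (1 + \<xi>\<^sub>l)\<close>, where
  \<open>\<xi>\<^sub>l = x\<^sub>l\<^sup>\<dagger> G\<^sub>l x\<^sub>l\<close> and \<open>G\<^sub>l\<close> omits column \<open>l\<close>. For bounded entries \<open>\<xi>\<^sub>l\<close> is
  within \<open>O(n\<^sup>-\<^sup>1\<^sup>/\<^sup>2)\<close> of \<open>tr G\<close> in mean square, so \<open>a = tr G\<close> nearly solves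
  \<open>t a + a / (1 + a) = c\<close>, an equation that is stable because its left side has slope at least
  \<open>t\<close>; no concentration of \<open>tr G\<close> itself is needed. The mean-square errors are summable only
  along \<open>n = k\<^sup>2\<close>. The gaps between squares, and the passage from truncated to general entries,
  are bridged by the estimate \<open>\<bar>tr G(X) - tr G(Y)\<bar> \<le> 2 \<parallel>X - Y\<parallel> (p / (n t)\<^sup>3)\<^sup>1\<^sup>/\<^sup>2\<close> in the
  Frobenius norm, together with strong laws for rectangular arrays.\<close>

section \<open>Resolvents of Gram matrices\<close>

text \<open>The test points are the reals \<open>- t\<close> instead of the upper half plane. There
  the shifted Gram matrix is positive, every quantity is real, all bounds follow from one energy
  identity, and the limiting equation has a unique nonnegative solution because its left side
  increases. The equation arises by dividing the exact identity by \<open>n\<close> and replacing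
  each \<xi> by \<open>a\<close>: \<open>p/n - t a = a/(1 + a)\<close>. The shift \<open>n t\<close>
  makes \<open>tr G\<close> of order 1 without further normalization; its limit is \<open>c\<close>
  times the Stieltjes transform at \<open>- t\<close>. Two obstacles shape the rest. Only second
  moments are given, so the variance of a quadratic form is available only after truncation, and the
  truncation error is merely small, not vanishing; it must be bounded uniformly in \<open>n\<close>.
  Moreover \<open>measure\<close> is 0 on nonmeasurable sets, so weak convergence has to be shown to
  be an event. Hence the convergence criterion is an equivalence, and resolvents are written through
  determinants.\<close>

definition shifted_gram :: "(nat \<Rightarrow> nat \<Rightarrow> complex) \<Rightarrow> nat \<Rightarrow> real \<Rightarrow> nat \<Rightarrow> nat \<Rightarrow> complex" where
  "shifted_gram x n t i k = (\<Sum>l<n. x i l * cnj (x k l)) + (if i = k then of_real t else 0)"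

definition shifted_gram_mat :: "(nat \<Rightarrow> nat \<Rightarrow> complex) \<Rightarrow> nat \<Rightarrow> nat \<Rightarrow> real \<Rightarrow> complex mat" where
  "shifted_gram_mat x m n t = Matrix.mat m m (\<lambda>(i, k). shifted_gram x n t i k)"

text \<open>Cramer's rule in place of an abstract inverse: the entries are explicit in the array,
  which gives measurability, and the diagonal ones are ratios of principal minors, which is what the
  derivative of the characteristic polynomial produces.\<close>

definition resolvent :: "(nat \<Rightarrow> nat \<Rightarrow> complex) \<Rightarrow> nat \<Rightarrow> nat \<Rightarrow> real \<Rightarrow> nat \<Rightarrow> nat \<Rightarrow> complex" where
  "resolvent x m n t i k =
     adj_mat (shifted_gram_mat x m n t) $$ (i, k) / Determinant.det (shifted_gram_mat x m n t)"

definition resolvent_trace :: "(nat \<Rightarrow> nat \<Rightarrow> complex) \<Rightarrow> nat \<Rightarrow> nat \<Rightarrow> real \<Rightarrow> real" where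
  "resolvent_trace x m n t = (\<Sum>i<m. Re (resolvent x m n t i i))"

lemma shifted_gram_mat_carrier [simp]: "shifted_gram_mat x m n t \<in> carrier_mat m m"
  by (simp add: shifted_gram_mat_def)

lemma cnj_shifted_gram: "cnj (shifted_gram x n t i k) = shifted_gram x n t k i"
  by (simp add: shifted_gram_def mult.commute)

text \<open>With \<open>H\<close> the shifted Gram matrix, both sides are
  \<open>u\<^sup>\<dagger> H u\<close>. Every positivity and norm estimate on the resolvent rests on
  this identity; no spectral theorem is involved.\<close>

lemma shifted_gram_energy:
  assumes "\<And>k. k < m \<Longrightarrow> (\<Sum>i<m. shifted_gram x n t k i * u i) = v k"
  shows "(\<Sum>k<m. cnj (u k) * v k) =
    of_real (t * (\<Sum>i<m. (cmod (u i))\<^sup>2) + (\<Sum>l<n. (cmod (\<Sum>i<m. cnj (x i l) * u i))\<^sup>2))"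
proof -
  have "(\<Sum>k<m. cnj (u k) * v k) = (\<Sum>k<m. cnj (u k) * (\<Sum>i<m. shifted_gram x n t k i * u i))"
    using assms by (intro sum.cong) auto
  also have "\<dots> = (\<Sum>k<m. \<Sum>i<m. cnj (u k) * (\<Sum>l<n. x k l * cnj (x i l)) * u i
       + (if k = i then of_real t * (cnj (u k) * u i) else 0))"
    unfolding shifted_gram_def sum_distrib_left
    by (intro sum.cong refl) (auto simp: algebra_simps sum_distrib_left)
  also have "\<dots> = (\<Sum>k<m. \<Sum>i<m. \<Sum>l<n. cnj (u k) * x k l * (cnj (x i l) * u i))
       + (\<Sum>k<m. of_real t * (cnj (u k) * u k))"
    by (simp add: sum.distrib sum_distrib_left sum_distrib_right mult_ac)
  also have "(\<Sum>k<m. of_real t * (cnj (u k) * u k)) = of_real (t * (\<Sum>i<m. (cmod (u i))\<^sup>2))"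
    by (simp add: sum_distrib_left complex_norm_square[symmetric] mult.commute[of "cnj _"]
        del: of_real_power)
  also have "(\<Sum>k<m. \<Sum>i<m. \<Sum>l<n. cnj (u k) * x k l * (cnj (x i l) * u i)) =
      (\<Sum>l<n. \<Sum>k<m. \<Sum>i<m. cnj (u k) * x k l * (cnj (x i l) * u i))"
    by (simp only: sum.swap[of _ "{..<n}" "{..<m}"])
  also have "\<dots> = of_real (\<Sum>l<n. (cmod (\<Sum>i<m. cnj (x i l) * u i))\<^sup>2)"
    unfolding of_real_sum complex_norm_square
    by (intro sum.cong refl, simp add: sum_product mult_ac, rule sum.swap)
  finally show ?thesis by simp
qed

text \<open>Half of \<open>t |u|^2\<close> absorbs the cross term, by
  \<open>|u| |v| <= t/2 |u|^2 + |v|^2/(2t)\<close>. In operator terms, the inverse of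
  \<open>H\<close> has norm at most \<open>1/t\<close>, and \<open>X\<^sup>\<dagger>\<close> times
  this inverse has norm at most \<open>t^(-1/2)\<close>.\<close>

lemma shifted_gram_bounds:
  assumes "\<And>k. k < m \<Longrightarrow> (\<Sum>i<m. shifted_gram x n t k i * u i) = v k" and t: "t > 0"
  shows "(\<Sum>i<m. (cmod (u i))\<^sup>2) \<le> (\<Sum>i<m. (cmod (v i))\<^sup>2) / t\<^sup>2"
    and "(\<Sum>l<n. (cmod (\<Sum>i<m. cnj (x i l) * u i))\<^sup>2) \<le> (\<Sum>i<m. (cmod (v i))\<^sup>2) / t"
proof -
  let ?U = "\<Sum>i<m. (cmod (u i))\<^sup>2" and ?V = "\<Sum>i<m. (cmod (v i))\<^sup>2"
    and ?W = "\<Sum>l<n. (cmod (\<Sum>i<m. cnj (x i l) * u i))\<^sup>2"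
  have "t * ?U + ?W = Re (\<Sum>k<m. cnj (u k) * v k)"
    using shifted_gram_energy[OF assms(1)] by simp
  also have "\<dots> \<le> (\<Sum>k<m. cmod (u k) * cmod (v k))"
    unfolding Re_sum
    by (intro sum_mono) (metis complex_Re_le_cmod complex_mod_cnj norm_mult)
  also have "\<dots> \<le> (\<Sum>k<m. t / 2 * (cmod (u k))\<^sup>2 + 1 / (2 * t) * (cmod (v k))\<^sup>2)"
  proof (intro sum_mono)
    fix k
    have "0 \<le> (t * cmod (u k) - cmod (v k))\<^sup>2 / (2 * t)" using t by simp
    also have "\<dots> = t / 2 * (cmod (u k))\<^sup>2 + 1 / (2 * t) * (cmod (v k))\<^sup>2 - cmod (u k) * cmod (v k)"
      using t by (simp add: field_simps power2_eq_square)
    finally show "cmod (u k) * cmod (v k) \<le> t / 2 * (cmod (u k))\<^sup>2 + 1 / (2 * t) * (cmod (v k))\<^sup>2"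
      by simp
  qed
  also have "\<dots> = t / 2 * ?U + 1 / (2 * t) * ?V"
    by (simp add: sum.distrib sum_distrib_left)
  finally have *: "t * ?U + ?W \<le> t / 2 * ?U + 1 / (2 * t) * ?V" .
  have "?U \<ge> 0" "?W \<ge> 0" "?V \<ge> 0" by (simp_all add: sum_nonneg)
  moreover have "t / 2 * ?U \<ge> 0" using \<open>?U \<ge> 0\<close> t by simp
  moreover have "t * ?U = t / 2 * ?U + t / 2 * ?U" by (simp add: field_simps)
  ultimately have "t / 2 * ?U \<le> 1 / (2 * t) * ?V" "?W \<le> 1 / (2 * t) * ?V"
    using * by linarith+
  with t \<open>?V \<ge> 0\<close> show "?U \<le> ?V / t\<^sup>2" "?W \<le> ?V / t"
    by (simp_all add: field_simps power2_eq_square)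
qed

text \<open>A kernel vector solves the system with right side 0, so
  \<open>shifted_gram_bounds\<close> forces it to vanish.\<close>

lemma det_shifted_gram_mat:
  assumes "t > 0"
  shows "Determinant.det (shifted_gram_mat x m n t) \<noteq> 0"
proof
  assume "Determinant.det (shifted_gram_mat x m n t) = 0"
  then obtain v where v: "v \<in> carrier_vec m" "v \<noteq> 0\<^sub>v m" "shifted_gram_mat x m n t *\<^sub>v v = 0\<^sub>v m"
    using det_0_iff_vec_prod_zero_field[OF shifted_gram_mat_carrier] by blast
  have "(\<Sum>i<m. shifted_gram x n t k i * v $ i) = 0" if "k < m" for k
  proof -
    have "(shifted_gram_mat x m n t *\<^sub>v v) $ k = 0" using v(3) that by simp
    thus ?thesis using that v(1)
      by (simp add: shifted_gram_mat_def mult_mat_vec_def scalar_prod_def atLeast0LessThan row_def)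
  qed
  from shifted_gram_bounds(1)[OF this assms] have "(\<Sum>i<m. (cmod (v $ i))\<^sup>2) \<le> 0" by simp
  hence "(\<Sum>i<m. (cmod (v $ i))\<^sup>2) = 0" by (simp add: sum_nonneg antisym)
  hence "\<forall>i<m. v $ i = 0" by (subst (asm) sum_nonneg_eq_0_iff) auto
  with v(1) have "v = 0\<^sub>v m" by auto
  with v(2) show False ..
qed

lemma shifted_gram_mat_index:
  "i < m \<Longrightarrow> k < m \<Longrightarrow> shifted_gram_mat x m n t $$ (i, k) = shifted_gram x n t i k"
  by (simp add: shifted_gram_mat_def)

lemma index_mult_mat_sum:
  assumes "A \<in> carrier_mat m m" "B \<in> carrier_mat m m" "i < m" "k < m"
  shows "(A * B) $$ (i, k) = (\<Sum>j<m. A $$ (i, j) * B $$ (j, k))"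
  using assms by (auto simp: scalar_prod_def atLeast0LessThan intro!: sum.cong)

lemma resolvent_inverse:
  assumes "t > 0" "i < m" "k < m"
  shows "(\<Sum>j<m. shifted_gram x n t i j * resolvent x m n t j k) = (if i = k then 1 else 0)"
    and "(\<Sum>j<m. resolvent x m n t i j * shifted_gram x n t j k) = (if i = k then 1 else 0)"
proof -
  let ?H = "shifted_gram_mat x m n t" and ?d = "Determinant.det (shifted_gram_mat x m n t)"
  note a = adj_mat[OF shifted_gram_mat_carrier[of x m n t]]
  have d: "?d \<noteq> 0" using det_shifted_gram_mat assms by blast
  have left: "(\<Sum>j<m. shifted_gram x n t i j * adj_mat ?H $$ (j, k)) = (if i = k then ?d else 0)"
  proof -
    have "(\<Sum>j<m. shifted_gram x n t i j * adj_mat ?H $$ (j, k)) = (\<Sum>j<m. ?H $$ (i, j) * adj_mat ?H $$ (j, k))"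
      using assms by (intro sum.cong refl) (simp add: shifted_gram_mat_index)
    also have "\<dots> = (?H * adj_mat ?H) $$ (i, k)"
      by (rule index_mult_mat_sum[symmetric, OF _ a(1)]) (use assms in simp_all)
    also have "\<dots> = (if i = k then ?d else 0)" unfolding a(2) using assms by simp
    finally show ?thesis .
  qed
  have right: "(\<Sum>j<m. adj_mat ?H $$ (i, j) * shifted_gram x n t j k) = (if i = k then ?d else 0)"
  proof -
    have "(\<Sum>j<m. adj_mat ?H $$ (i, j) * shifted_gram x n t j k) = (\<Sum>j<m. adj_mat ?H $$ (i, j) * ?H $$ (j, k))"
      using assms by (intro sum.cong refl) (simp add: shifted_gram_mat_index)
    also have "\<dots> = (adj_mat ?H * ?H) $$ (i, k)"
      by (rule index_mult_mat_sum[symmetric, OF a(1)]) (use assms in simp_all)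
    also have "\<dots> = (if i = k then ?d else 0)" unfolding a(3) using assms by simp
    finally show ?thesis .
  qed
  define K where "K = (\<lambda>i j. adj_mat ?H $$ (i, j))"
  define d where "d = ?d"
  have 1: "(\<Sum>j<m. shifted_gram x n t i j *  K j k) = (if i = k then d else 0)"
    "(\<Sum>j<m.  K i j * shifted_gram x n t j k) = (if i = k then d else 0)"
    unfolding K_def d_def by (fact left right)+
  have G: "resolvent x m n t a b =  K a b / d" for a b
    by (simp add: resolvent_def K_def d_def)
  have "(\<Sum>j<m. shifted_gram x n t i j * (K j k / d)) = (\<Sum>j<m. shifted_gram x n t i j *  K j k) / d"
    "(\<Sum>j<m.  K i j / d * shifted_gram x n t j k) = (\<Sum>j<m.  K i j * shifted_gram x n t j k) / d"
    by (simp_all add: sum_divide_distrib)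
  thus "(\<Sum>j<m. shifted_gram x n t i j * resolvent x m n t j k) = (if i = k then 1 else 0)"
       "(\<Sum>j<m. resolvent x m n t i j * shifted_gram x n t j k) = (if i = k then 1 else 0)"
    using d unfolding G 1 by (auto simp: d_def)
qed

lemma sum_delta_mult:
  fixes f :: "nat \<Rightarrow> 'a::semiring_1"
  assumes "i < m"
  shows "(\<Sum>j<m. (if i = j then 1 else 0) * f j) = f i" "(\<Sum>j<m. (if j = i then 1 else 0) * f j) = f i"
    "(\<Sum>j<m. f j * (if i = j then 1 else 0)) = f i" "(\<Sum>j<m. f j * (if j = i then 1 else 0)) = f i"
proof -
  have *: "(if P then 1 else 0) * y = (if P then y else 0)" "y * (if P then 1 else 0) = (if P then y else 0)"
    for P and y :: 'a by auto
  show "(\<Sum>j<m. (if i = j then 1 else 0) * f j) = f i" "(\<Sum>j<m. (if j = i then 1 else 0) * f j) = f i"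
    "(\<Sum>j<m. f j * (if i = j then 1 else 0)) = f i" "(\<Sum>j<m. f j * (if j = i then 1 else 0)) = f i"
    unfolding * using assms by simp_all
qed

text \<open>A right inverse is the inverse. This is how adjoints, rescaled arrays and zero-padded
  arrays get their resolvents: a column is guessed and the system is checked.\<close>

lemma resolvent_unique:
  assumes t: "t > 0" and ik: "i < m" "k < m"
    and g: "\<And>i. i < m \<Longrightarrow> (\<Sum>j<m. shifted_gram x n t i j * g j) = (if i = k then 1 else 0)"
  shows "resolvent x m n t i k = g i"
proof -
  have "resolvent x m n t i k = (\<Sum>a<m. resolvent x m n t i a * (if a = k then 1 else 0))"
    by (rule sum_delta_mult(4)[symmetric]) fact
  also have "\<dots> = (\<Sum>a<m. resolvent x m n t i a * (\<Sum>j<m. shifted_gram x n t a j * g j))"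
    by (intro sum.cong refl) (simp add: g)
  also have "\<dots> = (\<Sum>j<m. (\<Sum>a<m. resolvent x m n t i a * shifted_gram x n t a j) * g j)"
    unfolding sum_distrib_left sum_distrib_right by (subst sum.swap) (simp add: mult_ac)
  also have "\<dots> = (\<Sum>j<m. (if i = j then 1 else 0) * g j)"
    by (intro sum.cong refl) (simp add: resolvent_inverse t ik)
  also have "\<dots> = g i" by (rule sum_delta_mult(1)) fact
  finally show ?thesis .
qed

lemma cnj_resolvent:
  assumes t: "t > 0" and ik: "i < m" "k < m"
  shows "cnj (resolvent x m n t i k) = resolvent x m n t k i"
proof (rule resolvent_unique[symmetric, OF t ik(2,1)])
  fix k assume "k < m"
  have "(\<Sum>j<m. shifted_gram x n t k j * cnj (resolvent x m n t i j)) =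
    cnj (\<Sum>j<m. resolvent x m n t i j * shifted_gram x n t j k)"
    by (simp add: cnj_shifted_gram mult.commute)
  also have "\<dots> = (if k = i then 1 else 0)"
    by (simp add: resolvent_inverse t ik \<open>k < m\<close>)
  finally show "(\<Sum>j<m. shifted_gram x n t k j * cnj (resolvent x m n t i j)) = (if k = i then 1 else 0)" .
qed

lemma resolvent_apply:
  assumes "t > 0" "k < m"
  shows "(\<Sum>i<m. shifted_gram x n t k i * (\<Sum>j<m. resolvent x m n t i j * v j)) = v k"
proof -
  have "(\<Sum>i<m. shifted_gram x n t k i * (\<Sum>j<m. resolvent x m n t i j * v j)) =
    (\<Sum>j<m. (\<Sum>i<m. shifted_gram x n t k i * resolvent x m n t i j) * v j)"
    unfolding sum_distrib_left sum_distrib_right by (subst sum.swap) (simp add: mult_ac)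
  also have "\<dots> = (\<Sum>j<m. (if k = j then 1 else 0) * v j)"
    by (intro sum.cong refl) (simp add: resolvent_inverse assms)
  also have "\<dots> = v k" by (rule sum_delta_mult(1)) fact
  finally show ?thesis .
qed

lemmas resolvent_apply_bounds = shifted_gram_bounds[OF resolvent_apply]

text \<open>The column is the solution whose right side is the \<open>k\<close>-th unit
  vector.\<close>

lemma resolvent_column_bound:
  assumes t: "t > 0" and k: "k < m"
  shows "(\<Sum>i<m. (cmod (resolvent x m n t i k))\<^sup>2) \<le> 1 / t\<^sup>2"
proof -
  have "(\<Sum>i<m. (cmod (if i = k then 1 else 0 :: complex))\<^sup>2) = (\<Sum>i<m. if i = k then 1 else 0)"
    by (intro sum.cong) auto
  thus ?thesis
    using shifted_gram_bounds(1)[where u = "\<lambda>i. resolvent x m n t i k" and v = "\<lambda>i. if i = k then 1 else 0",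
        OF resolvent_inverse(1)[OF t _ k] t] k
    by simp
qed

lemma resolvent_entry_bound:
  assumes "t > 0" "i < m" "k < m"
  shows "cmod (resolvent x m n t i k) \<le> 1 / t"
proof (rule power2_le_imp_le)
  have "(cmod (resolvent x m n t i k))\<^sup>2 \<le> (\<Sum>i<m. (cmod (resolvent x m n t i k))\<^sup>2)"
    by (rule member_le_sum[of i "{..<m}" "\<lambda>i. (cmod (resolvent x m n t i k))\<^sup>2"]) (use assms in auto)
  also have "\<dots> \<le> 1 / t\<^sup>2"
    by (rule resolvent_column_bound) (use assms in auto)
  also have "\<dots> = (1 / t)\<^sup>2" by (simp add: power_divide)
  finally show "(cmod (resolvent x m n t i k))\<^sup>2 \<le> (1 / t)\<^sup>2" .
qed (use assms in simp)

lemma resolvent_frobenius_bound: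
  assumes t: "t > 0"
  shows "(\<Sum>k<m. \<Sum>i<m. (cmod (resolvent x m n t i k))\<^sup>2) \<le> real m / t\<^sup>2"
proof -
  have "(\<Sum>k<m. \<Sum>i<m. (cmod (resolvent x m n t i k))\<^sup>2) \<le> (\<Sum>k<m. 1 / t\<^sup>2)"
    by (intro sum_mono resolvent_column_bound t) auto
  thus ?thesis by simp
qed

lemma of_real_resolvent_trace:
  assumes "t > 0"
  shows "of_real (resolvent_trace x m n t) = (\<Sum>i<m. resolvent x m n t i i)"
  unfolding resolvent_trace_def of_real_sum
proof (intro sum.cong refl)
  fix i assume "i \<in> {..<m}"
  hence "cnj (resolvent x m n t i i) = resolvent x m n t i i" using assms by (simp add: cnj_resolvent)
  thus "of_real (Re (resolvent x m n t i i)) = resolvent x m n t i i"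
    by (metis Reals_cnj_iff of_real_Re)
qed

lemma resolvent_trace_bounds:
  assumes t: "t > 0"
  shows "0 \<le> resolvent_trace x m n t" "resolvent_trace x m n t \<le> real m / t"
proof -
  show "resolvent_trace x m n t \<le> real m / t"
  proof -
    have "resolvent_trace x m n t \<le> (\<Sum>i<m. 1 / t)" unfolding resolvent_trace_def
      using resolvent_entry_bound[OF t] complex_Re_le_cmod order_trans by (intro sum_mono) blast
    thus ?thesis by simp
  qed
  \<comment> \<open>Paired with the \<open>k\<close>-th unit vector, the \<open>k\<close>-th column
    yields the conjugate of the diagonal entry, which is therefore an energy.\<close>
  have "Re (resolvent x m n t k k) \<ge> 0" if k: "k < m" for k
  proof -
    let ?u = "\<lambda>i. resolvent x m n t i k" and ?v = "\<lambda>i. if i = k then 1 else 0 :: complex"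
    have "(\<Sum>i<m. cnj (?u i) * ?v i) = of_real (t * (\<Sum>i<m. (cmod (?u i))\<^sup>2)
       + (\<Sum>l<n. (cmod (\<Sum>i<m. cnj (x i l) * ?u i))\<^sup>2))"
      by (rule shifted_gram_energy) (simp add: resolvent_inverse t k)
    hence "cnj (?u k) = of_real (t * (\<Sum>i<m. (cmod (?u i))\<^sup>2)
       + (\<Sum>l<n. (cmod (\<Sum>i<m. cnj (x i l) * ?u i))\<^sup>2))"
      using sum_delta_mult(4)[of k m "\<lambda>i. cnj (?u i)"] k by simp
    hence "Re (cnj (?u k)) \<ge> 0" using t by (simp add: sum_nonneg)
    thus ?thesis by simp
  qed
  thus "0 \<le> resolvent_trace x m n t" unfolding resolvent_trace_def by (intro sum_nonneg) auto
qed

section \<open>Perturbation of resolvent traces\<close>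

lemma resolvent_identity:
  assumes t: "t > 0" "t' > 0" and ik: "i < m" "k < m"
  shows "resolvent x m n t i k - resolvent y m n' t' i k =
    (\<Sum>a<m. \<Sum>b<m. resolvent x m n t i a * (shifted_gram y n' t' a b - shifted_gram x n t a b) * resolvent y m n' t' b k)"
proof -
  let ?G = "resolvent x m n t" and ?G' = "resolvent y m n' t'"
  let ?H = "shifted_gram x n t" and ?H' = "shifted_gram y n' t'"
  have "(\<Sum>a<m. \<Sum>b<m. ?G i a * ?H' a b * ?G' b k) = (\<Sum>a<m. ?G i a * (\<Sum>b<m. ?H' a b * ?G' b k))"
    by (intro sum.cong refl) (simp only: sum_distrib_left mult.assoc)
  also have "\<dots> = (\<Sum>a<m. ?G i a * (if a = k then 1 else 0))"
    by (intro sum.cong refl) (simp add: resolvent_inverse t ik)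
  also have "\<dots> = ?G i k" by (rule sum_delta_mult(4)) fact
  finally have 1: "(\<Sum>a<m. \<Sum>b<m. ?G i a * ?H' a b * ?G' b k) = ?G i k" .
  have "(\<Sum>a<m. \<Sum>b<m. ?G i a * ?H a b * ?G' b k) = (\<Sum>b<m. (\<Sum>a<m. ?G i a * ?H a b) * ?G' b k)"
    by (subst sum.swap) (simp add: sum_distrib_right)
  also have "\<dots> = (\<Sum>b<m. (if i = b then 1 else 0) * ?G' b k)"
    by (intro sum.cong refl) (simp add: resolvent_inverse t ik)
  also have "\<dots> = ?G' i k" by (rule sum_delta_mult(1)) fact
  finally have 2: "(\<Sum>a<m. \<Sum>b<m. ?G i a * ?H a b * ?G' b k) = ?G' i k" .
  show ?thesis by (simp add: right_diff_distrib left_diff_distrib sum_subtractf 1 2)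
qed

lemma sum_rev3:
  "(\<Sum>i\<in>A. \<Sum>b\<in>B. \<Sum>l\<in>C. f i b l) = (\<Sum>l\<in>C. \<Sum>b\<in>B. \<Sum>i\<in>A. f i b l)"
proof -
  have "(\<Sum>i\<in>A. \<Sum>b\<in>B. \<Sum>l\<in>C. f i b l) = (\<Sum>i\<in>A. \<Sum>l\<in>C. \<Sum>b\<in>B. f i b l)"
    by (intro sum.cong refl sum.swap)
  also have "\<dots> = (\<Sum>l\<in>C. \<Sum>i\<in>A. \<Sum>b\<in>B. f i b l)" by (rule sum.swap)
  also have "\<dots> = (\<Sum>l\<in>C. \<Sum>b\<in>B. \<Sum>i\<in>A. f i b l)"
    by (intro sum.cong refl sum.swap)
  finally show ?thesis .
qed

lemma sum_rotate4:
  "(\<Sum>i\<in>A. \<Sum>a\<in>B. \<Sum>b\<in>C. \<Sum>l\<in>D. f i a b l) = (\<Sum>a\<in>B. \<Sum>l\<in>D. \<Sum>b\<in>C. \<Sum>i\<in>A. f i a b l)"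
proof -
  have "(\<Sum>i\<in>A. \<Sum>a\<in>B. \<Sum>b\<in>C. \<Sum>l\<in>D. f i a b l) = (\<Sum>a\<in>B. \<Sum>i\<in>A. \<Sum>b\<in>C. \<Sum>l\<in>D. f i a b l)"
    by (rule sum.swap)
  also have "\<dots> = (\<Sum>a\<in>B. \<Sum>l\<in>D. \<Sum>b\<in>C. \<Sum>i\<in>A. f i a b l)"
    by (intro sum.cong refl sum_rev3)
  finally show ?thesis .
qed

lemma cmod_double_sum_le:
  assumes "(\<Sum>j<m. \<Sum>l<n. (cmod (D j l))\<^sup>2) \<le> d" "(\<Sum>j<m. \<Sum>l<n. (cmod (W j l))\<^sup>2) \<le> w"
  shows "cmod (\<Sum>j<m. \<Sum>l<n. D j l * W j l) \<le> sqrt d * sqrt w"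
proof -
  let ?S = "{..<m} \<times> {..<n}"
  have "cmod (\<Sum>j<m. \<Sum>l<n. D j l * W j l) = cmod (\<Sum>(j, l)\<in>?S. D j l * W j l)"
    by (simp add: sum.cartesian_product)
  also have "\<dots> \<le> (\<Sum>(j, l)\<in>?S. cmod (D j l) * cmod (W j l))"
    by (rule order_trans[OF norm_sum]) (simp add: case_prod_unfold norm_mult)
  also have "\<dots> \<le> sqrt ((\<Sum>(j, l)\<in>?S. (cmod (D j l))\<^sup>2) * (\<Sum>(j, l)\<in>?S. (cmod (W j l))\<^sup>2))"
    unfolding case_prod_unfold by (intro real_le_rsqrt Cauchy_Schwarz_ineq_sum)
  also have "\<dots> \<le> sqrt (d * w)"
  proof (intro real_sqrt_le_mono mult_mono)
    show "0 \<le> d" by (rule order_trans[OF _ assms(1)]) (intro sum_nonneg zero_le_power2)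
  qed (use assms in \<open>auto simp: sum.cartesian_product intro!: sum_nonneg\<close>)
  finally show ?thesis by (simp add: real_sqrt_mult)
qed

lemma abs_eq_cmodI: "complex_of_real a = z \<Longrightarrow> \<bar>a\<bar> = cmod z"
  by auto

lemma cmod_add_cnj_le: "cmod (a + cnj b) \<le> cmod a + cmod b"
  using norm_triangle_ineq[of a "cnj b"] by simp

text \<open>With \<open>D = Y - X\<close>, the resolvent identity gives two inner products of
  \<open>D\<close> with matrices of the form \<open>Y\<^sup>\<dagger> G' G\<close>. Each column of
  such a matrix has squared norm at most \<open>t^(-3)\<close>: \<open>t^(-2)\<close> for the column
  of \<open>G\<close>, and another \<open>1/t\<close> for \<open>Y\<^sup>\<dagger> G'\<close>. At
  shift \<open>n t\<close> and with \<open>m\<close> of order \<open>n\<close> the last root is of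
  order \<open>1/n\<close>, so a change of the array by \<open>o(n)\<close> in Frobenius norm is
  negligible.\<close>

lemma resolvent_trace_lipschitz:
  assumes t: "t > 0"
  shows "\<bar>resolvent_trace x m n t - resolvent_trace y m n t\<bar> \<le>
    2 * sqrt (\<Sum>i<m. \<Sum>l<n. (cmod (x i l - y i l))\<^sup>2) * sqrt (real m / t ^ 3)"
proof -
  let ?G = "resolvent x m n t" and ?G' = "resolvent y m n t"
  let ?d = "\<Sum>i<m. \<Sum>l<n. (cmod (x i l - y i l))\<^sup>2"
  define D where "D = (\<lambda>i l. y i l - x i l)"
  define W where "W = (\<lambda>(x :: nat \<Rightarrow> nat \<Rightarrow> complex) y j l.
    \<Sum>k<m. cnj (y k l) * (\<Sum>i<m. resolvent y m n t k i * resolvent x m n t i j))"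
  have W: "(\<Sum>j<m. \<Sum>l<n. (cmod (W x y j l))\<^sup>2) \<le> real m / t ^ 3" for x y
  proof -
    have "(\<Sum>l<n. (cmod (W x y j l))\<^sup>2) \<le> 1 / t ^ 3" if j: "j < m" for j
    proof -
      have "(\<Sum>l<n. (cmod (W x y j l))\<^sup>2) \<le> (\<Sum>i<m. (cmod (resolvent x m n t i j))\<^sup>2) / t"
        unfolding W_def by (rule resolvent_apply_bounds(2)) (use t in auto)
      also have "\<dots> \<le> (1 / t\<^sup>2) / t"
        using t j by (intro divide_right_mono resolvent_column_bound) auto
      finally show ?thesis by (simp add: power2_eq_square power3_eq_cube mult.assoc)
    qed
    hence "(\<Sum>j<m. \<Sum>l<n. (cmod (W x y j l))\<^sup>2) \<le> (\<Sum>j<m. 1 / t ^ 3)" by (intro sum_mono) auto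
    thus ?thesis by simp
  qed
  \<comment> \<open>Each term contains \<open>D\<close> once. The remaining factor is
    \<open>Y\<close> in one and \<open>X\<close> in the other, and each of them stands next to its
    own resolvent, which controls it.\<close>
  have diff: "shifted_gram y n t a b - shifted_gram x n t a b =
      (\<Sum>l<n. D a l * cnj (y b l)) + (\<Sum>l<n. x a l * cnj (D b l))" for a b
    unfolding shifted_gram_def D_def sum.distrib[symmetric]
    by (simp add: algebra_simps sum_subtractf sum.distrib)
  have "of_real (resolvent_trace x m n t - resolvent_trace y m n t) = (\<Sum>i<m. ?G i i - ?G' i i)"
    using t by (simp add: of_real_resolvent_trace sum_subtractf)
  also have "\<dots> = (\<Sum>i<m. \<Sum>a<m. \<Sum>b<m. \<Sum>l<n. ?G i a * (D a l * cnj (y b l)) * ?G' b i)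
     + (\<Sum>i<m. \<Sum>a<m. \<Sum>b<m. \<Sum>l<n. ?G i a * (x a l * cnj (D b l)) * ?G' b i)"
    unfolding sum.distrib[symmetric]
  proof (intro sum.cong refl, goal_cases)
    case (1 i)
    show ?case
      by (subst resolvent_identity[OF t t]; (use 1 in simp)?)
         (simp add: diff distrib_left distrib_right sum_distrib_left sum_distrib_right sum.distrib)
  qed
  also have "(\<Sum>i<m. \<Sum>a<m. \<Sum>b<m. \<Sum>l<n. ?G i a * (D a l * cnj (y b l)) * ?G' b i)
     = (\<Sum>a<m. \<Sum>l<n. \<Sum>b<m. \<Sum>i<m. ?G i a * (D a l * cnj (y b l)) * ?G' b i)"
    by (rule sum_rotate4)
  also have "\<dots> = (\<Sum>a<m. \<Sum>l<n. D a l * W x y a l)"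
    unfolding W_def sum_distrib_left by (intro sum.cong refl) (simp only: mult_ac)
  also have "(\<Sum>i<m. \<Sum>a<m. \<Sum>b<m. \<Sum>l<n. ?G i a * (x a l * cnj (D b l)) * ?G' b i)
     = (\<Sum>b<m. \<Sum>l<n. \<Sum>a<m. \<Sum>i<m. ?G i a * (x a l * cnj (D b l)) * ?G' b i)"
    by (subst sum_rotate4[symmetric]) (intro sum.cong refl sum.swap)
  \<comment> \<open>Since both resolvents are Hermitian, this term is the conjugate of one of the
    first kind, with the roles of \<open>x\<close> and \<open>y\<close> exchanged in
    \<open>W\<close>.\<close>
  also have "\<dots> = (\<Sum>b<m. \<Sum>l<n. cnj (D b l * W y x b l))"
  proof (intro sum.cong refl, goal_cases)
    case (1 b l)
    have "cnj (D b l * W y x b l) =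
       cnj (D b l) * (\<Sum>a<m. x a l * (\<Sum>i<m. cnj (?G a i) * cnj (?G' i b)))"
      by (simp add: W_def)
    also have "\<dots> = cnj (D b l) * (\<Sum>a<m. x a l * (\<Sum>i<m. ?G i a * ?G' b i))"
      using 1 by (intro arg_cong2[where f = "(*)"] sum.cong refl) (simp_all add: cnj_resolvent t)
    also have "\<dots> = (\<Sum>a<m. \<Sum>i<m. ?G i a * (x a l * cnj (D b l)) * ?G' b i)"
      unfolding sum_distrib_left by (intro sum.cong refl) (simp only: mult_ac)
    finally show ?case ..
  qed
  also have "\<dots> = cnj (\<Sum>b<m. \<Sum>l<n. D b l * W y x b l)" by simp
  finally have "\<bar>resolvent_trace x m n t - resolvent_trace y m n t\<bar> =
     cmod ((\<Sum>a<m. \<Sum>l<n. D a l * W x y a l) + cnj (\<Sum>b<m. \<Sum>l<n. D b l * W y x b l))"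
    by (rule abs_eq_cmodI)
  also have "\<dots> \<le> cmod (\<Sum>a<m. \<Sum>l<n. D a l * W x y a l) + cmod (\<Sum>b<m. \<Sum>l<n. D b l * W y x b l)"
    by (rule cmod_add_cnj_le)
  also have "\<dots> \<le> sqrt ?d * sqrt (real m / t ^ 3) + sqrt ?d * sqrt (real m / t ^ 3)"
    by (intro add_mono cmod_double_sum_le W) (simp_all add: D_def norm_minus_commute)
  finally show ?thesis by (simp only: mult_2 distrib_right)
qed

text \<open>The resolvent identity turns the difference into \<open>(t' - t) tr (G G')\<close>, and
  Cauchy-Schwarz with the two Frobenius bounds finishes. It serves to move the shift when the
  dimensions or the normalization of the array change.\<close>

lemma resolvent_trace_shift:
  assumes t: "t > 0" "t' > 0"
  shows "\<bar>resolvent_trace x m n t - resolvent_trace x m n t'\<bar> \<le> real m * \<bar>t - t'\<bar> / (t * t')"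
proof -
  let ?G = "resolvent x m n t" and ?G' = "resolvent x m n t'"
  have diff: "shifted_gram x n t' a b - shifted_gram x n t a b = of_real (t' - t) * (if b = a then 1 else 0)" for a b
    by (simp add: shifted_gram_def)
  have "of_real (resolvent_trace x m n t - resolvent_trace x m n t') = (\<Sum>i<m. ?G i i - ?G' i i)"
    using t by (simp add: of_real_resolvent_trace sum_subtractf)
  also have "\<dots> = (\<Sum>i<m. \<Sum>a<m. of_real (t' - t) * (?G i a * ?G' a i))"
  proof (intro sum.cong refl, goal_cases)
    case (1 i)
    have "?G i i - ?G' i i = (\<Sum>a<m. \<Sum>b<m. ?G i a * (of_real (t' - t) * (if b = a then 1 else 0)) * ?G' b i)"
      using 1 resolvent_identity[OF t, of i m i x n x n] by (simp only: diff lessThan_iff)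
    also have "\<dots> = (\<Sum>a<m. ?G i a * of_real (t' - t) * (\<Sum>b<m. (if b = a then 1 else 0) * ?G' b i))"
      by (simp only: sum_distrib_left mult.assoc)
    also have "\<dots> = (\<Sum>a<m. of_real (t' - t) * (?G i a * ?G' a i))"
      by (intro sum.cong refl) (simp add: sum_delta_mult)
    finally show ?case .
  qed
  also have "\<dots> = of_real (t' - t) * (\<Sum>i<m. \<Sum>a<m. ?G i a * ?G' a i)"
    by (simp add: sum_distrib_left)
  finally have "\<bar>resolvent_trace x m n t - resolvent_trace x m n t'\<bar> =
      cmod (of_real (t' - t) * (\<Sum>i<m. \<Sum>a<m. ?G i a * ?G' a i))"
    by (rule abs_eq_cmodI)
  also have "\<dots> = \<bar>t - t'\<bar> * cmod (\<Sum>i<m. \<Sum>a<m. ?G i a * ?G' a i)"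
    unfolding norm_mult norm_of_real by (subst abs_minus_commute) (rule refl)
  also have "\<dots> \<le> \<bar>t - t'\<bar> * (sqrt (real m / t\<^sup>2) * sqrt (real m / t'\<^sup>2))"
  proof (intro mult_left_mono cmod_double_sum_le)
    show "(\<Sum>j<m. \<Sum>l<m. (cmod (?G j l))\<^sup>2) \<le> real m / t\<^sup>2"
      by (subst sum.swap) (rule resolvent_frobenius_bound[OF t(1)])
    show "(\<Sum>j<m. \<Sum>l<m. (cmod (?G' l j))\<^sup>2) \<le> real m / t'\<^sup>2"
      by (rule resolvent_frobenius_bound[OF t(2)])
  qed simp
  also have "\<dots> = real m * \<bar>t - t'\<bar> / (t * t')"
    using t by (simp add: real_sqrt_divide)
  finally show ?thesis .
qed

text \<open>The shifted Gram matrix is block diagonal: the nonzero block, and \<open>t\<close> times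
  an identity of size \<open>p - q\<close> whose inverse contributes \<open>1/t\<close> per row.
  Zero columns do not enter at all.\<close>

lemma resolvent_trace_padding:
  assumes t: "t > 0" and le: "q \<le> p" "n' \<le> n"
    and zero: "\<And>i l. i < p \<Longrightarrow> l < n \<Longrightarrow> i \<ge> q \<or> l \<ge> n' \<Longrightarrow> x i l = 0"
  shows "resolvent_trace x p n t = resolvent_trace x q n' t + real (p - q) / t"
proof -
  define g where "g = (\<lambda>i k. if i < q \<and> k < q then resolvent x q n' t i k
     else if i = k then 1 / of_real t else 0)"
  have H: "shifted_gram x n t i j = (if i < q \<and> j < q then shifted_gram x n' t i j else
      if i = j then of_real t else 0)" if "i < p" "j < p" for i j
  proof -
    have "(\<Sum>l<n. x i l * cnj (x j l)) = (\<Sum>l<n'. x i l * cnj (x j l))"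
      by (rule sum.mono_neutral_right) (use zero that le in auto)
    moreover have "(\<Sum>l<n'. x i l * cnj (x j l)) = 0" if "\<not> (i < q \<and> j < q)"
      by (rule sum.neutral) (use zero that le \<open>i < p\<close> \<open>j < p\<close> in auto)
    ultimately show ?thesis by (auto simp: shifted_gram_def)
  qed
  have res: "resolvent x p n t i k = g i k" if ik: "i < p" "k < p" for i k
  proof (rule resolvent_unique[OF t ik])
    fix i assume i: "i < p"
    show "(\<Sum>j<p. shifted_gram x n t i j * g j k) = (if i = k then 1 else 0)"
    proof (cases "i < q")
      case True
      have "(\<Sum>j<p. shifted_gram x n t i j * g j k) = (\<Sum>j<q. shifted_gram x n' t i j * g j k)"
        using True le i by (intro sum.mono_neutral_cong_right) (auto simp: H)
      also have "\<dots> = (if i = k then 1 else 0)"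
      proof (cases "k < q")
        case kq: True
        have "(\<Sum>j<q. shifted_gram x n' t i j * g j k) = (\<Sum>j<q. shifted_gram x n' t i j * resolvent x q n' t j k)"
          using kq by (intro sum.cong refl) (auto simp: g_def)
        also have "\<dots> = (if i = k then 1 else 0)"
          using True kq t by (intro resolvent_inverse) auto
        finally show ?thesis .
      next
        case False
        thus ?thesis using True by (auto simp: g_def intro!: sum.neutral)
      qed
      finally show ?thesis .
    next
      case False
      have "(\<Sum>j<p. shifted_gram x n t i j * g j k) = (\<Sum>j<p. (if i = j then 1 else 0) * (of_real t * g j k))"
        using False i by (intro sum.cong refl) (auto simp: H)
      also have "\<dots> = of_real t * g i k" using i by (rule sum_delta_mult(1))
      also have "\<dots> = (if i = k then 1 else 0)" using False t by (simp add: g_def)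
      finally show ?thesis .
    qed
  qed
  have "resolvent_trace x p n t = (\<Sum>i<p. Re (g i i))"
    unfolding resolvent_trace_def by (intro sum.cong refl) (simp add: res)
  also have "\<dots> = (\<Sum>i<q. Re (g i i)) + (\<Sum>i\<in>{q..<p}. Re (g i i))"
    using le by (metis lessThan_atLeast0 le0 sum.atLeastLessThan_concat)
  also have "(\<Sum>i<q. Re (g i i)) = resolvent_trace x q n' t"
    unfolding resolvent_trace_def by (intro sum.cong refl) (simp add: g_def)
  also have "(\<Sum>i\<in>{q..<p}. Re (g i i)) = (\<Sum>i\<in>{q..<p}. 1 / t)"
    by (intro sum.cong refl) (simp add: g_def Re_divide_of_real)
  finally show ?thesis by simp
qed

section \<open>Removing one column\<close>

text \<open>The column is overwritten by zeros and not deleted, so no index moves and all dimensions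
  stay.\<close>

definition drop_column :: "nat \<Rightarrow> (nat \<Rightarrow> nat \<Rightarrow> complex) \<Rightarrow> nat \<Rightarrow> nat \<Rightarrow> complex" where
  "drop_column c x i l = (if l = c then 0 else x i l)"

definition column_form :: "(nat \<Rightarrow> nat \<Rightarrow> complex) \<Rightarrow> nat \<Rightarrow> nat \<Rightarrow> (nat \<Rightarrow> nat \<Rightarrow> complex) \<Rightarrow> complex" where
  "column_form x m c B = (\<Sum>i<m. \<Sum>j<m. cnj (x i c) * B i j * x j c)"

text \<open>Rank-one update. With \<open>v\<close> the column, \<open>u = G' v\<close> and
  \<open>w = G v\<close>, the resolvent identity says \<open>G' - G = u w\<^sup>\<dagger>\<close>.
  Applied to \<open>v\<close> it yields the scalar equation \<open>r - e = r e\<close> for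
  \<open>r = v\<^sup>\<dagger> G' v\<close> and \<open>e = v\<^sup>\<dagger> G v\<close>, whence
  \<open>e = r/(1 + r)\<close> and \<open>w = u/(1 + r)\<close>. The traces then differ by
  \<open>|u|^2/(1 + r)\<close>, which is at most \<open>1/t\<close> because
  \<open>t |u|^2 <= r\<close>.\<close>

lemma drop_column_resolvent:
  fixes x :: "nat \<Rightarrow> nat \<Rightarrow> complex" and m :: nat
  assumes t: "t > 0" and c: "c < n"
  defines "G \<equiv> resolvent x m n t" and "G' \<equiv> resolvent (drop_column c x) m n t"
  obtains r where "r \<ge> 0" "column_form x m c G' = of_real r" "column_form x m c G = of_real (r / (1 + r))"
    "0 \<le> resolvent_trace (drop_column c x) m n t - resolvent_trace x m n t"
    "resolvent_trace (drop_column c x) m n t - resolvent_trace x m n t \<le> 1 / t"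
proof -
  define v where "v = (\<lambda>i. x i c)"
  define u where "u = (\<lambda>i. \<Sum>j<m. G' i j * v j)"
  define w where "w = (\<lambda>i. \<Sum>j<m. G i j * v j)"
  define U where "U = (\<Sum>i<m. (cmod (u i))\<^sup>2)"
  \<comment> \<open>Introduced as the energy of \<open>u\<close>, so that
    \<open>v\<^sup>\<dagger> G' v\<close> is at once real and at least
    \<open>t |u|^2\<close>.\<close>
  define r where "r = t * U + (\<Sum>l<n. (cmod (\<Sum>i<m. cnj (drop_column c x i l) * u i))\<^sup>2)"
  have rU: "t * U \<le> r" "0 \<le> U" by (auto simp: r_def U_def intro!: sum_nonneg)
  hence r0: "r \<ge> 0" using t by (meson mult_nonneg_nonneg less_imp_le order_trans)
  have "(\<Sum>k<m. cnj (u k) * v k) = of_real r" unfolding r_def U_def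
    by (rule shifted_gram_energy) (simp add: u_def G'_def resolvent_apply t)
  hence "cnj (\<Sum>k<m. cnj (u k) * v k) = of_real r" by simp
  hence xi: "(\<Sum>i<m. cnj (v i) * u i) = of_real r" by (simp add: mult.commute)
  have diff: "shifted_gram x n t a b - shifted_gram (drop_column c x) n t a b = v a * cnj (v b)" for a b
  proof -
    have "(\<Sum>l<n. x a l * cnj (x b l)) - (\<Sum>l<n. drop_column c x a l * cnj (drop_column c x b l)) =
      (\<Sum>l<n. if l = c then v a * cnj (v b) else 0)"
      unfolding sum_subtractf[symmetric] by (intro sum.cong refl) (auto simp: drop_column_def v_def)
    thus ?thesis using c by (simp add: shifted_gram_def)
  qed
  define e where "e = (\<Sum>i<m. cnj (v i) * w i)"
  have cnjw: "cnj (w k) = (\<Sum>b<m. cnj (v b) * G b k)" if "k < m" for k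
    unfolding w_def G_def using that by (simp add: cnj_resolvent t mult.commute)
  have id: "G' i k - G i k = u i * cnj (w k)" if "i < m" "k < m" for i k
  proof -
    have "G' i k - G i k = (\<Sum>a<m. \<Sum>b<m. G' i a * (v a * cnj (v b)) * G b k)"
      unfolding G'_def G_def using resolvent_identity[OF t t that] by (simp only: diff)
    also have "\<dots> = u i * cnj (w k)"
      unfolding u_def cnjw[OF that(2)] sum_product by (simp only: mult_ac)
    finally show ?thesis .
  qed
  have uw: "u i - w i = u i * e" if i: "i < m" for i
  proof -
    have "u i - w i = (\<Sum>k<m. (G' i k - G i k) * v k)" by (simp add: u_def w_def sum_subtractf left_diff_distrib)
    also have "\<dots> = (\<Sum>k<m. u i * (cnj (w k) * v k))"
      using i by (intro sum.cong refl) (simp add: id mult.assoc)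
    also have "\<dots> = u i * (\<Sum>k<m. cnj (w k) * v k)" by (simp add: sum_distrib_left)
    also have "(\<Sum>k<m. cnj (w k) * v k) = (\<Sum>k<m. \<Sum>b<m. cnj (v b) * G b k * v k)"
      by (intro sum.cong refl) (simp add: cnjw sum_distrib_right)
    also have "\<dots> = (\<Sum>b<m. \<Sum>k<m. cnj (v b) * G b k * v k)" by (rule sum.swap)
    also have "\<dots> = e" unfolding e_def w_def sum_distrib_left by (simp only: mult.assoc)
    finally show ?thesis .
  qed
  have "of_real r - e = (\<Sum>i<m. cnj (v i) * (u i - w i))"
    by (simp add: xi[symmetric] e_def right_diff_distrib sum_subtractf)
  also have "\<dots> = (\<Sum>i<m. cnj (v i) * u i * e)"
    by (intro sum.cong refl) (simp add: uw mult.assoc)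
  also have "\<dots> = of_real r * e" by (simp add: xi[symmetric] sum_distrib_right)
  finally have "e * (1 + of_real r) = of_real r" by (simp add: algebra_simps)
  moreover have "(1 + of_real r :: complex) \<noteq> 0" using r0
    by (metis add_nonneg_eq_0_iff of_real_1 of_real_add of_real_eq_0_iff zero_le_one zero_neq_one)
  ultimately have "e = of_real r / (1 + of_real r)" by (simp add: eq_divide_eq)
  hence e: "e = of_real (r / (1 + r))" by simp
  have w: "w i = u i * of_real (1 / (1 + r))" if "i < m" for i
  proof -
    have "w i = u i * (1 - e)" using uw[OF that] by (simp add: algebra_simps)
    also have "1 - e = of_real (1 - r / (1 + r))" by (simp add: e)
    also have "1 - r / (1 + r) = 1 / (1 + r)" using r0 by (simp add: field_simps)
    finally show ?thesis .
  qed
  have "complex_of_real (resolvent_trace (drop_column c x) m n t - resolvent_trace x m n t) = (\<Sum>i<m. G' i i - G i i)"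
    using t by (simp add: of_real_resolvent_trace sum_subtractf G_def G'_def)
  also have "\<dots> = (\<Sum>i<m. of_real (1 / (1 + r)) * (u i * cnj (u i)))"
    by (intro sum.cong refl) (simp add: id w mult_ac)
  also have "\<dots> = of_real (1 / (1 + r) * U)"
    by (simp add: U_def sum_distrib_left complex_norm_square[symmetric] del: of_real_power)
  finally have tr: "resolvent_trace (drop_column c x) m n t - resolvent_trace x m n t = U / (1 + r)"
    unfolding of_real_eq_iff by simp
  show ?thesis
  proof
    show "r \<ge> 0" by (rule r0)
    show "column_form x m c G' = of_real r"
      unfolding column_form_def xi[symmetric] u_def v_def sum_distrib_left by (simp only: mult.assoc)
    show "column_form x m c G = of_real (r / (1 + r))"
      unfolding column_form_def e[symmetric] e_def w_def v_def sum_distrib_left by (simp only: mult.assoc)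
    show "0 \<le> resolvent_trace (drop_column c x) m n t - resolvent_trace x m n t"
      unfolding tr using rU r0 by simp
    show "resolvent_trace (drop_column c x) m n t - resolvent_trace x m n t \<le> 1 / t"
      unfolding tr using rU r0 t by (simp add: field_simps)
  qed
qed

text \<open>The left side is \<open>tr (G X X\<^sup>\<dagger>) = tr (G (H - t))\<close>.\<close>

lemma sum_column_form_resolvent:
  assumes t: "t > 0"
  shows "(\<Sum>l<n. column_form x m l (resolvent x m n t)) = of_real (real m - t * resolvent_trace x m n t)"
proof -
  let ?G = "resolvent x m n t"
  have "(\<Sum>l<n. column_form x m l ?G) = (\<Sum>i<m. \<Sum>j<m. \<Sum>l<n. cnj (x i l) * ?G i j * x j l)"
    unfolding column_form_def by (subst sum_rev3) (rule sum.swap)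
  also have "\<dots> = (\<Sum>i<m. \<Sum>j<m. ?G i j * (shifted_gram x n t j i - (if j = i then 1 else 0) * of_real t))"
    by (intro sum.cong refl) (auto simp: shifted_gram_def sum_distrib_left mult_ac)
  also have "\<dots> = (\<Sum>i<m. (\<Sum>j<m. ?G i j * shifted_gram x n t j i) - (\<Sum>j<m. (if j = i then 1 else 0) * (?G i j * of_real t)))"
    by (simp add: right_diff_distrib sum_subtractf mult_ac)
  also have "\<dots> = (\<Sum>i<m. 1 - ?G i i * of_real t)"
    by (intro sum.cong refl) (simp add: resolvent_inverse t sum_delta_mult)
  also have "\<dots> = of_real (real m - t * resolvent_trace x m n t)"
    by (simp add: sum_subtractf of_real_resolvent_trace t sum_distrib_left mult.commute)
  finally show ?thesis .
qed

text \<open>On nonnegative reals \<open>r/(1 + r)\<close> is 1-Lipschitz in \<open>r\<close>, so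
  replacing \<open>r\<close> by \<open>a\<close> costs their distance; \<open>1/t\<close> per column
  pays for passing from the trace without column \<open>l\<close> to \<open>a\<close>. When
  \<open>n t\<close> stands for \<open>t\<close>, this second error is \<open>O(1)\<close> in total,
  against main terms of order \<open>n\<close>.\<close>

lemma resolvent_trace_equation:
  fixes x :: "nat \<Rightarrow> nat \<Rightarrow> complex" and m n :: nat
  assumes t: "t > 0"
  defines "a \<equiv> resolvent_trace x m n t"
  shows "\<bar>real m - t * a - real n * (a / (1 + a))\<bar> \<le>
    (\<Sum>l<n. cmod (column_form x m l (resolvent (drop_column l x) m n t)
       - of_real (resolvent_trace (drop_column l x) m n t))) + real n / t"
proof -
  have a0: "a \<ge> 0" unfolding a_def using resolvent_trace_bounds[OF t] by auto
  have *: "cmod (column_form x m l (resolvent x m n t) - of_real (a / (1 + a))) \<le>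
     cmod (column_form x m l (resolvent (drop_column l x) m n t)
       - of_real (resolvent_trace (drop_column l x) m n t)) + 1 / t" if l: "l < n" for l
  proof -
    obtain r where r: "r \<ge> 0" "column_form x m l (resolvent (drop_column l x) m n t) = of_real r"
       "column_form x m l (resolvent x m n t) = of_real (r / (1 + r))"
       "0 \<le> resolvent_trace (drop_column l x) m n t - a"
       "resolvent_trace (drop_column l x) m n t - a \<le> 1 / t"
      using drop_column_resolvent[OF t l] unfolding a_def by blast
    have "r / (1 + r) - a / (1 + a) = (r - a) / ((1 + r) * (1 + a))"
      using r(1) a0 by (simp add: field_simps)
    hence "\<bar>r / (1 + r) - a / (1 + a)\<bar> = \<bar>r - a\<bar> / ((1 + r) * (1 + a))"
      using r(1) a0 by (simp add: abs_mult)
    also have "\<dots> \<le> \<bar>r - a\<bar> / 1"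
    proof (intro divide_left_mono)
      have "0 \<le> r * a" using r(1) a0 by simp
      thus "1 \<le> (1 + r) * (1 + a)" using r(1) a0 by (simp add: algebra_simps)
      thus "0 < (1 + r) * (1 + a) * 1" by simp
    qed simp
    also have "\<dots> \<le> \<bar>r - resolvent_trace (drop_column l x) m n t\<bar> + 1 / t" using r(4,5) by simp
    finally show ?thesis unfolding r(2,3) of_real_diff[symmetric] norm_of_real .
  qed
  have "\<bar>real m - t * a - real n * (a / (1 + a))\<bar> =
    cmod (of_real (real m - t * a) - (\<Sum>l<n. of_real (a / (1 + a))))"
    by (rule abs_eq_cmodI) (simp only: of_real_diff of_real_mult sum_constant card_lessThan of_real_of_nat_eq)
  also have "\<dots> = cmod (\<Sum>l<n. column_form x m l (resolvent x m n t) - of_real (a / (1 + a)))"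
    unfolding a_def sum_column_form_resolvent[OF t, symmetric] sum_subtractf ..
  also have "\<dots> \<le> (\<Sum>l<n. cmod (column_form x m l (resolvent (drop_column l x) m n t)
       - of_real (resolvent_trace (drop_column l x) m n t)) + 1 / t)"
    by (rule order_trans[OF norm_sum], rule sum_mono) (use * in auto)
  also have "\<dots> = (\<Sum>l<n. cmod (column_form x m l (resolvent (drop_column l x) m n t)
       - of_real (resolvent_trace (drop_column l x) m n t))) + real n / t"
    by (simp add: sum.distrib)
  finally show ?thesis .
qed

section \<open>Eigenvalues and measurability\<close>

lemma det_measurable:
  fixes A :: "'a \<Rightarrow> complex mat"
  assumes "\<And>w. A w \<in> carrier_mat n n"
    and "\<And>i j. i < n \<Longrightarrow> j < n \<Longrightarrow> (\<lambda>w. A w $$ (i, j)) \<in> borel_measurable M"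
  shows "(\<lambda>w. Determinant.det (A w)) \<in> borel_measurable M"
proof -
  have "(\<lambda>w. Determinant.det (A w)) = (\<lambda>w. \<Sum>p\<in>{p. p permutes {0..<n}}. signof p * (\<Prod>i = 0..<n. A w $$ (i, p i)))"
    using det_def'[OF assms(1)] by auto
  also have "\<dots> \<in> borel_measurable M"
    using assms(2) permutes_in_image
    by (intro borel_measurable_sum borel_measurable_times borel_measurable_const borel_measurable_prod) fastforce
  finally show ?thesis .
qed

lemma shifted_gram_measurable:
  assumes "\<And>i l. i < m \<Longrightarrow> l < n \<Longrightarrow> (\<lambda>w. x w i l) \<in> borel_measurable M" "i < m" "k < m"
  shows "(\<lambda>w. shifted_gram (x w) n t i k) \<in> borel_measurable M"
proof -
  have [measurable]: "cnj \<in> borel_measurable borel"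
    by (intro borel_measurable_continuous_onI continuous_intros)
  have "(\<lambda>w. x w i l * cnj (x w k l)) \<in> borel_measurable M" if "l < n" for l
    using assms(1)[OF assms(2) that] assms(1)[OF assms(3) that] by measurable
  thus ?thesis unfolding shifted_gram_def
    by (intro borel_measurable_add borel_measurable_sum borel_measurable_const) auto
qed

text \<open>The sigma-algebra is arbitrary on purpose: besides that of the whole space it will be
  one generated by some of the entries, which expresses that a resolvent without column
  \<open>l\<close> does not see that column.\<close>

lemma resolvent_measurable:
  assumes "\<And>i l. i < m \<Longrightarrow> l < n \<Longrightarrow> (\<lambda>w. x w i l) \<in> borel_measurable M" "i < m" "k < m"
  shows "(\<lambda>w. resolvent (x w) m n t i k) \<in> borel_measurable M"
proof -
  let ?H = "\<lambda>w. shifted_gram_mat (x w) m n t"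
  have "(\<lambda>w. Determinant.det (mat_delete (?H w) k i)) \<in> borel_measurable M"
  proof (rule det_measurable[where n = "m - 1"])
    show "mat_delete (?H w) k i \<in> carrier_mat (m - 1) (m - 1)" for w
      by (rule mat_delete_carrier) simp
    fix a b assume ab: "a < m - 1" "b < m - 1"
    have dim: "dim_row (?H w) = m" "dim_col (?H w) = m" for w
      by (simp_all add: shifted_gram_mat_def)
    have "mat_delete (?H w) k i $$ (a, b) = shifted_gram (x w) n t (if a < k then a else Suc a) (if b < i then b else Suc b)" for w
      using ab unfolding mat_delete_def dim by (subst index_mat) (auto simp: shifted_gram_mat_index)
    thus "(\<lambda>w. mat_delete (?H w) k i $$ (a, b)) \<in> borel_measurable M"
      using ab by (simp only:) (rule shifted_gram_measurable[OF assms(1)], auto)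
  qed
  moreover have "(\<lambda>w. Determinant.det (?H w)) \<in> borel_measurable M"
  proof (rule det_measurable[where n = m])
    fix a b assume ab: "a < m" "b < m"
    show "(\<lambda>w. ?H w $$ (a, b)) \<in> borel_measurable M"
      unfolding shifted_gram_mat_index[OF ab] by (rule shifted_gram_measurable[OF assms(1) ab])
  qed simp
  moreover have "adj_mat (?H w) $$ (i, k) = (-1) ^ (k + i) * Determinant.det (mat_delete (?H w) k i)" for w
    using assms(2,3) by (simp add: adj_mat_def cofactor_def shifted_gram_mat_def)
  ultimately show ?thesis unfolding resolvent_def
    by (simp only:) (intro borel_measurable_divide borel_measurable_times borel_measurable_const)
qed

lemma resolvent_trace_measurable:
  assumes "\<And>i l. i < m \<Longrightarrow> l < n \<Longrightarrow> (\<lambda>w. x w i l) \<in> borel_measurable M"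
  shows "(\<lambda>w. resolvent_trace (x w) m n t) \<in> borel_measurable M"
proof -
  have "Re \<in> borel_measurable borel" by (intro borel_measurable_continuous_onI continuous_intros)
  thus ?thesis unfolding resolvent_trace_def
    by (intro borel_measurable_sum measurable_compose[OF resolvent_measurable] assms) auto
qed

text \<open>The shifted Gram matrix is multiplied by \<open>s^2\<close>. This moves the random
  normalization of the density matrix into the shift.\<close>

lemma resolvent_trace_scale:
  assumes t: "t > 0" and s: "s > 0"
  shows "resolvent_trace (\<lambda>i l. of_real s * x i l) m n (s\<^sup>2 * t) = resolvent_trace x m n t / s\<^sup>2"
proof -
  have H: "shifted_gram (\<lambda>i l. of_real s * x i l) n (s\<^sup>2 * t) i k = of_real (s\<^sup>2) * shifted_gram x n t i k" for i k
    by (simp add: shifted_gram_def sum_distrib_left power2_eq_square algebra_simps)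
  have "resolvent (\<lambda>i l. of_real s * x i l) m n (s\<^sup>2 * t) i k = resolvent x m n t i k / of_real (s\<^sup>2)"
    if ik: "i < m" "k < m" for i k
  proof (rule resolvent_unique)
    fix i assume i: "i < m"
    have "(\<Sum>j<m. shifted_gram (\<lambda>i l. of_real s * x i l) n (s\<^sup>2 * t) i j * (resolvent x m n t j k / of_real (s\<^sup>2)))
      = (\<Sum>j<m. shifted_gram x n t i j * resolvent x m n t j k)"
      unfolding H using s by (intro sum.cong refl) (simp add: field_simps)
    thus "(\<Sum>j<m. shifted_gram (\<lambda>i l. of_real s * x i l) n (s\<^sup>2 * t) i j * (resolvent x m n t j k / of_real (s\<^sup>2)))
      = (if i = k then 1 else 0)" using resolvent_inverse(1)[OF t i ik(2)] by simp
  qed (use assms ik in auto)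
  thus ?thesis
    unfolding resolvent_trace_def sum_divide_distrib by (intro sum.cong refl) (simp add: Re_divide_of_real del: of_real_power)
qed

section \<open>Characteristic polynomials of Gram matrices\<close>

lemma poly_pderiv_prod_linear:
  fixes z :: complex
  assumes "z \<notin> set as"
  shows "poly (pderiv (\<Prod>a\<leftarrow>as. [:- a, 1:])) z = poly (\<Prod>a\<leftarrow>as. [:- a, 1:]) z * (\<Sum>a\<leftarrow>as. 1 / (z - a))"
  using assms
proof (induction as)
  case (Cons b as)
  define q where "q = (\<Prod>a\<leftarrow>as. [:- a, 1:])"
  have "z - b \<noteq> 0" using Cons.prems by auto
  moreover have "pderiv ([:- b, 1:] * q) = [:- b, 1:] * pderiv q + q"
    unfolding pderiv_mult by (simp add: pderiv_pCons)
  moreover have "poly (pderiv q) z = poly q z * (\<Sum>a\<leftarrow>as. 1 / (z - a))"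
    using Cons by (simp add: q_def)
  moreover have "(\<Prod>a\<leftarrow>b # as. [:- a, 1:]) = [:- b, 1:] * q" by (simp add: q_def)
  ultimately show ?case by (simp only: poly_add poly_mult) (simp add: field_simps)
qed simp

lemma det_uminus:
  assumes "A \<in> carrier_mat n n"
  shows "Determinant.det (- A :: complex mat) = (-1) ^ n * Determinant.det A"
proof -
  have "- A = (-1) \<cdot>\<^sub>m A" by (rule eq_matI) auto
  thus ?thesis using assms by auto
qed

text \<open>For an eigenvector \<open>v\<close>, the energy identity at shift 0 reads
  \<open>z |v|^2 = |X\<^sup>\<dagger> v|^2\<close>.\<close>

lemma gram_eigenvalue_nonneg:
  fixes x :: "nat \<Rightarrow> nat \<Rightarrow> complex"
  assumes A: "A \<in> carrier_mat m m" "\<And>i k. i < m \<Longrightarrow> k < m \<Longrightarrow> A $$ (i, k) = (\<Sum>l<n. x i l * cnj (x k l))"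
    and "poly (char_poly A) z = 0"
  shows "z = of_real (Re z)" "Re z \<ge> 0"
proof -
  from assms have "eigenvalue A z" by (simp add: eigenvalue_root_char_poly)
  then obtain v where v: "v \<in> carrier_vec m" "v \<noteq> 0\<^sub>v m" "A *\<^sub>v v = z \<cdot>\<^sub>v v"
    using A unfolding eigenvalue_def eigenvector_def by auto
  let ?u = "\<lambda>i. v $ i"
  have "(\<Sum>i<m. shifted_gram x n 0 k i * ?u i) = z * ?u k" if k: "k < m" for k
  proof -
    have "(A *\<^sub>v v) $ k = (z \<cdot>\<^sub>v v) $ k" by (simp only: v(3))
    moreover have "(A *\<^sub>v v) $ k = (\<Sum>i<m. A $$ (k, i) * ?u i)"
      using A(1) v(1) k by (auto simp: mult_mat_vec_def scalar_prod_def atLeast0LessThan intro!: sum.cong)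
    moreover have "\<dots> = (\<Sum>i<m. shifted_gram x n 0 k i * ?u i)"
      using k by (intro sum.cong refl) (simp add: A(2) shifted_gram_def)
    ultimately show ?thesis using v(1) k by simp
  qed
  note shifted_gram_energy[OF this]
  moreover define W where "W = (\<Sum>l<n. (cmod (\<Sum>i<m. cnj (x i l) * ?u i))\<^sup>2)"
  moreover define U where "U = (\<Sum>i<m. (cmod (?u i))\<^sup>2)"
  moreover have "(\<Sum>k<m. cnj (?u k) * (z * ?u k)) = z * of_real U"
    by (simp add: U_def sum_distrib_left complex_norm_square mult_ac del: of_real_power)
  ultimately have *: "z * of_real U = of_real W" by simp
  have "W \<ge> 0" "U \<ge> 0" by (auto simp: W_def U_def intro!: sum_nonneg)
  moreover have "U \<noteq> 0"
  proof
    assume "U = 0"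
    hence "\<forall>i<m. v $ i = 0" unfolding U_def by (subst (asm) sum_nonneg_eq_0_iff) auto
    with v(1) have "v = 0\<^sub>v m" by auto
    with v(2) show False ..
  qed
  ultimately have "z = of_real (W / U)" using * by (simp add: field_simps)
  thus "z = of_real (Re z)" "Re z \<ge> 0" using \<open>W \<ge> 0\<close> \<open>U \<ge> 0\<close> by auto
qed

text \<open>Sums over the eigenvalues do not see their order, so the sorted list can be traded for
  the roots of the characteristic polynomial, listed in any order.\<close>

lemma gram_char_poly_roots:
  fixes x :: "nat \<Rightarrow> nat \<Rightarrow> complex"
  assumes A: "A \<in> carrier_mat m m" "\<And>i k. i < m \<Longrightarrow> k < m \<Longrightarrow> A $$ (i, k) = (\<Sum>l<n. x i l * cnj (x k l))"
  obtains as where "\<And>f :: real \<Rightarrow> real. (\<Sum>j=1..m. f (hermitian_eigenvalue j A)) = (\<Sum>a\<leftarrow>as. f (Re a))"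
    "\<And>a. a \<in> set as \<Longrightarrow> a = of_real (Re a)" "\<And>a. a \<in> set as \<Longrightarrow> Re a \<ge> 0"
    "char_poly A = (\<Prod>a\<leftarrow>as. [:- a, 1:])"
proof -
  obtain as where as: "char_poly A = (\<Prod>a\<leftarrow>as. [:- a, 1:])" "length as = m"
    using char_poly_factorized[OF A(1)] by auto
  have root: "poly (char_poly A) a = 0" if "a \<in> set as" for a
    using that unfolding as poly_prod_list by (induction as) auto
  have nz: "(\<Prod>a\<leftarrow>bs. [:- a, 1:]) \<noteq> 0" for bs :: "complex list"
    by (induction bs) (auto simp del: mult_pCons_left)
  have pr: "proots (char_poly A) = mset as"
    unfolding as(1)
  proof (induction as)
    case (Cons a as)
    have "proots ([:- a, 1:] * (\<Prod>a\<leftarrow>as. [:- a, 1:])) = proots [:- a, 1:] + proots (\<Prod>a\<leftarrow>as. [:- a, 1:])"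
      by (rule proots_mult) (use nz in auto)
    thus ?case using Cons by simp
  qed simp
  have "(\<Sum>j=1..m. f (hermitian_eigenvalue j A)) = (\<Sum>a\<leftarrow>as. f (Re a))" for f :: "real \<Rightarrow> real"
  proof -
    have "(\<Sum>j=1..m. f (hermitian_eigenvalue j A)) = (\<Sum>j<m. f (eigenvalues_desc A ! j))"
      unfolding hermitian_eigenvalue_def
      by (rule sum.reindex_bij_witness[of _ Suc "\<lambda>j. j - 1"]) auto
    also have "\<dots> = sum_list (map f (eigenvalues_desc A))"
      using length_eigenvalues_desc[OF A(1)] by (simp add: sum_list_sum_nth atLeast0LessThan)
    also have "\<dots> = sum_mset (image_mset f (mset (eigenvalues_desc A)))"
      by (metis mset_map sum_mset_sum_list)
    also have "mset (eigenvalues_desc A) = image_mset Re (mset as)"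
      by (simp add: eigenvalues_desc_def pr)
    also have "sum_mset (image_mset f (image_mset Re (mset as))) = (\<Sum>a\<leftarrow>as. f (Re a))"
      by (induction as) auto
    finally show ?thesis .
  qed
  with that[OF this] gram_eigenvalue_nonneg[OF A root] as show ?thesis by blast
qed

lemma hermitian_eigenvalue_gram_nonneg:
  fixes x :: "nat \<Rightarrow> nat \<Rightarrow> complex"
  assumes A: "A \<in> carrier_mat m m" "\<And>i k. i < m \<Longrightarrow> k < m \<Longrightarrow> A $$ (i, k) = (\<Sum>l<n. x i l * cnj (x k l))"
    and j: "j \<in> {1..m}"
  shows "hermitian_eigenvalue j A \<ge> 0"
proof -
  obtain as where as: "\<And>f :: real \<Rightarrow> real. (\<Sum>j=1..m. f (hermitian_eigenvalue j A)) = (\<Sum>a\<leftarrow>as. f (Re a))"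
    "\<And>a. a \<in> set as \<Longrightarrow> Re a \<ge> 0"
    using gram_char_poly_roots[OF A] by metis
  \<comment> \<open>Eigenvalues are accessible only through sums: this function counts the negative
    ones.\<close>
  let ?f = "\<lambda>y::real. if y < 0 then 1 else 0 :: real"
  have "(\<Sum>j=1..m. ?f (hermitian_eigenvalue j A)) = 0"
  proof -
    have "(\<Sum>j=1..m. ?f (hermitian_eigenvalue j A)) = (\<Sum>a\<leftarrow>as. ?f (Re a))" by (rule as(1))
    also have "\<dots> = (\<Sum>a\<leftarrow>as. 0)"
      using as(2) by (intro arg_cong[of _ _ sum_list] map_cong) (auto simp: not_less)
    finally show ?thesis by simp
  qed
  hence "\<forall>j\<in>{1..m}. ?f (hermitian_eigenvalue j A) = 0"
    by (subst (asm) sum_nonneg_eq_0_iff) auto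
  with j show ?thesis by (metis linorder_not_less zero_neq_one)
qed

text \<open>The proof reads the trace of the resolvent as minus the logarithmic derivative of the
  characteristic polynomial at \<open>-t\<close>.\<close>

lemma sum_inverse_eigenvalues:
  fixes x :: "nat \<Rightarrow> nat \<Rightarrow> complex"
  assumes A: "A \<in> carrier_mat m m" "\<And>i k. i < m \<Longrightarrow> k < m \<Longrightarrow> A $$ (i, k) = (\<Sum>l<n. x i l * cnj (x k l))"
    and t: "t > 0"
  shows "(\<Sum>j=1..m. 1 / (hermitian_eigenvalue j A + t)) = resolvent_trace x m n t"
proof -
  obtain as where as: "\<And>f :: real \<Rightarrow> real. (\<Sum>j=1..m. f (hermitian_eigenvalue j A)) = (\<Sum>a\<leftarrow>as. f (Re a))"
    "\<And>a. a \<in> set as \<Longrightarrow> a = of_real (Re a)" "\<And>a. a \<in> set as \<Longrightarrow> Re a \<ge> 0"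
    "char_poly A = (\<Prod>a\<leftarrow>as. [:- a, 1:])"
    using gram_char_poly_roots[OF A] by metis
  let ?H = "shifted_gram_mat x m n t" and ?z = "- of_real t :: complex"
  have dimA: "dim_row A = m" "dim_col A = m" using A by auto
  have dimH: "dim_row ?H = m" "dim_col ?H = m" by (simp_all add: shifted_gram_mat_def)
  \<comment> \<open>\<open>char_matrix A z\<close> is \<open>A - z\<close>, while the characteristic
    polynomial is the determinant of its negative; hence the signs below.\<close>
  have "char_matrix A ?z = ?H"
    by (rule eq_matI) (auto simp: char_matrix_def dimA dimH A(2) shifted_gram_mat_index shifted_gram_def)
  hence det: "poly (char_poly A) ?z = (-1) ^ m * Determinant.det ?H"
    using char_poly_matrix[OF A(1)] det_uminus[OF shifted_gram_mat_carrier] by metis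
  have minor: "poly (char_poly (mat_delete A i i)) ?z = (-1) ^ (m - 1) * (Determinant.det ?H * resolvent x m n t i i)"
    if i: "i < m" for i
  proof -
    have "char_matrix (mat_delete A i i) ?z = mat_delete ?H i i"
      by (rule eq_matI) (auto simp: char_matrix_def mat_delete_def dimA dimH A(2) shifted_gram_mat_index shifted_gram_def)
    hence "poly (char_poly (mat_delete A i i)) ?z = Determinant.det (- mat_delete ?H i i)"
      using char_poly_matrix[OF mat_delete_carrier[OF A(1)]] by metis
    also have "\<dots> = (-1) ^ (m - 1) * Determinant.det (mat_delete ?H i i)"
      by (rule det_uminus) (rule mat_delete_carrier[OF shifted_gram_mat_carrier])
    also have "Determinant.det (mat_delete ?H i i) = adj_mat ?H $$ (i, i)"
      using i by (simp add: adj_mat_def cofactor_def dimH)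
    also have "\<dots> = Determinant.det ?H * resolvent x m n t i i"
      using det_shifted_gram_mat[OF t, of x m n] by (simp add: resolvent_def)
    finally show ?thesis .
  qed
  \<comment> \<open>The derivative is the sum of the characteristic polynomials of the principal
    submatrices of size \<open>m - 1\<close>, which at \<open>- t\<close> are, up to sign, the
    diagonal cofactors of \<open>H\<close>.\<close>
  have "poly (pderiv (char_poly A)) ?z = (\<Sum>i<m. (-1) ^ (m - 1) * (Determinant.det ?H * resolvent x m n t i i))"
    unfolding pderiv_char_poly[OF A(1)] poly_sum by (intro sum.cong refl) (simp add: minor)
  also have "\<dots> = (-1) ^ (m - 1) * Determinant.det ?H * of_real (resolvent_trace x m n t)"
    by (simp add: of_real_resolvent_trace t sum_distrib_left mult.assoc)
  also have "\<dots> = poly (char_poly A) ?z * (- of_real (resolvent_trace x m n t))"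
    unfolding det
  \<comment> \<open>For \<open>m = 0\<close> truncated subtraction makes the two signs equal instead
    of opposite, but the trace is then an empty sum.\<close>
  proof (cases m)
    case 0
    thus "(- 1) ^ (m - 1) * Determinant.det ?H * of_real (resolvent_trace x m n t) =
      (- 1) ^ m * Determinant.det ?H * - of_real (resolvent_trace x m n t)"
      by (simp add: resolvent_trace_def)
  qed simp
  finally have 1: "poly (pderiv (char_poly A)) ?z = poly (char_poly A) ?z * (- of_real (resolvent_trace x m n t))" .
  have "?z \<notin> set as"
  proof
    assume "?z \<in> set as"
    from as(3)[OF this] t show False by simp
  qed
  from poly_pderiv_prod_linear[OF this]
  have "poly (pderiv (char_poly A)) ?z = poly (char_poly A) ?z * (\<Sum>a\<leftarrow>as. 1 / (?z - a))"
    unfolding as(4) .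
  moreover have "poly (char_poly A) ?z \<noteq> 0"
    using det_shifted_gram_mat[OF t, of x m n] by (simp add: det)
  ultimately have "- of_real (resolvent_trace x m n t) = (\<Sum>a\<leftarrow>as. 1 / (?z - a))"
    using 1 by (metis mult_left_cancel)
  also have "\<dots> = - of_real (\<Sum>a\<leftarrow>as. 1 / (Re a + t))"
    using as(2)
  proof (induction as)
    case (Cons a as)
    have "1 / (?z - a) = - of_real (1 / (Re a + t))"
    proof -
      have "a = of_real (Re a)" by (rule Cons.prems) simp
      hence "?z - a = - of_real (Re a + t)" by (simp add: complex_eq_iff)
      thus ?thesis by (metis minus_divide_right of_real_1 of_real_divide)
    qed
    thus ?case using Cons by simp
  qed simp
  finally have "resolvent_trace x m n t = (\<Sum>a\<leftarrow>as. 1 / (Re a + t))"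
    by (metis neg_equal_iff_equal of_real_eq_iff)
  thus ?thesis using as(1)[of "\<lambda>y. 1 / (y + t)"] by simp
qed

section \<open>The density matrix as a Gram matrix\<close>

definition shift_array :: "(nat \<Rightarrow> nat \<Rightarrow> complex) \<Rightarrow> nat \<Rightarrow> nat \<Rightarrow> complex" where
  "shift_array x i l = x (Suc i) (Suc l)"

definition square_sum :: "(nat \<Rightarrow> nat \<Rightarrow> complex) \<Rightarrow> nat \<Rightarrow> nat \<Rightarrow> real" where
  "square_sum x p n = (\<Sum>i<p. \<Sum>l<n. (cmod (x i l))\<^sup>2)"

lemma square_sum_nonneg: "square_sum x p n \<ge> 0"
  by (auto simp: square_sum_def intro!: sum_nonneg)

text \<open>Dividing by the trace amounts to dividing the array by the root of the trace, so
  everything on Gram matrices applies. A vanishing trace is covered too: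
  \<open>1 / sqrt 0 = 0\<close> makes \<open>y\<close> zero, in agreement with the default value in
  \<open>density_matrix\<close>.\<close>

lemma density_matrix_array:
  fixes x :: "nat \<Rightarrow> nat \<Rightarrow> complex" and p n :: nat
  defines "\<rho> \<equiv> density_matrix (array_matrix x p n)"
    and "y \<equiv> (\<lambda>i l. of_real (1 / sqrt (square_sum (shift_array x) p n)) * shift_array x i l)"
  shows "\<rho> \<in> carrier_mat p p" "\<And>i k. i < p \<Longrightarrow> k < p \<Longrightarrow> \<rho> $$ (i, k) = (\<Sum>l<n. y i l * cnj (y k l))"
proof -
  let ?X = "array_matrix x p n" and ?x = "shift_array x" and ?T = "square_sum (shift_array x) p n"
  have X: "dim_row ?X = p" "dim_col ?X = n" by (simp_all add: array_matrix_def)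
  have Xa: "mat_adjoint ?X \<in> carrier_mat n p" "\<And>l i. l < n \<Longrightarrow> i < p \<Longrightarrow> mat_adjoint ?X $$ (l, i) = cnj (?x i l)"
    unfolding mat_adjoint_def mat_of_rows_def by (auto simp: array_matrix_def shift_array_def)
  have Xe: "?X $$ (i, l) = ?x i l" if "i < p" "l < n" for i l
    using that by (simp add: array_matrix_def shift_array_def)
  have P: "(?X * mat_adjoint ?X) $$ (i, k) = (\<Sum>l<n. ?x i l * cnj (?x k l))" if "i < p" "k < p" for i k
  proof -
    have "(?X * mat_adjoint ?X) $$ (i, k) = (\<Sum>l<n. ?X $$ (i, l) * mat_adjoint ?X $$ (l, k))"
      using X Xa(1) that by (auto simp: scalar_prod_def atLeast0LessThan intro!: sum.cong)
    also have "\<dots> = (\<Sum>l<n. ?x i l * cnj (?x k l))"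
      using that by (intro sum.cong refl) (simp add: Xa Xe)
    finally show ?thesis .
  qed
  have PC: "?X * mat_adjoint ?X \<in> carrier_mat p p" using X Xa(1) by auto
  have "mat_trace (?X * mat_adjoint ?X) = (\<Sum>i<p. \<Sum>l<n. of_real ((cmod (?x i l))\<^sup>2))"
    unfolding mat_trace_def complex_norm_square using PC by (intro sum.cong) (auto simp: P)
  hence T: "mat_trace (?X * mat_adjoint ?X) = of_real ?T" by (simp add: square_sum_def)
  show "\<rho> \<in> carrier_mat p p" unfolding \<rho>_def density_matrix_def using PC by auto
  fix i k assume ik: "i < p" "k < p"
  have "\<rho> $$ (i, k) = of_real (1 / ?T) * (\<Sum>l<n. ?x i l * cnj (?x k l))"
    unfolding \<rho>_def density_matrix_def T
    by (subst index_smult_mat(1)) (use PC ik in \<open>simp_all add: P del: index_mult_mat\<close>)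
  also have "1 / ?T = (1 / sqrt ?T) * (1 / sqrt ?T)"
    using square_sum_nonneg[of ?x p n] by simp
  finally show "\<rho> $$ (i, k) = (\<Sum>l<n. y i l * cnj (y k l))"
    by (simp only: y_def of_real_mult complex_cnj_mult complex_cnj_complex_of_real sum_distrib_left mult_ac)
qed

lemmas density_matrix_eigenvalue_nonneg = hermitian_eigenvalue_gram_nonneg[OF density_matrix_array]
lemmas density_matrix_sum_inverse = sum_inverse_eigenvalues[OF density_matrix_array]

section \<open>The Marchenko-Pastur law\<close>

lemma arcsin_compose_derivative:
  assumes f: "(f has_real_derivative d) (at x)" and s: "s > 0" and eq: "1 - (f x)\<^sup>2 = s\<^sup>2"
  shows "((\<lambda>x. arcsin (f x)) has_real_derivative d / s) (at x)"
proof -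
  have "s\<^sup>2 > 0" using s by simp
  hence "(f x)\<^sup>2 < 1" using eq by linarith
  hence "-1 < f x" "f x < 1" by (simp_all add: abs_square_less_1 abs_less_iff)
  from DERIV_chain2[OF DERIV_arcsin[OF this] f]
  have "((\<lambda>x. arcsin (f x)) has_real_derivative inverse (sqrt (1 - (f x)\<^sup>2)) * d) (at x)" .
  moreover have "sqrt (1 - (f x)\<^sup>2) = s" unfolding eq using s by simp
  ultimately show ?thesis by (simp add: field_simps)
qed

text \<open>With \<open>y = x + t\<close> and \<open>S\<close> the root, the integrand splits as
  \<open>S/y = (\<alpha> + \<beta> - y)/S - \<alpha> \<beta>/(S y)\<close>, which leads to two
  arcsines. The case \<open>a + t = 0\<close> is included because at \<open>c = 1\<close> the
  support reaches 0 and the mass is computed at \<open>t = 0\<close>.\<close>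

lemma has_integral_sqrt_quadratic_over_linear:
  fixes a b t :: real
  assumes ab: "a < b" and t: "a + t \<ge> 0"
  shows "((\<lambda>x. sqrt ((b - x) * (x - a)) / (x + t)) has_integral
     pi * ((a + b) / 2 + t - sqrt ((a + t) * (b + t)))) {a..b}"
proof -
  define \<alpha> where "\<alpha> = a + t"
  define \<beta> where "\<beta> = b + t"
  have ab': "0 \<le> \<alpha>" "\<alpha> < \<beta>" "b - a = \<beta> - \<alpha>" using assms by (auto simp: \<alpha>_def \<beta>_def)
  define S where "S = (\<lambda>x. sqrt ((b - x) * (x - a)))"
  \<comment> \<open>\<open>u\<close> is the affine map and, for nonzero \<alpha>, \<open>w\<close>
    the Moebius map that takes \<open>a\<close>, \<open>b\<close> to \<open>-1\<close>,
    \<open>1\<close>. Then \<open>1 - u^2\<close> and \<open>1 - w^2\<close> are squares of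
    multiples of \<open>S\<close> and \<open>S/y\<close>, so the arcsines have simple derivatives,
    and each grows by \<open>pi\<close> over the interval.\<close>
  define u where "u = (\<lambda>x. (2 * x - a - b) / (b - a))"
  define w where "w = (\<lambda>x. (\<alpha> + \<beta> - 2 * (\<alpha> * \<beta>) / (x + t)) / (b - a))"
  \<comment> \<open>For \<alpha> = 0 the last coefficient is 0 and \<open>w\<close> is identically
    1, where arcsin has no derivative; the conditional removes it.\<close>
  define F where "F = (\<lambda>x. S x + ((a + b) / 2 + t) * arcsin (u x) - sqrt (\<alpha> * \<beta>) * (if \<alpha> = 0 then 0 else arcsin (w x)))"
  have S2: "(S x)\<^sup>2 = (b - x) * (x - a)" if "x \<in> {a..b}" for x
    using that by (simp add: S_def)
  have Spos: "S x > 0" if "x \<in> {a<..<b}" for x using that by (simp add: S_def)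
  have u2: "1 - (u x)\<^sup>2 = (2 * S x / (b - a))\<^sup>2" if "x \<in> {a..b}" for x
  proof -
    have "(2 * S x / (b - a))\<^sup>2 = 4 * ((b - x) * (x - a)) / (b - a)\<^sup>2"
      using S2[OF that] by (simp add: power_divide power_mult_distrib)
    also have "\<dots> = ((b - a)\<^sup>2 - (2 * x - a - b)\<^sup>2) / (b - a)\<^sup>2"
      by (simp add: power2_eq_square algebra_simps)
    also have "\<dots> = 1 - (u x)\<^sup>2" unfolding u_def power_divide using ab by (subst diff_divide_distrib) simp
    finally show ?thesis by simp
  qed
  have w2: "1 - (w x)\<^sup>2 = (2 * sqrt (\<alpha> * \<beta>) * S x / ((b - a) * (x + t)))\<^sup>2" if x: "x \<in> {a..b}" "x + t > 0" for x
  proof -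
    define y where "y = x + t"
    have y: "y > 0" using x by (simp add: y_def)
    have "(2 * sqrt (\<alpha> * \<beta>) * S x / ((b - a) * (x + t)))\<^sup>2 = 4 * (\<alpha> * \<beta>) * ((b - x) * (x - a)) / ((b - a)\<^sup>2 * y\<^sup>2)"
      using S2[OF x(1)] ab' by (simp add: power_divide power_mult_distrib y_def)
    also have "\<dots> = 4 * (\<alpha> * \<beta>) * ((\<beta> - y) * (y - \<alpha>)) / ((\<beta> - \<alpha>)\<^sup>2 * y\<^sup>2)"
      unfolding ab'(3) by (simp add: y_def \<alpha>_def \<beta>_def)
    also have "\<dots> = ((\<beta> - \<alpha>)\<^sup>2 * y\<^sup>2 - ((\<alpha> + \<beta>) * y - 2 * (\<alpha> * \<beta>))\<^sup>2) / ((\<beta> - \<alpha>)\<^sup>2 * y\<^sup>2)"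
      by (intro arg_cong2[where f = "(/)"] refl) (simp add: power2_eq_square algebra_simps)
    also have "\<dots> = 1 - (((\<alpha> + \<beta>) * y - 2 * (\<alpha> * \<beta>)) / ((\<beta> - \<alpha>) * y))\<^sup>2"
      using y ab' by (subst diff_divide_distrib) (simp add: power_divide power_mult_distrib)
    also have "((\<alpha> + \<beta>) * y - 2 * (\<alpha> * \<beta>)) / ((\<beta> - \<alpha>) * y) = w x"
      using y ab' by (simp add: w_def y_def[symmetric] ab'(3) divide_simps)
    finally show ?thesis by simp
  qed
  have ypos: "x + t > 0" if "x \<in> {a..b}" "\<alpha> \<noteq> 0" for x
    using that ab' by (auto simp: \<alpha>_def)
  have sq1: "-1 \<le> z \<and> z \<le> 1" if "1 - z\<^sup>2 = v\<^sup>2" for z v :: real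
  proof -
    have "z\<^sup>2 \<le> 1" using that zero_le_power2[of v] by linarith
    thus ?thesis by (simp add: abs_square_le_1 abs_le_iff)
  qed
  have cont: "continuous_on {a..b} F"
  proof (cases "\<alpha> = 0")
    case True
    show ?thesis unfolding F_def using True ab
      by (auto simp: S_def u_def intro!: continuous_intros sq1[OF u2, unfolded u_def] )
  next
    case False
    have "x + t \<noteq> 0" if "x \<in> {a..b}" for x using ypos[OF that False] by simp
    hence "continuous_on {a..b} w" unfolding w_def using ab
      by (intro continuous_intros) auto
    hence "continuous_on {a..b} (\<lambda>x. arcsin (w x))"
      by (intro continuous_on_arcsin) (auto intro!: sq1[OF w2] ypos[OF _ False])
    moreover have "continuous_on {a..b} (\<lambda>x. arcsin (u x))"
    proof (intro continuous_on_arcsin)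
      show "continuous_on {a..b} u" unfolding u_def using ab by (intro continuous_intros) auto
    qed (auto intro!: sq1[OF u2])
    moreover have "continuous_on {a..b} S" unfolding S_def by (intro continuous_intros)
    ultimately show ?thesis unfolding F_def using False
      by (auto intro!: continuous_intros)
  qed
  have deriv: "(F has_vector_derivative (sqrt ((b - x) * (x - a)) / (x + t))) (at x)" if x: "x \<in> {a<..<b}" for x
  proof -
    have x': "x \<in> {a..b}" using x by auto
    define y where "y = x + t"
    have y: "y > 0" using x ab' by (auto simp: y_def \<alpha>_def)
    have dS: "(S has_real_derivative (a + b - 2 * x) / (2 * S x)) (at x)"
    proof -
      have quad: "((\<lambda>x. (b - x) * (x - a)) has_real_derivative (a + b - 2 * x)) (at x)"
        by (auto intro!: derivative_eq_intros)
      have "(b - x) * (x - a) > 0" using x by simp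
      from DERIV_chain2[where g = "\<lambda>x. (b - x) * (x - a)", OF DERIV_real_sqrt[OF this] quad]
      have "(S has_real_derivative inverse (S x) / 2 * (a + b - 2 * x)) (at x)"
        by (simp only: S_def)
      thus ?thesis by (rule DERIV_cong) (use Spos[OF x] in \<open>simp add: field_simps\<close>)
    qed
    have "(u has_real_derivative (2 / (b - a))) (at x)"
      unfolding u_def by (rule DERIV_cdivide) (auto intro!: derivative_eq_intros)
    hence "((\<lambda>x. arcsin (u x)) has_real_derivative 2 / (b - a) / (2 * S x / (b - a))) (at x)"
      by (rule arcsin_compose_derivative[where f = u, OF _ _ u2[OF x']]) (use Spos[OF x] ab in simp)
    hence du: "((\<lambda>x. arcsin (u x)) has_real_derivative 1 / S x) (at x)"
      by (rule DERIV_cong) (use Spos[OF x] ab in \<open>simp add: divide_simps\<close>)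
    have dw: "((\<lambda>x. arcsin (w x)) has_real_derivative sqrt (\<alpha> * \<beta>) / (S x * y)) (at x)" if "\<alpha> \<noteq> 0"
    proof -
      have "\<alpha> > 0" using that ab' by auto
      hence p: "\<alpha> * \<beta> > 0" using ab' by auto
      have "(w has_real_derivative (2 * (\<alpha> * \<beta>) / y\<^sup>2 / (b - a))) (at x)"
        unfolding w_def using y by (intro DERIV_cdivide) (auto intro!: derivative_eq_intros simp: y_def power2_eq_square)
      hence "((\<lambda>x. arcsin (w x)) has_real_derivative 2 * (\<alpha> * \<beta>) / y\<^sup>2 / (b - a) / (2 * sqrt (\<alpha> * \<beta>) * S x / ((b - a) * (x + t)))) (at x)"
        by (rule arcsin_compose_derivative[where f = w, OF _ _ w2[OF x']]) (use Spos[OF x] ab y p in \<open>simp_all add: y_def\<close>)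
      also have "x + t = y" by (simp add: y_def)
      also have "2 * (\<alpha> * \<beta>) / y\<^sup>2 / (b - a) / (2 * sqrt (\<alpha> * \<beta>) * S x / ((b - a) * y)) = (\<alpha> * \<beta>) / sqrt (\<alpha> * \<beta>) / (S x * y)"
        using y ab Spos[OF x] p by (simp add: divide_simps power2_eq_square)
      also have "(\<alpha> * \<beta>) / sqrt (\<alpha> * \<beta>) = sqrt (\<alpha> * \<beta>)" using p by (simp add: real_div_sqrt)
      finally show ?thesis .
    qed
    have "((\<lambda>x. sqrt (\<alpha> * \<beta>) * (if \<alpha> = 0 then 0 else arcsin (w x))) has_real_derivative \<alpha> * \<beta> / (S x * y)) (at x)"
    proof (cases "\<alpha> = 0")
      case False
      have "\<alpha> * \<beta> \<ge> 0" using ab' by auto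
      with DERIV_cmult[OF dw[OF False], of "sqrt (\<alpha> * \<beta>)"] False show ?thesis by simp
    qed simp
    from DERIV_diff[OF DERIV_add[OF dS DERIV_cmult[OF du, of "(a + b) / 2 + t"]] this]
    have "(F has_real_derivative (a + b - 2 * x) / (2 * S x) + ((a + b) / 2 + t) * (1 / S x) - \<alpha> * \<beta> / (S x * y)) (at x)"
      unfolding F_def .
    also have "(a + b - 2 * x) / (2 * S x) + ((a + b) / 2 + t) * (1 / S x) - \<alpha> * \<beta> / (S x * y) = ((a + b - x + t) * y - \<alpha> * \<beta>) / (S x * y)"
      using Spos[OF x] y by (simp add: field_simps)
    also have "(a + b - x + t) * y - \<alpha> * \<beta> = (S x)\<^sup>2"
      unfolding S2[OF x'] by (simp add: y_def \<alpha>_def \<beta>_def algebra_simps)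
    also have "(S x)\<^sup>2 / (S x * y) = S x / y" using Spos[OF x] by (simp add: power2_eq_square)
    finally show ?thesis
      by (simp add: has_real_derivative_iff_has_vector_derivative S_def y_def)
  qed
  have "((\<lambda>x. sqrt ((b - x) * (x - a)) / (x + t)) has_integral (F b - F a)) {a..b}"
    using ab cont deriv by (intro fundamental_theorem_of_calculus_interior) auto
  moreover have "F b - F a = pi * ((a + b) / 2 + t - sqrt ((a + t) * (b + t)))"
  proof -
    have "u b = 1" "u a = -1" using ab by (simp_all add: u_def divide_simps)
    moreover have "(\<alpha> - \<beta>) / (\<beta> - \<alpha>) = -1" using ab' by (simp add: divide_eq_minus_1_iff)
    hence "w b = 1" "w a = -1" if "\<alpha> \<noteq> 0"
      using that ab ab' by (simp_all add: w_def \<alpha>_def[symmetric] \<beta>_def[symmetric] ab'(3))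
    ultimately show ?thesis
      by (cases "\<alpha> = 0") (simp_all add: F_def S_def \<alpha>_def[symmetric] \<beta>_def[symmetric] field_simps)
  qed
  ultimately show ?thesis by simp
qed

section \<open>Mass and Stieltjes transform of the law\<close>

lemma sets_marchenko_pastur [simp, measurable_cong]: "sets (marchenko_pastur c) = sets borel"
  using sets.sigma_sets_eq[of "borel :: real measure"] by (simp add: marchenko_pastur_def)

lemma space_marchenko_pastur [simp]: "space (marchenko_pastur c) = UNIV"
  by (simp add: marchenko_pastur_def)

lemma marchenko_pastur_density_measurable [measurable]:
  "marchenko_pastur_density c \<in> borel_measurable borel"
  unfolding marchenko_pastur_density_def Let_def by measurable

text \<open>The law is given as a sum of two set functions, so the formula holds for indicators and
  is extended by the standard induction on nonnegative measurable functions.\<close>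

lemma nn_integral_marchenko_pastur:
  assumes "g \<in> borel_measurable borel"
  shows "(\<integral>\<^sup>+x. g x \<partial>marchenko_pastur c) = ennreal ((1 - 1 / c) * indicator {1..} c) * g 0
    + (\<integral>\<^sup>+x. ennreal (marchenko_pastur_density c x) * g x \<partial>lborel)"
  using assms
proof (induction rule: borel_measurable_induct)
  case (cong f g)
  thus ?case by simp
next
  case (set A)
  have "(\<integral>\<^sup>+x. indicator A x \<partial>marchenko_pastur c) = emeasure (marchenko_pastur c) A"
    using set by (intro nn_integral_indicator) simp
  also have "\<dots> = ennreal ((1 - 1 / c) * indicator {1..} c) * indicator A 0
    + (\<integral>\<^sup>+x. ennreal (marchenko_pastur_density c x) * indicator A x \<partial>lborel)"
    using set by (subst emeasure_marchenko_pastur) (auto simp: emeasure_density)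
  finally show ?case .
next
  case (mult u b)
  have 1: "(\<integral>\<^sup>+x. b * u x \<partial>marchenko_pastur c) = b * (\<integral>\<^sup>+x. u x \<partial>marchenko_pastur c)"
    by (rule nn_integral_cmult) (use mult in measurable)
  have "(\<integral>\<^sup>+x. b * (ennreal (marchenko_pastur_density c x) * u x) \<partial>lborel) =
    b * (\<integral>\<^sup>+x. ennreal (marchenko_pastur_density c x) * u x \<partial>lborel)"
    by (rule nn_integral_cmult) (use mult in measurable)
  with 1 mult show ?case by (simp add: distrib_left mult_ac)
next
  case (add u v)
  have 1: "(\<integral>\<^sup>+x. v x + u x \<partial>marchenko_pastur c) = (\<integral>\<^sup>+x. v x \<partial>marchenko_pastur c) + (\<integral>\<^sup>+x. u x \<partial>marchenko_pastur c)"
    by (rule nn_integral_add) (use add in measurable)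
  have "(\<integral>\<^sup>+x. ennreal (marchenko_pastur_density c x) * v x + ennreal (marchenko_pastur_density c x) * u x \<partial>lborel) =
    (\<integral>\<^sup>+x. ennreal (marchenko_pastur_density c x) * v x \<partial>lborel) + (\<integral>\<^sup>+x. ennreal (marchenko_pastur_density c x) * u x \<partial>lborel)"
    by (rule nn_integral_add) (use add in measurable)
  with 1 add show ?case by (simp add: distrib_left add_ac)
next
  case (seq U)
  let ?k = "ennreal ((1 - 1 / c) * indicator {1..} c)" and ?f = "\<lambda>x. ennreal (marchenko_pastur_density c x)"
  have inc: "incseq (\<lambda>i. U i x)" for x using \<open>incseq U\<close> by (auto simp: mono_def le_fun_def)
  have "(\<integral>\<^sup>+x. (SUP i. U i x) \<partial>marchenko_pastur c) = (SUP i. \<integral>\<^sup>+x. U i x \<partial>marchenko_pastur c)"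
    by (rule nn_integral_monotone_convergence_SUP) (use seq in \<open>simp_all\<close>)
  also have "\<dots> = (SUP i. ?k * U i 0 + (\<integral>\<^sup>+x. ?f x * U i x \<partial>lborel))"
    by (simp add: seq)
  also have "\<dots> = (SUP i. ?k * U i 0) + (SUP i. (\<integral>\<^sup>+x. ?f x * U i x \<partial>lborel))"
    using inc by (intro ennreal_SUP_add) (auto simp: mono_def intro!: mult_left_mono nn_integral_mono)
  also have "(SUP i. (\<integral>\<^sup>+x. ?f x * U i x \<partial>lborel)) = (\<integral>\<^sup>+x. (SUP i. ?f x * U i x) \<partial>lborel)"
    using seq inc by (intro nn_integral_monotone_convergence_SUP[symmetric])
      (auto simp: mono_def le_fun_def intro!: mult_left_mono)
  also have "\<dots> = (\<integral>\<^sup>+x. ?f x * (SUP i. U i x) \<partial>lborel)"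
    by (simp add: SUP_mult_left_ennreal)
  also have "(SUP i. ?k * U i 0) = ?k * (SUP i. U i 0)" by (simp add: SUP_mult_left_ennreal)
  finally show ?case by (simp add: image_comp)
qed

context
  fixes c :: real
  assumes c: "c > 0"
begin

definition mp_minus :: real where "mp_minus = (sqrt c - 1)\<^sup>2"
definition mp_plus :: real where "mp_plus = (sqrt c + 1)\<^sup>2"

lemma mp_endpoints:
  shows "0 \<le> mp_minus" "mp_minus < mp_plus" "(mp_minus + mp_plus) / 2 = c + 1" "mp_minus * mp_plus = (c - 1)\<^sup>2"
    "(mp_minus + t) * (mp_plus + t) = (t + 1 - c)\<^sup>2 + 4 * c * t"
proof -
  define r where "r = sqrt c"
  have r: "r > 0" "c = r\<^sup>2" using c by (auto simp: r_def)
  have mp: "mp_minus = (r - 1)\<^sup>2" "mp_plus = (r + 1)\<^sup>2" by (simp_all add: mp_minus_def mp_plus_def r_def)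
  show "0 \<le> mp_minus" by (simp add: mp_minus_def)
  show "mp_minus < mp_plus" using r(1) unfolding mp
    by (simp add: power2_eq_square algebra_simps)
  show "(mp_minus + mp_plus) / 2 = c + 1" "mp_minus * mp_plus = (c - 1)\<^sup>2"
    "(mp_minus + t) * (mp_plus + t) = (t + 1 - c)\<^sup>2 + 4 * c * t"
    unfolding mp unfolding r(2)
    by (simp_all add: power2_eq_square algebra_simps)
qed

lemma mp_density_eq: "marchenko_pastur_density c x =
    1 / (2 * pi * c) * (sqrt ((mp_plus - x) * (x - mp_minus)) / x) * indicator {mp_minus..mp_plus} x"
  by (simp add: marchenko_pastur_density_def Let_def mp_minus_def mp_plus_def)

lemma mp_density_nonneg: "marchenko_pastur_density c x \<ge> 0"
  using c mp_endpoints(1) by (auto simp: mp_density_eq indicator_def)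

text \<open>The integral formula at \<open>t = 0\<close>. The value is \<open>min 1 (1/c)\<close>;
  for \<open>c > 1\<close> the atom at 0 supplies the rest.\<close>

lemma mp_mass: "(\<integral>\<^sup>+x. ennreal (marchenko_pastur_density c x) \<partial>lborel) = ennreal ((c + 1 - \<bar>c - 1\<bar>) / (2 * c))"
proof -
  have "((\<lambda>x. 1 / (2 * pi * c) * (sqrt ((mp_plus - x) * (x - mp_minus)) / x)) has_integral
     (1 / (2 * pi * c) * (pi * ((mp_minus + mp_plus) / 2 - sqrt (mp_minus * mp_plus))))) {mp_minus..mp_plus}"
    using has_integral_sqrt_quadratic_over_linear[of mp_minus mp_plus 0] mp_endpoints(1,2)
    by (intro has_integral_mult_right) simp
  from nn_integral_has_integral_lebesgue'[OF _ this]
  have "(\<integral>\<^sup>+x. ennreal (1 / (2 * pi * c) * (sqrt ((mp_plus - x) * (x - mp_minus)) / x)) * indicator {mp_minus..mp_plus} x \<partial>lborel)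
    = ennreal (1 / (2 * pi * c) * (pi * ((mp_minus + mp_plus) / 2 - sqrt (mp_minus * mp_plus))))"
    using mp_endpoints(1) c by simp
  moreover have "1 / (2 * pi * c) * (pi * ((mp_minus + mp_plus) / 2 - sqrt (mp_minus * mp_plus))) = (c + 1 - \<bar>c - 1\<bar>) / (2 * c)"
    using c unfolding mp_endpoints by simp
  moreover have "ennreal (1 / (2 * pi * c) * (sqrt ((mp_plus - x) * (x - mp_minus)) / x)) * indicator {mp_minus..mp_plus} x
     = ennreal (marchenko_pastur_density c x)" for x
    by (simp add: mp_density_eq indicator_def)
  ultimately show ?thesis by (simp only:)
qed

text \<open>Partial fractions \<open>1/(x (x + t)) = (1/x - 1/(x + t))/t\<close> reduce the integral
  to the formula at 0 and at \<open>t\<close>. Writing \<open>max x 0\<close> for \<open>x\<close>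
  changes nothing on the support and keeps the test function bounded and continuous on the
  line.\<close>

lemma mp_resolvent:
  assumes t: "t > 0"
  shows "(\<integral>\<^sup>+x. ennreal (marchenko_pastur_density c x) * ennreal (1 / (max x 0 + t)) \<partial>lborel) =
    ennreal ((sqrt ((t + 1 - c)\<^sup>2 + 4 * c * t) - t - \<bar>c - 1\<bar>) / (2 * c * t))"
proof -
  let ?q = "\<lambda>x. sqrt ((mp_plus - x) * (x - mp_minus))"
  let ?I0 = "pi * ((mp_minus + mp_plus) / 2 - sqrt (mp_minus * mp_plus))"
  let ?It = "pi * ((mp_minus + mp_plus) / 2 + t - sqrt ((mp_minus + t) * (mp_plus + t)))"
  have I: "((\<lambda>x. 1 / (2 * pi * c * t) * (?q x / x - ?q x / (x + t))) has_integral
     (1 / (2 * pi * c * t) * (?I0 - ?It))) {mp_minus..mp_plus}"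
    using has_integral_sqrt_quadratic_over_linear[of mp_minus mp_plus 0]
      has_integral_sqrt_quadratic_over_linear[of mp_minus mp_plus t] mp_endpoints(1,2) t
    by (intro has_integral_mult_right has_integral_diff) simp_all
  have eq: "1 / (2 * pi * c * t) * (?q x / x - ?q x / (x + t)) = 1 / (2 * pi * c) * (?q x / x) * (1 / (max x 0 + t))"
    if "x \<in> {mp_minus..mp_plus} - {0}" for x
  proof -
    have x: "x > 0" using that mp_endpoints(1) by auto
    have "?q x / x - ?q x / (x + t) = ?q x * t / (x * (x + t))"
      using x t by (simp add: field_simps)
    thus ?thesis using x t by simp
  qed
  \<comment> \<open>At \<open>c = 1\<close> the interval contains 0, where the partial fractions
    break down; a single point is negligible.\<close>
  have "((\<lambda>x. 1 / (2 * pi * c) * (?q x / x) * (1 / (max x 0 + t))) has_integral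
     (1 / (2 * pi * c * t) * (?I0 - ?It))) {mp_minus..mp_plus}"
    by (rule has_integral_spike[OF negligible_sing[of 0] eq[symmetric] I])
  from nn_integral_has_integral_lebesgue'[OF _ this]
  have "(\<integral>\<^sup>+x. ennreal (1 / (2 * pi * c) * (?q x / x) * (1 / (max x 0 + t))) * indicator {mp_minus..mp_plus} x \<partial>lborel)
    = ennreal (1 / (2 * pi * c * t) * (?I0 - ?It))"
    using mp_endpoints(1) c t by simp
  moreover have "1 / (2 * pi * c * t) * (?I0 - ?It) = (sqrt ((t + 1 - c)\<^sup>2 + 4 * c * t) - t - \<bar>c - 1\<bar>) / (2 * c * t)"
  proof -
    have "?I0 - ?It = pi * (sqrt ((t + 1 - c)\<^sup>2 + 4 * c * t) - t - \<bar>c - 1\<bar>)"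
      unfolding mp_endpoints by (simp add: algebra_simps)
    thus ?thesis using c t by simp
  qed
  moreover have "ennreal (1 / (2 * pi * c) * (?q x / x) * (1 / (max x 0 + t))) * indicator {mp_minus..mp_plus} x
     = ennreal (marchenko_pastur_density c x) * ennreal (1 / (max x 0 + t))" for x
  proof (cases "x \<in> {mp_minus..mp_plus}")
    case True
    have "marchenko_pastur_density c x = 1 / (2 * pi * c) * (?q x / x)" using True by (simp add: mp_density_eq)
    thus ?thesis using True mp_density_nonneg[of x] by (simp add: ennreal_mult'[symmetric] del: times_divide_eq_left times_divide_eq_right)
  qed (simp add: mp_density_eq)
  ultimately show ?thesis by (simp only:)
qed

text \<open>\<open>c\<close> times the Stieltjes transform of the Marchenko-Pastur law at \<open>-t\<close>.\<close>

definition mp_root :: "real \<Rightarrow> real" where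
  "mp_root t = (sqrt ((t + 1 - c)\<^sup>2 + 4 * c * t) - (t + 1 - c)) / (2 * t)"

text \<open>Multiplied by \<open>1 + a\<close>, the equation is
  \<open>t a^2 + (t + 1 - c) a - c = 0\<close>, and \<open>mp_root t\<close> is its root with the
  positive sign of the radical.\<close>

lemma mp_root_equation:
  assumes t: "t > 0"
  shows "mp_root t \<ge> 0" "t * mp_root t + mp_root t / (1 + mp_root t) = c"
proof -
  define D where "D = sqrt ((t + 1 - c)\<^sup>2 + 4 * c * t)"
  have D2: "D\<^sup>2 = (t + 1 - c)\<^sup>2 + 4 * c * t" and D: "D \<ge> \<bar>t + 1 - c\<bar>"
    unfolding D_def using c t by (auto intro!: real_le_rsqrt)
  define a where "a = mp_root t"
  have a: "a = (D - (t + 1 - c)) / (2 * t)" by (simp add: a_def mp_root_def D_def)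
  show "mp_root t \<ge> 0" unfolding a_def[symmetric] a using D t by simp
  hence a0: "a \<ge> 0" by (simp add: a_def)
  have Da: "D = 2 * t * a + (t + 1 - c)" using t by (simp add: a)
  have "4 * t * (t * a * (1 + a) + a - c * (1 + a)) = 0"
    using D2 unfolding Da by (simp add: power2_eq_square algebra_simps)
  hence "t * a * (1 + a) + a = c * (1 + a)" using t by simp
  thus "t * mp_root t + mp_root t / (1 + mp_root t) = c"
    unfolding a_def[symmetric] using a0 by (simp add: field_simps)
qed

lemma real_distribution_marchenko_pastur: "real_distribution (marchenko_pastur c)"
proof -
  have "emeasure (marchenko_pastur c) UNIV = (\<integral>\<^sup>+x. 1 \<partial>marchenko_pastur c)" by simp
  also have "\<dots> = ennreal ((1 - 1 / c) * indicator {1..} c) + ennreal ((c + 1 - \<bar>c - 1\<bar>) / (2 * c))"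
    by (subst nn_integral_marchenko_pastur) (simp_all add: mp_mass)
  also have "\<dots> = ennreal ((1 - 1 / c) * indicator {1..} c + (c + 1 - \<bar>c - 1\<bar>) / (2 * c))"
    using c by (intro ennreal_plus[symmetric]) (auto simp: indicator_def abs_if field_simps)
  also have "(1 - 1 / c) * indicator {1..} c + (c + 1 - \<bar>c - 1\<bar>) / (2 * c) = 1"
    using c by (auto simp: indicator_def abs_if field_simps)
  finally have "prob_space (marchenko_pastur c)" by (intro prob_spaceI) simp
  thus ?thesis by (simp add: real_distribution_def real_distribution_axioms_def)
qed

lemma AE_marchenko_pastur_nonneg: "AE x in marchenko_pastur c. x \<ge> 0"
proof (rule AE_I')
  have "emeasure (marchenko_pastur c) {..<0} = (\<integral>\<^sup>+x. indicator {..<0} x \<partial>marchenko_pastur c)"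
    by (intro nn_integral_indicator[symmetric]) simp
  also have "\<dots> = (\<integral>\<^sup>+x. ennreal (marchenko_pastur_density c x) * indicator {..<0} x \<partial>lborel)"
    by (subst nn_integral_marchenko_pastur) simp_all
  also have "\<dots> = (\<integral>\<^sup>+(x::real). 0 \<partial>lborel)"
    using mp_endpoints(1) by (intro nn_integral_cong) (auto simp: mp_density_eq indicator_def)
  finally show "{..<0} \<in> null_sets (marchenko_pastur c)" by auto
qed auto

text \<open>The atom contributes \<open>(c - 1 + |c - 1|)/(2 c t)\<close>, whose absolute value
  cancels that of the continuous part, so one formula covers both \<open>c < 1\<close> and
  \<open>c >= 1\<close>.\<close>

lemma integral_marchenko_pastur_resolvent:
  assumes t: "t > 0"
  shows "(\<integral>x. 1 / (max x 0 + t) \<partial>marchenko_pastur c) = mp_root t / c"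
proof -
  define D where "D = sqrt ((t + 1 - c)\<^sup>2 + 4 * c * t)"
  \<comment> \<open>Makes the continuous part nonnegative, so that adding in \<open>ennreal\<close>
    agrees with adding in the reals.\<close>
  have D: "D \<ge> t + \<bar>c - 1\<bar>"
    unfolding D_def
  proof (rule real_le_rsqrt)
    have "c - 1 + \<bar>c - 1\<bar> \<le> 2 * c" using c by (auto simp: abs_if)
    hence "2 * t * (c - 1 + \<bar>c - 1\<bar>) \<le> 2 * t * (2 * c)" using t by (intro mult_left_mono) auto
    thus "(t + \<bar>c - 1\<bar>)\<^sup>2 \<le> (t + 1 - c)\<^sup>2 + 4 * c * t"
      by (simp add: power2_eq_square algebra_simps)
  qed
  have "(\<integral>\<^sup>+x. ennreal (1 / (max x 0 + t)) \<partial>marchenko_pastur c) =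
    ennreal ((1 - 1 / c) * indicator {1..} c) * ennreal (1 / t) + ennreal ((D - t - \<bar>c - 1\<bar>) / (2 * c * t))"
    unfolding D_def by (subst nn_integral_marchenko_pastur) (simp_all add: mp_resolvent[OF t])
  also have "\<dots> = ennreal ((1 - 1 / c) * indicator {1..} c * (1 / t) + (D - t - \<bar>c - 1\<bar>) / (2 * c * t))"
    using c t D by (subst ennreal_mult''[symmetric], simp, intro ennreal_plus[symmetric])
      (auto simp: indicator_def field_simps)
  also have "(1 - 1 / c) * indicator {1..} c * (1 / t) + (D - t - \<bar>c - 1\<bar>) / (2 * c * t) = (D - (t + 1 - c)) / (2 * t) / c"
    using c t by (auto simp: indicator_def abs_if field_simps)
  also have "\<dots> = mp_root t / c" by (simp add: mp_root_def D_def)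
  finally have "(\<integral>\<^sup>+x. ennreal (1 / (max x 0 + t)) \<partial>marchenko_pastur c) = ennreal (mp_root t / c)" .
  moreover have "mp_root t / c \<ge> 0" using mp_root_equation(1)[OF t] c by simp
  ultimately show ?thesis
    using t by (intro nn_integral_eq_integrable[THEN iffD1, THEN conjunct2]) auto
qed

end

section \<open>A countable criterion for weak convergence\<close>

lemma cts_step_continuous: "a < b \<Longrightarrow> continuous_on UNIV (cts_step a b)"
  by (intro uniformly_continuous_imp_continuous cts_step_uniformly_continuous)

text \<open>Boundedness belongs to the class so that integrability against probability measures is
  automatic, which keeps linear combinations and uniform limits inside.\<close>

definition conv_class :: "(nat \<Rightarrow> real measure) \<Rightarrow> real measure \<Rightarrow> (real \<Rightarrow> real) set" where
  "conv_class N L = {g \<in> borel_measurable borel. (\<exists>B. \<forall>x. \<bar>g x\<bar> \<le> B) \<and>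
     (\<lambda>n. integral\<^sup>L (N n) g) \<longlonglongrightarrow> integral\<^sup>L L g}"

text \<open>The test points are \<open>1 + h\<close> with \<open>h = 1/(k + 1)\<close>. They
  accumulate at 1, and \<open>h = 0\<close> stands for the accumulation point.\<close>

definition inv_shift :: "real \<Rightarrow> real \<Rightarrow> real" where
  "inv_shift h x = 1 / (max x 0 + (1 + h))"

lemma inv_shift_bounds: "h \<ge> 0 \<Longrightarrow> 0 < inv_shift h x" "h \<ge> 0 \<Longrightarrow> inv_shift h x \<le> 1"
  by (auto simp: inv_shift_def divide_simps)

lemma abs_inv_shift_le: "h \<ge> 0 \<Longrightarrow> \<bar>inv_shift h x\<bar> \<le> 1"
  using inv_shift_bounds[of h x] by linarith

lemma inv_shift_measurable [measurable]: "inv_shift h \<in> borel_measurable borel"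
  unfolding inv_shift_def by measurable

lemma inv_shift_resolvent: "h \<ge> 0 \<Longrightarrow> inv_shift 0 x - inv_shift h x = h * (inv_shift 0 x * inv_shift h x)"
proof -
  assume h: "h \<ge> 0"
  have "max x 0 + 1 > 0" "max x 0 + (1 + h) > 0" using h by auto
  thus ?thesis by (simp add: inv_shift_def field_simps)
qed

context
  fixes N :: "nat \<Rightarrow> real measure" and L :: "real measure"
  assumes N: "\<And>n. real_distribution (N n)" and L: "real_distribution L"
begin

lemma real_distribution_integrable:
  assumes "real_distribution K" "g \<in> borel_measurable borel" "\<exists>B. \<forall>x. \<bar>g x :: real\<bar> \<le> B"
  shows "integrable K g"
proof -
  interpret real_distribution K by fact
  from assms(3) obtain B where "\<forall>x. \<bar>g x\<bar> \<le> B" by blast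
  thus ?thesis using assms(2) by (intro integrable_const_bound[of _ B]) auto
qed

lemma conv_class_const: "(\<lambda>_. a) \<in> conv_class N L"
proof -
  have "measure K (space K) = 1" if "real_distribution K" for K
    using that by (simp add: real_distribution_def prob_space.prob_space)
  thus ?thesis using N L by (auto simp: conv_class_def)
qed

lemma conv_class_add:
  assumes "f \<in> conv_class N L" "g \<in> conv_class N L"
  shows "(\<lambda>x. f x + g x) \<in> conv_class N L"
proof -
  from assms obtain A B where AB: "\<forall>x. \<bar>f x\<bar> \<le> A" "\<forall>x. \<bar>g x\<bar> \<le> B" by (auto simp: conv_class_def)
  have "\<bar>f x + g x\<bar> \<le> A + B" for x using AB[rule_format, of x] by linarith
  moreover have "integral\<^sup>L K (\<lambda>x. f x + g x) = integral\<^sup>L K f + integral\<^sup>L K g" if "real_distribution K" for K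
    using assms that by (intro Bochner_Integration.integral_add real_distribution_integrable) (auto simp: conv_class_def)
  ultimately show ?thesis using assms N L by (auto simp: conv_class_def intro!: tendsto_add)
qed

lemma conv_class_cmult:
  assumes "f \<in> conv_class N L"
  shows "(\<lambda>x. a * f x) \<in> conv_class N L"
proof -
  from assms obtain A where A: "\<forall>x. \<bar>f x\<bar> \<le> A" by (auto simp: conv_class_def)
  have "\<bar>a * f x\<bar> \<le> \<bar>a\<bar> * A" for x using A by (simp add: abs_mult mult_left_mono)
  thus ?thesis using assms by (auto simp: conv_class_def intro!: tendsto_mult)
qed

lemma conv_class_sum:
  assumes "\<And>i. i \<in> I \<Longrightarrow> f i \<in> conv_class N L"
  shows "(\<lambda>x. \<Sum>i\<in>I. f i x) \<in> conv_class N L"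
  using assms
proof (induction I rule: infinite_finite_induct)
  case (insert i I)
  thus ?case using conv_class_add[of "f i" "\<lambda>x. \<Sum>i\<in>I. f i x"] by simp
qed (simp_all add: conv_class_const)

lemma conv_class_uniform_limit:
  assumes g: "g \<in> borel_measurable borel"
    and approx: "\<And>e. e > 0 \<Longrightarrow> \<exists>f\<in>conv_class N L. \<forall>x. \<bar>g x - f x\<bar> \<le> e"
  shows "g \<in> conv_class N L"
proof -
  obtain f0 where f0: "f0 \<in> conv_class N L" "\<forall>x. \<bar>g x - f0 x\<bar> \<le> 1" using approx[of 1] by auto
  then obtain A where A: "\<forall>x. \<bar>f0 x\<bar> \<le> A" by (auto simp: conv_class_def)
  have gb: "\<bar>g x\<bar> \<le> A + 1" for x using f0(2)[rule_format, of x] A[rule_format, of x] by linarith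
  have close: "\<bar>integral\<^sup>L K g - integral\<^sup>L K f\<bar> \<le> e"
    if K: "real_distribution K" and f: "f \<in> conv_class N L" "\<forall>x. \<bar>g x - f x\<bar> \<le> e" for K f e
  proof -
    interpret real_distribution K by fact
    have fi: "integrable K f" using f K by (auto simp: conv_class_def intro!: real_distribution_integrable)
    have gi: "integrable K g" using g K gb by (auto intro!: real_distribution_integrable)
    have "\<bar>integral\<^sup>L K g - integral\<^sup>L K f\<bar> = \<bar>integral\<^sup>L K (\<lambda>x. g x - f x)\<bar>" using fi gi by simp
    also have "\<dots> \<le> integral\<^sup>L K (\<lambda>x. \<bar>g x - f x\<bar>)" by (rule integral_abs_bound)
    also have "\<dots> \<le> integral\<^sup>L K (\<lambda>x. e)" using fi gi f(2) by (intro integral_mono) auto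
    also have "\<dots> = e" using prob_space by simp
    finally show ?thesis .
  qed
  have "(\<lambda>n. integral\<^sup>L (N n) g) \<longlonglongrightarrow> integral\<^sup>L L g"
  proof (rule LIMSEQ_I)
    fix r :: real assume r: "r > 0"
    then obtain f where f: "f \<in> conv_class N L" "\<forall>x. \<bar>g x - f x\<bar> \<le> r / 3" using approx[of "r / 3"] by auto
    then obtain n0 where n0: "\<And>n. n \<ge> n0 \<Longrightarrow> norm (integral\<^sup>L (N n) f - integral\<^sup>L L f) < r / 3"
      using LIMSEQ_D[of "\<lambda>n. integral\<^sup>L (N n) f" "integral\<^sup>L L f" "r / 3"] r by (auto simp: conv_class_def)
    have "norm (integral\<^sup>L (N n) g - integral\<^sup>L L g) < r" if "n \<ge> n0" for n
      using close[OF N f, of n] close[OF L f] n0[OF that] by (simp add: abs_if split: if_splits)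
    thus "\<exists>no. \<forall>n\<ge>no. norm (integral\<^sup>L (N n) g - integral\<^sup>L L g) < r" by blast
  qed
  thus ?thesis using g gb by (auto simp: conv_class_def)
qed

text \<open>Powers of \<open>1 / (1 + x)\<close> are obtained one at a time: dividing differences of
  \<open>u\<^sup>j\<close> and \<open>u\<^sup>j / (1 + h u)\<close> by \<open>h\<close> raises the exponent, and \<open>h \<rightarrow> 0\<close> removes the denominator.\<close>

lemma conv_class_power:
  assumes base: "\<And>k. inv_shift (1 / real (Suc k)) \<in> conv_class N L"
  shows "(\<lambda>x. inv_shift 0 x ^ j) \<in> conv_class N L"
proof -
  have step: "(\<lambda>x. inv_shift 0 x ^ Suc j) \<in> conv_class N L"
    if "\<And>k. (\<lambda>x. inv_shift 0 x ^ j * inv_shift (1 / real (Suc k)) x) \<in> conv_class N L" for j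
  proof (rule conv_class_uniform_limit)
    fix e :: real assume "e > 0"
    then obtain k where k: "inverse (real (Suc k)) < e" using reals_Archimedean by blast
    let ?h = "1 / real (Suc k)"
    have "\<bar>inv_shift 0 x ^ Suc j - inv_shift 0 x ^ j * inv_shift ?h x\<bar> \<le> e" for x
    proof -
      have "inv_shift 0 x ^ Suc j - inv_shift 0 x ^ j * inv_shift ?h x = inv_shift 0 x ^ j * (inv_shift 0 x - inv_shift ?h x)"
        by (simp add: algebra_simps)
      also have "\<dots> = ?h * (inv_shift 0 x ^ j * inv_shift 0 x * inv_shift ?h x)"
        by (subst inv_shift_resolvent) simp_all
      finally have eq: "inv_shift 0 x ^ Suc j - inv_shift 0 x ^ j * inv_shift ?h x = ?h * (inv_shift 0 x ^ Suc j * inv_shift ?h x)"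
        by (simp add: mult_ac)
      have "0 \<le> inv_shift 0 x ^ Suc j" "inv_shift 0 x ^ Suc j \<le> 1"
        using inv_shift_bounds[of 0 x] by (simp, intro power_le_one) auto
      moreover have "0 \<le> inv_shift ?h x" "inv_shift ?h x \<le> 1" using inv_shift_bounds[of ?h x] by auto
      ultimately have "0 \<le> inv_shift 0 x ^ Suc j * inv_shift ?h x" "inv_shift 0 x ^ Suc j * inv_shift ?h x \<le> 1"
        by (auto intro!: mult_nonneg_nonneg mult_le_one)
      hence "\<bar>inv_shift 0 x ^ Suc j * inv_shift ?h x\<bar> \<le> 1" by linarith
      hence "\<bar>?h * (inv_shift 0 x ^ Suc j * inv_shift ?h x)\<bar> \<le> ?h * 1"
        by (subst abs_mult) (intro mult_mono, auto)
      also have "\<dots> \<le> e" using k by (simp add: divide_inverse)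
      finally show ?thesis unfolding eq .
    qed
    with that[of k] show "\<exists>f\<in>conv_class N L. \<forall>x. \<bar>inv_shift 0 x ^ Suc j - f x\<bar> \<le> e"
      by (intro bexI[of _ "\<lambda>x. inv_shift 0 x ^ j * inv_shift ?h x"] allI)
  qed simp
  have mixed: "(\<lambda>x. inv_shift 0 x ^ j * inv_shift (1 / real (Suc k)) x) \<in> conv_class N L" for j k
  \<comment> \<open>\<open>k\<close> stays arbitrary because \<open>step\<close>, which supplies the
    next power, consumes the mixed products for every \<open>k\<close>.\<close>
  proof (induction j arbitrary: k)
    case 0
    thus ?case using base by simp
  next
    case (Suc j)
    let ?h = "1 / real (Suc k)"
    have "(\<lambda>x. real (Suc k) * (inv_shift 0 x ^ Suc j + (-1) * (inv_shift 0 x ^ j * inv_shift ?h x))) \<in> conv_class N L"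
      by (intro conv_class_cmult conv_class_add step Suc)
    also have "(\<lambda>x. real (Suc k) * (inv_shift 0 x ^ Suc j + (-1) * (inv_shift 0 x ^ j * inv_shift ?h x))) =
      (\<lambda>x. inv_shift 0 x ^ Suc j * inv_shift ?h x)"
    proof
      fix x
      have "inv_shift 0 x ^ Suc j + (-1) * (inv_shift 0 x ^ j * inv_shift ?h x) = inv_shift 0 x ^ j * (inv_shift 0 x - inv_shift ?h x)"
        by (simp add: algebra_simps)
      also have "\<dots> = ?h * (inv_shift 0 x ^ Suc j * inv_shift ?h x)"
        by (subst inv_shift_resolvent) (simp_all add: mult_ac)
      finally show "real (Suc k) * (inv_shift 0 x ^ Suc j + (-1) * (inv_shift 0 x ^ j * inv_shift ?h x)) =
        inv_shift 0 x ^ Suc j * inv_shift ?h x" by simp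
    qed
    finally show ?case .
  qed
  show ?thesis using step[OF mixed] conv_class_const[of 1] by (cases j) auto
qed

text \<open>The substitution \<open>u = 1/(1 + z)\<close> maps the half line into
  \<open>[0, 1]\<close>. A continuous step becomes a continuous function of \<open>u\<close>,
  Weierstrass approximates it by polynomials in \<open>u\<close>, and
  \<open>conv_class_power\<close> covers those. Both directions are proved since the criterion also
  has to describe the event of weak convergence exactly.\<close>

lemma weak_conv_m_inv_shift:
  assumes nonneg: "\<And>n. AE x in N n. x \<ge> 0" "AE x in L. x \<ge> 0"
  shows "weak_conv_m N L \<longleftrightarrow> (\<forall>k. (\<lambda>n. integral\<^sup>L (N n) (inv_shift (1 / real (Suc k))))
     \<longlonglongrightarrow> integral\<^sup>L L (inv_shift (1 / real (Suc k))))"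
proof (intro iffI allI)
  fix k assume "weak_conv_m N L"
  thus "(\<lambda>n. integral\<^sup>L (N n) (inv_shift (1 / real (Suc k)))) \<longlonglongrightarrow> integral\<^sup>L L (inv_shift (1 / real (Suc k)))"
  proof (rule weak_conv_imp_integral_bdd_continuous_conv[OF N L, where B = 1])
    have "continuous_on UNIV (inv_shift (1 / real (Suc k)))"
      unfolding inv_shift_def by (intro continuous_intros) (auto simp: add_nonneg_eq_0_iff add_pos_nonneg less_imp_neq[symmetric])
    thus "isCont (inv_shift (1 / real (Suc k))) x" for x by (simp add: continuous_on_eq_continuous_at)
    show "norm (inv_shift (1 / real (Suc k)) x) \<le> 1" for x
      using abs_inv_shift_le[of "1 / real (Suc k)" x] by simp
  qed
next
  assume lim: "\<forall>k. (\<lambda>n. integral\<^sup>L (N n) (inv_shift (1 / real (Suc k)))) \<longlonglongrightarrow> integral\<^sup>L L (inv_shift (1 / real (Suc k)))"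
  have base: "inv_shift (1 / real (Suc k)) \<in> conv_class N L" for k
    using lim unfolding conv_class_def by (auto intro!: exI[of _ 1] abs_inv_shift_le)
  show "weak_conv_m N L"
  proof (rule integral_cts_step_conv_imp_weak_conv[OF N L])
    fix x y :: real assume xy: "x < y"
    \<comment> \<open>\<open>d\<close> is the value of \<open>u\<close> at
      \<open>z = max y 0\<close>. Cutting \<open>u\<close> off at \<open>d\<close> avoids the pole
      of \<open>1/u - 1\<close> and loses nothing, because the step is 0 from \<open>y\<close>
      on.\<close>
    define d where "d = 1 / (1 + max y 0)"
    have d: "d > 0" by (auto simp: d_def)
    define G where "G = (\<lambda>u. cts_step x y (1 / max u d - 1))"
    have contG: "continuous_on UNIV G" unfolding G_def using d
      by (intro continuous_on_compose2[OF cts_step_continuous[OF xy]] continuous_intros) (auto simp: max_def)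
    define g where "g = (\<lambda>z. G (inv_shift 0 z))"
    have gm: "g \<in> borel_measurable borel" unfolding g_def
      by (intro measurable_compose[OF _ borel_measurable_continuous_onI[OF contG]]) simp
    have "g \<in> conv_class N L"
    proof (rule conv_class_uniform_limit[OF gm])
      fix e :: real assume e: "e > 0"
      obtain q where q: "real_polynomial_function q" "\<And>u. u \<in> {0..1} \<Longrightarrow> \<bar>G u - q u\<bar> < e"
        using Stone_Weierstrass_real_polynomial_function[of "{0..1}" G e] e contG continuous_on_subset[OF contG] by auto
      then obtain a m where am: "q = (\<lambda>u. \<Sum>i\<le>m. a i * u ^ i)" by (auto simp: real_polynomial_function_iff_sum)
      have "(\<lambda>z. q (inv_shift 0 z)) \<in> conv_class N L"
        unfolding am by (intro conv_class_sum conv_class_cmult conv_class_power base)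
      moreover have "\<bar>g z - q (inv_shift 0 z)\<bar> \<le> e" for z
        using q(2)[of "inv_shift 0 z"] inv_shift_bounds[of 0 z] by (auto simp: g_def)
      ultimately show "\<exists>f\<in>conv_class N L. \<forall>x. \<bar>g x - f x\<bar> \<le> e"
        by (intro bexI[of _ "\<lambda>z. q (inv_shift 0 z)"] allI)
    qed
    moreover have eq: "g z = cts_step x y z" if "z \<ge> 0" for z
    proof (cases "inv_shift 0 z \<ge> d")
      case True
      have "1 / max (inv_shift 0 z) d - 1 = z" using True that by (simp add: max_def inv_shift_def)
      thus ?thesis by (simp add: g_def G_def)
    next
      case False
      hence "z > max y 0" using that by (auto simp: d_def inv_shift_def field_simps max_def split: if_splits)
      moreover have "1 / max (inv_shift 0 z) d - 1 = max y 0" using False by (simp add: d_def)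
      ultimately show ?thesis using xy by (auto simp: g_def G_def cts_step_def)
    qed
    moreover have "integral\<^sup>L K g = integral\<^sup>L K (cts_step x y)" if "real_distribution K" "AE z in K. z \<ge> 0" for K
    proof (rule integral_cong_AE)
      interpret real_distribution K by fact
      show "g \<in> borel_measurable K" using gm by simp
      show "cts_step x y \<in> borel_measurable K"
        using borel_measurable_continuous_onI[OF cts_step_continuous[OF xy]] by simp
      show "AE z in K. g z = cts_step x y z" using that(2) by (rule AE_mp) (auto simp: eq)
    qed
    ultimately show "(\<lambda>n. integral\<^sup>L (N n) (cts_step x y)) \<longlonglongrightarrow> integral\<^sup>L L (cts_step x y)"
      using N L nonneg by (auto simp: conv_class_def)
  qed
qed

end

section \<open>Empirical measures as images of uniform laws\<close>

lemma empirical_measure_distr: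
  assumes "p > 0"
  shows "empirical_measure p y = distr (measure_pmf (pmf_of_set {1..p})) borel y"
proof (rule measure_eqI)
  have sets: "sets (empirical_measure p y) = sets borel"
    using sets.sigma_sets_eq[of "borel :: real measure"] by (simp add: empirical_measure_def)
  thus "sets (empirical_measure p y) = sets (distr (measure_pmf (pmf_of_set {1..p})) borel y)" by simp
  fix A assume "A \<in> sets (empirical_measure p y)"
  hence A: "A \<in> sets borel" using sets by simp
  have "(\<Sum>j=1..p. emeasure (return borel (y j)) A) = (\<Sum>j=1..p. if y j \<in> A then 1 else 0)"
    using A by (intro sum.cong refl) (auto simp: indicator_def)
  also have "\<dots> = of_nat (card ({1..p} \<inter> y -` A))"
    by (simp add: sum.If_cases vimage_def)
  finally have "emeasure (empirical_measure p y) A = ennreal (1 / real p) * of_nat (card ({1..p} \<inter> y -` A))"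
    using A by (simp add: emeasure_empirical_measure)
  also have "\<dots> = ennreal (card ({1..p} \<inter> y -` A) / real p)"
    using assms by (simp add: ennreal_of_nat_eq_real_of_nat ennreal_mult[symmetric])
  also have "\<dots> = emeasure (distr (measure_pmf (pmf_of_set {1..p})) borel y) A"
    using assms A by (simp add: emeasure_distr emeasure_pmf_of_set)
  finally show "emeasure (empirical_measure p y) A = emeasure (distr (measure_pmf (pmf_of_set {1..p})) borel y) A" .
qed

lemma real_distribution_empirical_measure:
  assumes "p > 0"
  shows "real_distribution (empirical_measure p y)"
  unfolding empirical_measure_distr[OF assms]
  by (auto simp: real_distribution_def real_distribution_axioms_def intro!: prob_space.prob_space_distr measure_pmf.prob_space_axioms)

lemma integral_empirical_measure:
  assumes "p > 0" "g \<in> borel_measurable borel"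
  shows "(\<integral>x. g x \<partial>empirical_measure p y) = (\<Sum>j=1..p. g (y j) :: real) / real p"
  unfolding empirical_measure_distr[OF assms(1)]
  using assms by (subst integral_distr) (auto simp: integral_pmf_of_set)

lemma AE_empirical_measure_nonneg:
  assumes "p > 0" "\<And>j. j \<in> {1..p} \<Longrightarrow> y j \<ge> 0"
  shows "AE x in empirical_measure p y. x \<ge> 0"
  unfolding empirical_measure_distr[OF assms(1)]
  using assms by (subst AE_distr_iff) (auto simp: AE_measure_pmf_iff)

section \<open>Quadratic forms in independent variables\<close>

lemma cnj_measurable [measurable]: "cnj \<in> borel_measurable borel"
  by (intro borel_measurable_continuous_onI continuous_intros)

text \<open>Being measurable for this sigma-algebra replaces exhibiting a quantity as a function of
  the variables with index in \<open>A\<close>; a resolvent is thus never rewritten in terms of its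
  entries.\<close>

definition generated :: "'a measure \<Rightarrow> ('i \<Rightarrow> 'a \<Rightarrow> complex) \<Rightarrow> 'i set \<Rightarrow> 'a measure" where
  "generated M Y A = vimage_algebra (space M) (\<lambda>w. restrict (\<lambda>i. Y i w) A) (PiM A (\<lambda>_. borel))"

lemma measurable_generated: "i \<in> A \<Longrightarrow> Y i \<in> borel_measurable (generated M Y A)"
proof -
  assume i: "i \<in> A"
  have "(\<lambda>w. restrict (\<lambda>i. Y i w) A) \<in> measurable (generated M Y A) (PiM A (\<lambda>_. borel))"
    unfolding generated_def by (rule measurable_vimage_algebra1) (auto simp: space_PiM)
  from measurable_compose[OF this measurable_component_singleton[OF i]] show ?thesis using i by simp
qed

context prob_space
begin

text \<open>Disjoint groups of independent variables are jointly independent, and the sigma-algebras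
  of \<open>f\<close> and \<open>h\<close> lie in those of the two groups.\<close>

lemma indep_var_generated:
  assumes ind: "indep_vars (\<lambda>_. borel) Y UNIV" and AB: "A \<inter> B = {}"
    and f: "f \<in> borel_measurable (generated M Y A)" and h: "h \<in> borel_measurable (generated M Y B)"
  shows "indep_var borel (f :: 'a \<Rightarrow> complex) borel (h :: 'a \<Rightarrow> complex)"
proof -
  let ?Y = "\<lambda>A w. restrict (\<lambda>i. Y i w) A" and ?P = "\<lambda>A. PiM A (\<lambda>_. borel :: complex measure)"
  let ?S = "\<lambda>A. sigma_sets (space M) {?Y A -` D \<inter> space M | D. D \<in> sets (?P A)}"
  have sub: "sigma_sets (space M) {g -` D \<inter> space M | D. D \<in> sets (borel :: complex measure)} \<subseteq> ?S C"
    if "g \<in> borel_measurable (generated M Y C)" for g :: "'a \<Rightarrow> complex" and C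
  proof -
    have sp: "?Y C \<in> space M \<rightarrow> space (?P C)" by (auto simp: space_PiM)
    have "g -` D \<inter> space M \<in> ?S C" if "D \<in> sets borel" for D
    proof -
      have "g -` D \<inter> space (generated M Y C) \<in> sets (generated M Y C)"
        using that \<open>g \<in> _\<close> by (rule measurable_sets[rotated])
      hence "g -` D \<inter> space M \<in> sets (generated M Y C)" by (simp add: generated_def)
      thus ?thesis unfolding generated_def sets_vimage_algebra2[OF sp] by (intro sigma_sets.Basic)
    qed
    thus ?thesis by (intro sigma_sets_mono) auto
  qed
  have I: "indep_var (?P A) (?Y A) (?P B) (?Y B)"
    by (rule indep_var_restrict[OF ind AB]) auto
  hence S: "indep_set (?S A) (?S B)" and rv: "random_variable (?P A) (?Y A)" "random_variable (?P B) (?Y B)"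
    unfolding indep_var_eq by blast+
  have meas: "random_variable borel g" if "g \<in> borel_measurable (generated M Y C)" "random_variable (?P C) (?Y C)"
    for g :: "'a \<Rightarrow> complex" and C
  proof (rule measurableI)
    fix D :: "complex set" assume "D \<in> sets borel"
    hence "g -` D \<inter> space M \<in> ?S C" using sub[OF that(1)] by (auto intro: sigma_sets.Basic)
    moreover have "?S C \<subseteq> events"
      using that(2) by (intro sets.sigma_sets_subset) (auto intro: measurable_sets)
    ultimately show "g -` D \<inter> space M \<in> events" by blast
  qed simp
  show ?thesis
    unfolding indep_var_eq
  proof (intro conjI meas[OF f rv(1)] meas[OF h rv(2)])
    show "indep_set (sigma_sets (space M) {f -` D \<inter> space M | D. D \<in> sets borel})
      (sigma_sets (space M) {h -` D \<inter> space M | D. D \<in> sets borel})"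
      using S sub[OF f] sub[OF h] unfolding indep_sets2_eq by (meson subset_iff subset_trans)
  qed
qed

text \<open>The device that kills cross terms: one centred function of a single variable is split
  off, and all the rest only has to be measurable in the other variables.\<close>

lemma expectation_generated_zero:
  assumes ind: "indep_vars (\<lambda>_. borel) Y UNIV"
    and h: "h \<in> borel_measurable (generated M Y (- {a}))" "\<And>w. w \<in> space M \<Longrightarrow> cmod (h w) \<le> H"
    and f: "f \<in> borel_measurable borel" "\<And>w. w \<in> space M \<Longrightarrow> cmod (f (Y a w)) \<le> F"
    and zero: "expectation (\<lambda>w. f (Y a w)) = 0"
  shows "expectation (\<lambda>w. f (Y a w) * h w) = (0 :: complex)"
proof -
  have f': "(\<lambda>w. f (Y a w)) \<in> borel_measurable (generated M Y {a})"
    by (rule measurable_compose[OF measurable_generated f(1)]) simp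
  have I: "indep_var borel (\<lambda>w. f (Y a w)) borel h"
    by (rule indep_var_generated[OF ind _ f' h(1)]) auto
  hence rv: "random_variable borel (\<lambda>w. f (Y a w))" "random_variable borel h" by (auto simp: indep_var_eq)
  have "expectation (\<lambda>w. f (Y a w) * h w) = expectation (\<lambda>w. f (Y a w)) * expectation h"
    by (intro indep_var_lebesgue_integral I integrable_const_bound[of _ F] integrable_const_bound[of _ H])
      (use rv f(2) h(2) in auto)
  thus ?thesis using zero by simp
qed

text \<open>The form minus the trace is a sum of terms \<open>V\<close> indexed by pairs. Two of
  them are orthogonal unless their pairs are equal or transposed, so each pair meets at most two
  others in the double sum, itself included; with \<open>|V| <= K |B|\<close> this leaves
  \<open>2 K^2\<close> times the squared Frobenius norm. \<open>B\<close> may be random: its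
  independence is asked against one entry of the column at a time, since each cancellation isolates
  one entry.\<close>

lemma quadratic_form_variance:
  fixes Y :: "nat \<times> nat \<Rightarrow> 'a \<Rightarrow> complex" and B :: "'a \<Rightarrow> nat \<Rightarrow> nat \<Rightarrow> complex"
  assumes ind: "indep_vars (\<lambda>_. borel) Y UNIV"
    and bound: "\<And>a w. w \<in> space M \<Longrightarrow> cmod (Y a w) \<le> C"
    and mean: "\<And>a. expectation (Y a) = 0"
    and var: "\<And>a. expectation (\<lambda>w. (cmod (Y a w))\<^sup>2) = 1"
    and B: "\<And>i j a. i < m \<Longrightarrow> j < m \<Longrightarrow> (\<lambda>w. B w i j) \<in> borel_measurable (generated M Y (- {(a, l)}))"
    and Bb: "\<And>i j w. i < m \<Longrightarrow> j < m \<Longrightarrow> w \<in> space M \<Longrightarrow> cmod (B w i j) \<le> b"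
    and Bs: "\<And>w. w \<in> space M \<Longrightarrow> (\<Sum>i<m. \<Sum>j<m. (cmod (B w i j))\<^sup>2) \<le> \<beta>"
  shows "(\<lambda>w. (cmod (column_form (\<lambda>i l. Y (i, l) w) m l (B w) - (\<Sum>i<m. B w i i)))\<^sup>2) \<in> borel_measurable M"
    and "expectation (\<lambda>w. (cmod (column_form (\<lambda>i l. Y (i, l) w) m l (B w) - (\<Sum>i<m. B w i i)))\<^sup>2) \<le> 2 * (C\<^sup>2 + 1)\<^sup>2 * \<beta>"
    and "\<And>w. w \<in> space M \<Longrightarrow> (cmod (column_form (\<lambda>i l. Y (i, l) w) m l (B w) - (\<Sum>i<m. B w i i)))\<^sup>2 \<le> (real m * real m * (b * (C\<^sup>2 + 1)))\<^sup>2"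
proof -
  define P where "P = {..<m} \<times> {..<m}"
  \<comment> \<open>The Kronecker delta centres the diagonal terms, as the entries have second
    moment 1, and accounts for the trace of \<open>B\<close>.\<close>
  define w where "w = (\<lambda>(i, j) \<omega>. cnj (Y (i, l) \<omega>) * Y (j, l) \<omega> - (if i = j then 1 else 0))"
  define V where "V = (\<lambda>q \<omega>. B \<omega> (fst q) (snd q) * w q \<omega>)"
  define S where "S = (\<lambda>\<omega>. \<Sum>q\<in>P. V q \<omega>)"
  define K where "K = C\<^sup>2 + 1"
  have Ym [measurable]: "random_variable borel (Y a)" for a using ind unfolding indep_vars_def by blast
  have YG: "Y a' \<in> borel_measurable (generated M Y (- {a}))" if "a' \<noteq> a" for a a'
    by (rule measurable_generated) (use that in simp)
  \<comment> \<open>Independence from a constant on the empty index set yields plain measurability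
    on \<open>M\<close>.\<close>
  have genM: "g \<in> borel_measurable M" if "g \<in> borel_measurable (generated M Y D)" for g :: "'a \<Rightarrow> complex" and D
    using indep_var_generated[OF ind, of "{}" D "\<lambda>_. 0" g] that by (auto simp: indep_var_eq)
  have Bm: "(\<lambda>\<omega>. B \<omega> i j) \<in> borel_measurable M" if "i < m" "j < m" for i j
    by (rule genM[OF B[OF that, of 0]])
  have Seq: "S \<omega> = column_form (\<lambda>i l. Y (i, l) \<omega>) m l (B \<omega>) - (\<Sum>i<m. B \<omega> i i)" for \<omega>
  proof -
    have "S \<omega> = (\<Sum>i<m. \<Sum>j<m. V (i, j) \<omega>)"
      unfolding S_def P_def by (simp add: sum.cartesian_product case_prod_unfold)
    also have "\<dots> = (\<Sum>i<m. \<Sum>j<m. cnj (Y (i, l) \<omega>) * B \<omega> i j * Y (j, l) \<omega> - (if i = j then 1 else 0) * B \<omega> i j)"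
      by (intro sum.cong refl) (simp add: V_def w_def algebra_simps)
    also have "\<dots> = column_form (\<lambda>i l. Y (i, l) \<omega>) m l (B \<omega>) - (\<Sum>i<m. \<Sum>j<m. (if i = j then 1 else 0) * B \<omega> i j)"
      by (simp add: sum_subtractf column_form_def)
    also have "(\<Sum>i<m. \<Sum>j<m. (if i = j then 1 else 0) * B \<omega> i j) = (\<Sum>i<m. B \<omega> i i)"
      by (intro sum.cong refl sum_delta_mult(1)) simp
    finally show ?thesis .
  qed
  have C: "C \<ge> 0"
  proof -
    obtain \<omega> where "\<omega> \<in> space M" using not_empty by blast
    from order_trans[OF norm_ge_zero bound[OF this]] show ?thesis .
  qed
  have wb: "cmod (w q \<omega>) \<le> K" if "\<omega> \<in> space M" for q \<omega>
  proof -
    obtain i j where q: "q = (i, j)" by (cases q)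
    have "cmod (w q \<omega>) \<le> cmod (cnj (Y (i, l) \<omega>) * Y (j, l) \<omega>) + cmod (if i = j then 1 else 0)"
      unfolding w_def q prod.case by (rule norm_triangle_ineq4)
    also have "\<dots> \<le> C * C + 1"
      unfolding norm_mult complex_mod_cnj using C by (intro add_mono mult_mono bound that) auto
    finally show ?thesis by (simp add: K_def power2_eq_square)
  qed
  have K: "K \<ge> 0" by (simp add: K_def)
  have Vb2: "cmod (V q \<omega>) \<le> K * cmod (B \<omega> (fst q) (snd q))" if "\<omega> \<in> space M" for q \<omega>
    unfolding V_def norm_mult using wb[OF that, of q] by (subst mult.commute) (intro mult_right_mono, auto)
  have Vb: "cmod (V q \<omega>) \<le> b * K" if "\<omega> \<in> space M" "q \<in> P" for q \<omega>
  proof -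
    have "K * cmod (B \<omega> (fst q) (snd q)) \<le> K * b"
      using that K by (intro mult_left_mono Bb) (auto simp: P_def)
    with Vb2[OF that(1), of q] show ?thesis by (simp add: mult.commute)
  qed
  have wm: "w q \<in> borel_measurable M" for q unfolding w_def by (cases q) simp
  have Vm: "V q \<in> borel_measurable M" if "q \<in> P" for q
    unfolding V_def using that by (intro borel_measurable_times wm Bm) (auto simp: P_def)
  have wG: "w (i, j) \<in> borel_measurable (generated M Y (- {(a, l)}))" if "a \<noteq> i" "a \<noteq> j" for i j a
    using YG[of "(i, l)" "(a, l)"] YG[of "(j, l)" "(a, l)"] that unfolding w_def by simp
  have VG: "V (i, j) \<in> borel_measurable (generated M Y (- {(a, l)}))" if "(i, j) \<in> P" "a \<noteq> i" "a \<noteq> j" for i j a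
    unfolding V_def using that by (intro borel_measurable_times wG B) (auto simp: P_def)
  have cnjG: "(\<lambda>\<omega>. cnj (g \<omega>)) \<in> borel_measurable N" if "g \<in> borel_measurable N" for g :: "'a \<Rightarrow> complex" and N
    using that by measurable
  have VV: "V (i, j) \<omega> = B \<omega> i j * (cnj (Y (i, l) \<omega>) * Y (j, l) \<omega> - (if i = j then 1 else 0))" for i j \<omega>
    by (simp add: V_def w_def)
  \<comment> \<open>Either an index of an off-diagonal pair is absent from the other pair, or both
    pairs are diagonal and distinct. In each case one centred factor splits off.\<close>
  have Z: "expectation (\<lambda>\<omega>. V (i, j) \<omega> * cnj (V (k, k') \<omega>)) = 0"
    if ij: "(i, j) \<in> P" and kk: "(k, k') \<in> P"
      and c: "i \<noteq> j \<and> i \<notin> {k, k'} \<or> i \<noteq> j \<and> j \<notin> {k, k'} \<or> i = j \<and> k = k' \<and> i \<noteq> k" for i j k k'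
    using c
  proof (elim disjE conjE)
    assume a: "i \<noteq> j" "i \<notin> {k, k'}"
    have "expectation (\<lambda>\<omega>. cnj (Y (i, l) \<omega>) * (B \<omega> i j * Y (j, l) \<omega> * cnj (V (k, k') \<omega>))) = 0"
    proof (rule expectation_generated_zero[OF ind, where H = "b * C * (b * K)"])
      show "(\<lambda>\<omega>. B \<omega> i j * Y (j, l) \<omega> * cnj (V (k, k') \<omega>)) \<in> borel_measurable (generated M Y (- {(i, l)}))"
        using ij kk a by (intro borel_measurable_times cnjG VG B YG) (auto simp: P_def)
      show "cmod (B \<omega> i j * Y (j, l) \<omega> * cnj (V (k, k') \<omega>)) \<le> b * C * (b * K)" if "\<omega> \<in> space M" for \<omega>
        unfolding norm_mult complex_mod_cnj
        using Bb[of i j \<omega>] bound[OF that, of "(j, l)"] Vb[OF that kk] ij C that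
          order_trans[OF norm_ge_zero Bb[of i j \<omega>]]
        by (intro mult_mono) (auto simp: P_def)
      show "expectation (\<lambda>\<omega>. cnj (Y (i, l) \<omega>)) = 0" by (simp add: mean)
    qed (use bound in auto)
    moreover have "V (i, j) \<omega> * cnj (V (k, k') \<omega>) = cnj (Y (i, l) \<omega>) * (B \<omega> i j * Y (j, l) \<omega> * cnj (V (k, k') \<omega>))" for \<omega>
      using a by (simp add: VV[of i j] mult_ac)
    ultimately show ?thesis by (simp only:)
  next
    assume a: "i \<noteq> j" "j \<notin> {k, k'}"
    have "expectation (\<lambda>\<omega>. Y (j, l) \<omega> * (B \<omega> i j * cnj (Y (i, l) \<omega>) * cnj (V (k, k') \<omega>))) = 0"
    proof (rule expectation_generated_zero[OF ind, where f = "\<lambda>z. z" and H = "b * C * (b * K)"])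
      show "(\<lambda>\<omega>. B \<omega> i j * cnj (Y (i, l) \<omega>) * cnj (V (k, k') \<omega>)) \<in> borel_measurable (generated M Y (- {(j, l)}))"
        using ij kk a by (intro borel_measurable_times cnjG VG B YG) (auto simp: P_def)
      show "cmod (B \<omega> i j * cnj (Y (i, l) \<omega>) * cnj (V (k, k') \<omega>)) \<le> b * C * (b * K)" if "\<omega> \<in> space M" for \<omega>
        unfolding norm_mult complex_mod_cnj
        using Bb[of i j \<omega>] bound[OF that, of "(i, l)"] Vb[OF that kk] ij C that
          order_trans[OF norm_ge_zero Bb[of i j \<omega>]]
        by (intro mult_mono) (auto simp: P_def)
    qed (use bound mean in auto)
    moreover have "V (i, j) \<omega> * cnj (V (k, k') \<omega>) = Y (j, l) \<omega> * (B \<omega> i j * cnj (Y (i, l) \<omega>) * cnj (V (k, k') \<omega>))" for \<omega>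
      using a by (simp add: VV[of i j] mult_ac)
    ultimately show ?thesis by (simp only:)
  next
    assume a: "i = j" "k = k'" "i \<noteq> k"
    have "expectation (\<lambda>\<omega>. (cnj (Y (i, l) \<omega>) * Y (i, l) \<omega> - 1) * (B \<omega> i j * cnj (V (k, k') \<omega>))) = 0"
    proof (rule expectation_generated_zero[OF ind, where f = "\<lambda>z. cnj z * z - 1" and H = "b * (b * K)"])
      show "(\<lambda>\<omega>. B \<omega> i j * cnj (V (k, k') \<omega>)) \<in> borel_measurable (generated M Y (- {(i, l)}))"
        using ij kk a by (intro borel_measurable_times cnjG VG B) (auto simp: P_def)
      show "cmod (B \<omega> i j * cnj (V (k, k') \<omega>)) \<le> b * (b * K)" if "\<omega> \<in> space M" for \<omega>
        unfolding norm_mult complex_mod_cnj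
        using Bb[of i j \<omega>] Vb[OF that kk] ij that order_trans[OF norm_ge_zero Bb[of i j \<omega>]]
        by (intro mult_mono) (auto simp: P_def)
      show "cmod (cnj (Y (i, l) \<omega>) * Y (i, l) \<omega> - 1) \<le> K" if "\<omega> \<in> space M" for \<omega>
        using wb[OF that, of "(i, i)"] by (simp add: w_def)
      have "integrable M (\<lambda>\<omega>. (cmod (Y (i, l) \<omega>))\<^sup>2)"
        using var[of "(i, l)"] not_integrable_integral_eq by fastforce
      hence "expectation (\<lambda>\<omega>. complex_of_real ((cmod (Y (i, l) \<omega>))\<^sup>2 - 1)) = 0"
        by (simp only: integral_complex_of_real) (simp add: var prob_space)
      thus "expectation (\<lambda>\<omega>. cnj (Y (i, l) \<omega>) * Y (i, l) \<omega> - 1) = 0"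
        by (simp add: complex_norm_square mult.commute del: of_real_power)
    qed simp
    moreover have "V (i, j) \<omega> * cnj (V (k, k') \<omega>) = (cnj (Y (i, l) \<omega>) * Y (i, l) \<omega> - 1) * (B \<omega> i j * cnj (V (k, k') \<omega>))" for \<omega>
      using a by (simp add: VV[of j j] mult_ac)
    ultimately show ?thesis by (simp only:)
  qed
  have Zero: "expectation (\<lambda>\<omega>. V q \<omega> * cnj (V r \<omega>)) = 0"
    if q: "q \<in> P" and r: "r \<in> P" and ne: "r \<noteq> q" "r \<noteq> prod.swap q" for q r
  proof -
    obtain i j where q': "q = (i, j)" by (cases q)
    obtain k k' where r': "r = (k, k')" by (cases r)
    show ?thesis
    proof (cases "i \<noteq> j \<and> i \<notin> {k, k'} \<or> i \<noteq> j \<and> j \<notin> {k, k'} \<or> i = j \<and> k = k' \<and> i \<noteq> k")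
      case True
      thus ?thesis using Z q r unfolding q' r' by blast
    next
      case False
      \<comment> \<open>Now the other pair owns an index; conjugating the expectation exchanges the
        two.\<close>
      hence "k \<noteq> k' \<and> k \<notin> {i, j} \<or> k \<noteq> k' \<and> k' \<notin> {i, j}" using ne unfolding q' r' by auto
      hence "expectation (\<lambda>\<omega>. V r \<omega> * cnj (V q \<omega>)) = 0" using Z[of k k' i j] q r unfolding q' r' by blast
      hence "expectation (\<lambda>\<omega>. cnj (V r \<omega> * cnj (V q \<omega>))) = 0"
        unfolding Bochner_Integration.integral_cnj by simp
      thus ?thesis by (simp add: mult.commute)
    qed
  qed
  have finP: "finite P" by (simp add: P_def)
  have VVi: "integrable M (\<lambda>\<omega>. V q \<omega> * cnj (V r \<omega>))" if "q \<in> P" "r \<in> P" for q r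
  proof (rule integrable_const_bound[of _ "(b * K) * (b * K)"])
    show "(\<lambda>\<omega>. V q \<omega> * cnj (V r \<omega>)) \<in> borel_measurable M" using Vm that by (intro borel_measurable_times cnjG)
    have "cmod (V q \<omega> * cnj (V r \<omega>)) \<le> b * K * (b * K)" if "\<omega> \<in> space M" for \<omega>
      unfolding norm_mult complex_mod_cnj
      using Vb[OF that \<open>q \<in> P\<close>] Vb[OF that \<open>r \<in> P\<close>] order_trans[OF norm_ge_zero Vb[OF that \<open>q \<in> P\<close>]]
      by (intro mult_mono) auto
    thus "AE \<omega> in M. norm (V q \<omega> * cnj (V r \<omega>)) \<le> b * K * (b * K)" by (auto intro: AE_I2)
  qed
  have V2i: "integrable M (\<lambda>\<omega>. (cmod (V q \<omega>))\<^sup>2)" if "q \<in> P" for q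
    using integrable_norm[OF VVi[OF that that]] by (simp add: norm_mult power2_eq_square)
  define e where "e = (\<lambda>q. expectation (\<lambda>\<omega>. (cmod (V q \<omega>))\<^sup>2))"
  have VVe: "cmod (expectation (\<lambda>\<omega>. V q \<omega> * cnj (V r \<omega>))) \<le> (e q + e r) / 2" if "q \<in> P" "r \<in> P" for q r
  proof -
    have "cmod (expectation (\<lambda>\<omega>. V q \<omega> * cnj (V r \<omega>))) \<le> expectation (\<lambda>\<omega>. cmod (V q \<omega> * cnj (V r \<omega>)))"
      by (rule integral_norm_bound)
    also have "\<dots> \<le> expectation (\<lambda>\<omega>. (cmod (V q \<omega>))\<^sup>2 / 2 + (cmod (V r \<omega>))\<^sup>2 / 2)"
    proof (intro integral_mono integrable_norm VVi Bochner_Integration.integrable_add integrable_divide V2i that)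
      fix \<omega>
      have "0 \<le> (cmod (V q \<omega>) - cmod (V r \<omega>))\<^sup>2" by simp
      thus "cmod (V q \<omega> * cnj (V r \<omega>)) \<le> (cmod (V q \<omega>))\<^sup>2 / 2 + (cmod (V r \<omega>))\<^sup>2 / 2"
        by (simp add: norm_mult power2_eq_square algebra_simps)
    qed
    also have "\<dots> = e q / 2 + e r / 2"
      unfolding e_def using V2i that by simp
    finally show ?thesis by (simp add: add_divide_distrib)
  qed
  have e0: "e q \<ge> 0" for q by (simp add: e_def)
  have swapP: "prod.swap q \<in> P" if "q \<in> P" for q using that by (auto simp: P_def)
  have Sm: "S \<in> borel_measurable M" unfolding S_def using Vm by (intro borel_measurable_sum)
  have Sb: "cmod (S \<omega>) \<le> real m * real m * (b * K)" if "\<omega> \<in> space M" for \<omega>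
  proof -
    have "cmod (S \<omega>) \<le> (\<Sum>q\<in>P. b * K)" unfolding S_def
      by (rule order_trans[OF norm_sum], rule sum_mono) (use Vb that in auto)
    thus ?thesis by (simp add: P_def)
  qed
  have "of_real (expectation (\<lambda>\<omega>. (cmod (S \<omega>))\<^sup>2)) = expectation (\<lambda>\<omega>. complex_of_real ((cmod (S \<omega>))\<^sup>2))"
    by (simp only: integral_complex_of_real)
  also have "\<dots> = expectation (\<lambda>\<omega>. \<Sum>q\<in>P. \<Sum>r\<in>P. V q \<omega> * cnj (V r \<omega>))"
    unfolding complex_norm_square S_def by (simp add: sum_product)
  also have "\<dots> = (\<Sum>q\<in>P. \<Sum>r\<in>P. expectation (\<lambda>\<omega>. V q \<omega> * cnj (V r \<omega>)))"
    using VVi by (simp add: Bochner_Integration.integral_sum)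
  finally have "expectation (\<lambda>\<omega>. (cmod (S \<omega>))\<^sup>2) = cmod (\<Sum>q\<in>P. \<Sum>r\<in>P. expectation (\<lambda>\<omega>. V q \<omega> * cnj (V r \<omega>)))"
    using abs_eq_cmodI[of "expectation (\<lambda>\<omega>. (cmod (S \<omega>))\<^sup>2)"] by simp
  also have "\<dots> \<le> (\<Sum>q\<in>P. 3 / 2 * e q + 1 / 2 * e (prod.swap q))"
  proof (rule order_trans[OF norm_sum], rule sum_mono)
    fix q assume q: "q \<in> P"
    have "(\<Sum>r\<in>P. expectation (\<lambda>\<omega>. V q \<omega> * cnj (V r \<omega>))) = (\<Sum>r\<in>{q, prod.swap q}. expectation (\<lambda>\<omega>. V q \<omega> * cnj (V r \<omega>)))"
      using q swapP[OF q] finP by (intro sum.mono_neutral_right) (auto intro!: Zero)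
    also have "cmod \<dots> \<le> (\<Sum>r\<in>{q, prod.swap q}. (e q + e r) / 2)"
    proof (rule order_trans[OF norm_sum], rule sum_mono, rule VVe[OF q])
      fix r assume "r \<in> {q, prod.swap q}"
      thus "r \<in> P" using q swapP[OF q] by (elim insertE emptyE) simp_all
    qed
    \<comment> \<open>\<open>e q\<close> comes from the pair itself and
      \<open>(e q + e (prod.swap q))/2\<close> from its transpose. A diagonal pair is its own
      transpose and contributes less.\<close>
    also have "\<dots> \<le> 3 / 2 * e q + 1 / 2 * e (prod.swap q)"
      using e0[of q] e0[of "prod.swap q"] by (cases "q = prod.swap q") (auto simp: field_simps)
    finally show "cmod (\<Sum>r\<in>P. expectation (\<lambda>\<omega>. V q \<omega> * cnj (V r \<omega>))) \<le> 3 / 2 * e q + 1 / 2 * e (prod.swap q)" .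
  qed
  also have "\<dots> = 3 / 2 * (\<Sum>q\<in>P. e q) + 1 / 2 * (\<Sum>q\<in>P. e (prod.swap q))"
    by (simp add: sum.distrib sum_distrib_left)
  also have "(\<Sum>q\<in>P. e (prod.swap q)) = (\<Sum>q\<in>P. e q)"
    by (rule sum.reindex_bij_witness[of _ prod.swap prod.swap]) (auto simp: P_def)
  also have "3 / 2 * (\<Sum>q\<in>P. e q) + 1 / 2 * (\<Sum>q\<in>P. e q) = 2 * (\<Sum>q\<in>P. e q)" by simp
  also have "(\<Sum>q\<in>P. e q) = expectation (\<lambda>\<omega>. \<Sum>q\<in>P. (cmod (V q \<omega>))\<^sup>2)"
    unfolding e_def using V2i by (simp add: Bochner_Integration.integral_sum)
  also have "\<dots> \<le> expectation (\<lambda>\<omega>. K\<^sup>2 * \<beta>)"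
  proof (intro integral_mono Bochner_Integration.integrable_sum V2i)
    fix \<omega> assume w: "\<omega> \<in> space M"
    have "(\<Sum>q\<in>P. (cmod (V q \<omega>))\<^sup>2) \<le> (\<Sum>q\<in>P. K\<^sup>2 * (cmod (B \<omega> (fst q) (snd q)))\<^sup>2)"
      unfolding power_mult_distrib[symmetric] by (intro sum_mono power_mono Vb2 w) simp
    also have "\<dots> = K\<^sup>2 * (\<Sum>i<m. \<Sum>j<m. (cmod (B \<omega> i j))\<^sup>2)"
      unfolding P_def sum_distrib_left by (simp add: sum.cartesian_product case_prod_unfold)
    also have "\<dots> \<le> K\<^sup>2 * \<beta>" by (intro mult_left_mono Bs w) simp
    finally show "(\<Sum>q\<in>P. (cmod (V q \<omega>))\<^sup>2) \<le> K\<^sup>2 * \<beta>" .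
  qed simp_all
  also have "expectation (\<lambda>\<omega>. K\<^sup>2 * \<beta>) = K\<^sup>2 * \<beta>" by (simp add: prob_space)
  finally have fin: "expectation (\<lambda>\<omega>. (cmod (S \<omega>))\<^sup>2) \<le> 2 * (K\<^sup>2 * \<beta>)" by simp
  show "(\<lambda>w. (cmod (column_form (\<lambda>i l. Y (i, l) w) m l (B w) - (\<Sum>i<m. B w i i)))\<^sup>2) \<in> borel_measurable M"
    unfolding Seq[symmetric] using Sm by measurable
  show "expectation (\<lambda>w. (cmod (column_form (\<lambda>i l. Y (i, l) w) m l (B w) - (\<Sum>i<m. B w i i)))\<^sup>2) \<le> 2 * (C\<^sup>2 + 1)\<^sup>2 * \<beta>"
    unfolding Seq[symmetric] using fin by (simp add: K_def)
  show "(cmod (column_form (\<lambda>i l. Y (i, l) \<omega>) m l (B \<omega>) - (\<Sum>i<m. B \<omega> i i)))\<^sup>2 \<le> (real m * real m * (b * (C\<^sup>2 + 1)))\<^sup>2"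
    if "\<omega> \<in> space M" for \<omega>
    unfolding Seq[symmetric] using Sb[OF that] by (intro power_mono) (simp_all add: K_def)
qed

end

section \<open>Bounded entries\<close>

text \<open>By monotone convergence the series of the \<open>U k\<close> has finite expectation, so
  it converges almost surely. This replaces Chebyshev with Borel-Cantelli throughout.\<close>

lemma (in prob_space) AE_tendsto_zero_of_summable:
  fixes U :: "nat \<Rightarrow> 'a \<Rightarrow> real"
  assumes U: "\<And>k. integrable M (U k)" "\<And>k w. 0 \<le> U k w"
    and b: "\<And>k. expectation (U k) \<le> b k" "summable b"
  shows "AE w in M. (\<lambda>k. U k w) \<longlonglongrightarrow> 0"
proof -
  have b0: "0 \<le> b k" for k by (rule order_trans[OF _ b(1)]) (simp add: U)
  have "(\<integral>\<^sup>+w. (\<Sum>k. ennreal (U k w)) \<partial>M) = (\<Sum>k. \<integral>\<^sup>+w. ennreal (U k w) \<partial>M)"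
    using U(1) by (intro nn_integral_suminf) auto
  also have "\<dots> = (\<Sum>k. ennreal (expectation (U k)))"
    using U by (simp add: nn_integral_eq_integral)
  also have "\<dots> \<le> (\<Sum>k. ennreal (b k))"
    using b by (intro suminf_le summableI ennreal_leI) auto
  also have "\<dots> < \<infinity>" using b(2) b0 by (simp add: suminf_ennreal_eq less_top[symmetric] ennreal_suminf_neq_top)
  finally have "AE w in M. (\<Sum>k. ennreal (U k w)) \<noteq> \<infinity>"
    using U(1) by (intro nn_integral_noteq_infinite) auto
  thus ?thesis
  proof (rule AE_mp, intro AE_I2 impI)
    fix w assume "(\<Sum>k. ennreal (U k w)) \<noteq> \<infinity>"
    hence "summable (\<lambda>k. U k w)" using U(2) by (intro summable_suminf_not_top) auto
    thus "(\<lambda>k. U k w) \<longlonglongrightarrow> 0" by (rule summable_LIMSEQ_zero)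
  qed
qed

definition column_defect :: "(nat \<Rightarrow> nat \<Rightarrow> complex) \<Rightarrow> nat \<Rightarrow> nat \<Rightarrow> real \<Rightarrow> nat \<Rightarrow> real" where
  "column_defect y m n t l = cmod (column_form y m l (resolvent (drop_column l y) m n t)
       - of_real (resolvent_trace (drop_column l y) m n t))"

text \<open>The quadratic-form estimate with \<open>B\<close> the resolvent of the array without
  column \<open>l\<close>. For \<open>m\<close> of order \<open>n\<close> and shift
  \<open>n t\<close> in place of \<open>t\<close>, the bound is \<open>O(1/n)\<close>.\<close>

lemma (in prob_space) column_defect_bound:
  fixes Y :: "nat \<times> nat \<Rightarrow> 'a \<Rightarrow> complex"
  assumes ind: "indep_vars (\<lambda>_. borel) Y UNIV"
    and bound: "\<And>a w. w \<in> space M \<Longrightarrow> cmod (Y a w) \<le> C"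
    and mean: "\<And>a. expectation (Y a) = 0"
    and var: "\<And>a. expectation (\<lambda>w. (cmod (Y a w))\<^sup>2) = 1"
    and t: "t > 0"
  shows "integrable M (\<lambda>w. (column_defect (\<lambda>i l. Y (i, l) w) m n t l)\<^sup>2)"
    and "expectation (\<lambda>w. (column_defect (\<lambda>i l. Y (i, l) w) m n t l)\<^sup>2) \<le> 2 * (C\<^sup>2 + 1)\<^sup>2 * (real m / t\<^sup>2)"
proof -
  let ?B = "\<lambda>w. resolvent (drop_column l (\<lambda>i l. Y (i, l) w)) m n t"
  have Bm: "(\<lambda>w. ?B w i j) \<in> borel_measurable (generated M Y (- {(a, l)}))" if "i < m" "j < m" for i j a
  proof (rule resolvent_measurable[OF _ that])
    fix i l'
    show "(\<lambda>w. drop_column l (\<lambda>i l. Y (i, l) w) i l') \<in> borel_measurable (generated M Y (- {(a, l)}))"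
      using measurable_generated[of "(i, l')" "- {(a, l)}" Y M] by (cases "l' = l") (simp_all add: drop_column_def)
  qed
  have Bb: "cmod (?B w i j) \<le> 1 / t" if "i < m" "j < m" for w i j
    using resolvent_entry_bound[OF t that] .
  have Bs: "(\<Sum>i<m. \<Sum>j<m. (cmod (?B w i j))\<^sup>2) \<le> real m / t\<^sup>2" for w
    by (subst sum.swap) (rule resolvent_frobenius_bound[OF t])
  have eq: "(column_defect (\<lambda>i l. Y (i, l) w) m n t l)\<^sup>2 =
     (cmod (column_form (\<lambda>i l. Y (i, l) w) m l (?B w) - (\<Sum>i<m. ?B w i i)))\<^sup>2" for w
    unfolding column_defect_def of_real_resolvent_trace[OF t] ..
  note q = quadratic_form_variance[where B = ?B, OF ind bound mean var Bm Bb Bs]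
  show "expectation (\<lambda>w. (column_defect (\<lambda>i l. Y (i, l) w) m n t l)\<^sup>2) \<le> 2 * (C\<^sup>2 + 1)\<^sup>2 * (real m / t\<^sup>2)"
    unfolding eq by (rule q(2))
  show "integrable M (\<lambda>w. (column_defect (\<lambda>i l. Y (i, l) w) m n t l)\<^sup>2)"
    unfolding eq
  proof (rule integrable_const_bound)
    show "AE w in M. norm ((cmod (column_form (\<lambda>i l. Y (i, l) w) m l (?B w) - (\<Sum>i<m. ?B w i i)))\<^sup>2)
       \<le> (real m * real m * (1 / t * (C\<^sup>2 + 1)))\<^sup>2"
      using q(3) by (intro AE_I2) simp
  qed (rule q(1))
qed

text \<open>The average has mean of order \<open>1/k^2\<close>, which is summable. The row count
  \<open>q\<close> is free up to a linear bound in \<open>k^2\<close>, since it will be a minimum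
  over a block and not \<open>p (k^2)\<close>.\<close>

lemma (in prob_space) AE_column_defect:
  fixes Y :: "nat \<times> nat \<Rightarrow> 'a \<Rightarrow> complex" and q :: "nat \<Rightarrow> nat"
  assumes ind: "indep_vars (\<lambda>_. borel) Y UNIV"
    and bound: "\<And>a w. w \<in> space M \<Longrightarrow> cmod (Y a w) \<le> C"
    and mean: "\<And>a. expectation (Y a) = 0"
    and var: "\<And>a. expectation (\<lambda>w. (cmod (Y a w))\<^sup>2) = 1"
    and t: "t > 0" and q: "\<And>k. k > 0 \<Longrightarrow> real (q k) \<le> A * real (k\<^sup>2)"
  shows "AE w in M. (\<lambda>k. (\<Sum>l<k\<^sup>2. (column_defect (\<lambda>i l. Y (i, l) w) (q k) (k\<^sup>2) (real (k\<^sup>2) * t) l)\<^sup>2) / real (k\<^sup>2)) \<longlonglongrightarrow> 0"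
proof -
  let ?D = "\<lambda>k l w. (column_defect (\<lambda>i l. Y (i, l) w) (q k) (k\<^sup>2) (real (k\<^sup>2) * t) l)\<^sup>2"
  define J where "J = 2 * (C\<^sup>2 + 1)\<^sup>2"
  have J: "J \<ge> 0" by (simp add: J_def)
  have int: "integrable M (?D k l)" if "k > 0" for k l
    by (rule column_defect_bound(1)[OF ind bound mean var]) (use t that in auto)
  show ?thesis
  proof (rule AE_tendsto_zero_of_summable[where b = "\<lambda>k. J * A / t\<^sup>2 * inverse (real k ^ 2)"])
    show "integrable M (\<lambda>w. (\<Sum>l<k\<^sup>2. ?D k l w) / real (k\<^sup>2))" for k
      using int by (cases "k = 0") (auto intro!: integrable_divide Bochner_Integration.integrable_sum)
    show "0 \<le> (\<Sum>l<k\<^sup>2. ?D k l w) / real (k\<^sup>2)" for k w by (intro divide_nonneg_nonneg sum_nonneg) auto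
    show "summable (\<lambda>k. J * A / t\<^sup>2 * inverse (real k ^ 2))"
      by (intro summable_mult inverse_power_summable) simp
    fix k
    show "expectation (\<lambda>w. (\<Sum>l<k\<^sup>2. ?D k l w) / real (k\<^sup>2)) \<le> J * A / t\<^sup>2 * inverse (real k ^ 2)"
    proof (cases "k = 0")
      case False
      hence k: "k > 0" by simp
      define N where "N = real (k\<^sup>2)"
      have N: "N > 0" using k by (simp add: N_def)
      have "expectation (\<lambda>w. (\<Sum>l<k\<^sup>2. ?D k l w) / real (k\<^sup>2)) = (\<Sum>l<k\<^sup>2. expectation (?D k l)) / N"
        unfolding N_def using int[OF k] by (simp add: Bochner_Integration.integral_sum)
      also have "\<dots> \<le> (\<Sum>l<k\<^sup>2. J * (real (q k) / (N * t)\<^sup>2)) / N"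
        unfolding J_def N_def using t k
        by (intro divide_right_mono sum_mono column_defect_bound(2)[OF ind bound mean var]) auto
      also have "\<dots> = J * (real (q k) / (N * t)\<^sup>2)" using N by (simp add: N_def)
      also have "\<dots> \<le> J * (A * N / (N * t)\<^sup>2)"
        using q[OF k] J by (intro mult_left_mono divide_right_mono) (auto simp: N_def)
      also have "\<dots> = J * A / t\<^sup>2 * inverse N" using N t by (simp add: power2_eq_square field_simps)
      finally show ?thesis by (simp add: N_def)
    qed simp
  qed
qed

text \<open>Since \<open>s/(1 + s)\<close> increases, the values at \<open>a\<close> and at the root
  \<open>b\<close> differ by \<open>a - b\<close> times \<open>t\<close> plus a positive
  number.\<close>

lemma fixed_point_stability:
  assumes c: "c > 0" and t: "t > 0" and a: "a \<ge> 0"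
  shows "t * \<bar>a - mp_root c t\<bar> \<le> \<bar>t * a + a / (1 + a) - c\<bar>"
proof -
  define b where "b = mp_root c t"
  have b: "b \<ge> 0" "t * b + b / (1 + b) = c" using mp_root_equation[OF c t] by (auto simp: b_def)
  have "a / (1 + a) - b / (1 + b) = (a - b) / ((1 + a) * (1 + b))" using a b(1) by (simp add: field_simps)
  hence "t * a + a / (1 + a) - c = (a - b) * (t + 1 / ((1 + a) * (1 + b)))"
    unfolding b(2)[symmetric] by (simp add: algebra_simps)
  hence "\<bar>t * a + a / (1 + a) - c\<bar> = \<bar>a - b\<bar> * (t + 1 / ((1 + a) * (1 + b)))"
    using a b(1) t by (simp add: abs_mult)
  also have "\<dots> \<ge> \<bar>a - b\<bar> * t" using a b(1) by (intro mult_left_mono) auto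
  finally show ?thesis by (simp add: b_def mult.commute)
qed

text \<open>Deterministic, to be applied outcome by outcome. The trace equation is divided by
  \<open>k^2\<close>, Cauchy-Schwarz passes from the mean to the root mean square of the defects,
  and stability of the fixed point turns the residual into an error for the trace.\<close>

lemma resolvent_trace_limit_of_defect:
  assumes c: "c > 0" and t: "t > 0" and q: "(\<lambda>k. real (q k) / real (k\<^sup>2)) \<longlonglongrightarrow> c"
    and D: "(\<lambda>k. (\<Sum>l<k\<^sup>2. (column_defect y (q k) (k\<^sup>2) (real (k\<^sup>2) * t) l)\<^sup>2) / real (k\<^sup>2)) \<longlonglongrightarrow> 0"
  shows "(\<lambda>k. resolvent_trace y (q k) (k\<^sup>2) (real (k\<^sup>2) * t)) \<longlonglongrightarrow> mp_root c t"
proof -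
  define D where "D = (\<lambda>k. (\<Sum>l<k\<^sup>2. (column_defect y (q k) (k\<^sup>2) (real (k\<^sup>2) * t) l)\<^sup>2) / real (k\<^sup>2))"
  define a where "a = (\<lambda>k. resolvent_trace y (q k) (k\<^sup>2) (real (k\<^sup>2) * t))"
  have bound: "\<bar>a k - mp_root c t\<bar> \<le> (sqrt (D k) + 1 / (real (k\<^sup>2) * t) + \<bar>real (q k) / real (k\<^sup>2) - c\<bar>) / t" if k: "k > 0" for k
  proof -
    define N where "N = real (k\<^sup>2)"
    have N: "N > 0" using k by (simp add: N_def)
    have Nt: "N * t > 0" using N t by simp
    have a0: "a k \<ge> 0" unfolding a_def using resolvent_trace_bounds(1) Nt by (simp add: N_def)
    have "\<bar>real (q k) - N * t * a k - N * (a k / (1 + a k))\<bar> \<le> (\<Sum>l<k\<^sup>2. column_defect y (q k) (k\<^sup>2) (N * t) l) + N / (N * t)"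
      using resolvent_trace_equation[OF Nt, of "q k" y "k\<^sup>2"] unfolding a_def N_def column_defect_def .
    also have "(\<Sum>l<k\<^sup>2. column_defect y (q k) (k\<^sup>2) (N * t) l) \<le> N * sqrt (D k)"
    proof -
      have "(\<Sum>l<k\<^sup>2. 1 * column_defect y (q k) (k\<^sup>2) (N * t) l)\<^sup>2 \<le> (\<Sum>l<k\<^sup>2. 1\<^sup>2) * (\<Sum>l<k\<^sup>2. (column_defect y (q k) (k\<^sup>2) (N * t) l)\<^sup>2)"
        by (rule Cauchy_Schwarz_ineq_sum)
      also have "\<dots> = N\<^sup>2 * D k" using N by (simp add: D_def N_def power2_eq_square)
      finally have "(\<Sum>l<k\<^sup>2. column_defect y (q k) (k\<^sup>2) (N * t) l) \<le> sqrt (N\<^sup>2 * D k)"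
        by (intro real_le_rsqrt) simp
      thus ?thesis using N by (simp add: real_sqrt_mult)
    qed
    finally have "\<bar>real (q k) - N * t * a k - N * (a k / (1 + a k))\<bar> \<le> N * (sqrt (D k) + 1 / (N * t))"
      using N by (simp add: distrib_left)
    moreover have "real (q k) - N * t * a k - N * (a k / (1 + a k)) = N * (real (q k) / N - (t * a k + a k / (1 + a k)))"
      using N by (simp add: algebra_simps)
    ultimately have "\<bar>real (q k) / N - (t * a k + a k / (1 + a k))\<bar> \<le> sqrt (D k) + 1 / (N * t)"
      using N by (simp add: abs_mult)
    hence "\<bar>t * a k + a k / (1 + a k) - c\<bar> \<le> sqrt (D k) + 1 / (N * t) + \<bar>real (q k) / N - c\<bar>" by linarith
    with fixed_point_stability[OF c t a0]
    have "t * \<bar>a k - mp_root c t\<bar> \<le> sqrt (D k) + 1 / (N * t) + \<bar>real (q k) / N - c\<bar>" by linarith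
    thus ?thesis using t unfolding N_def by (simp add: pos_le_divide_eq mult.commute)
  qed
  have sq: "filterlim (\<lambda>k. real (k\<^sup>2) * t) at_top sequentially"
    using t by real_asymp
  have "(\<lambda>k. (sqrt (D k) + 1 / (real (k\<^sup>2) * t) + \<bar>real (q k) / real (k\<^sup>2) - c\<bar>) / t) \<longlonglongrightarrow> (sqrt 0 + 0 + \<bar>c - c\<bar>) / t"
    using D q t unfolding D_def[symmetric]
    by (intro tendsto_intros tendsto_divide_0[OF tendsto_const] filterlim_at_top_imp_at_infinity sq) auto
  hence lim: "(\<lambda>k. (sqrt (D k) + 1 / (real (k\<^sup>2) * t) + \<bar>real (q k) / real (k\<^sup>2) - c\<bar>) / t) \<longlonglongrightarrow> 0" by simp
  have "(\<lambda>k. a k - mp_root c t) \<longlonglongrightarrow> 0"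
    by (rule Lim_null_comparison[OF _ lim], rule eventually_mono[OF eventually_gt_at_top[of 0]]) (use bound in auto)
  thus ?thesis unfolding a_def by (simp add: LIM_zero_iff)
qed

section \<open>Interpolation between the squares\<close>

lemma resolvent_trace_cong:
  assumes "t > 0" "\<And>i l. i < m \<Longrightarrow> l < n \<Longrightarrow> x i l = y i l"
  shows "resolvent_trace x m n t = resolvent_trace y m n t"
proof -
  have "(\<Sum>i<m. \<Sum>l<n. (cmod (x i l - y i l))\<^sup>2) = 0" using assms(2) by (intro sum.neutral ballI) simp
  with resolvent_trace_lipschitz[OF assms(1), of x m n y] show ?thesis by simp
qed

lemma sum_outside_rectangle:
  assumes "Q \<le> p" "N \<le> n"
  shows "(\<Sum>i<p. \<Sum>l<n. if i < Q \<and> l < N then 0 else 1 :: real) = real p * real n - real Q * real N"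
proof -
  have ind: "(\<Sum>i<p. if i < Q then 1 else 0 :: real) = real Q" if "Q \<le> p" for p Q :: nat
  proof -
    have "{..<p} \<inter> {i. i < Q} = {..<Q}" using that by auto
    thus ?thesis by (simp add: sum.If_cases)
  qed
  have "(\<Sum>i<p. \<Sum>l<n. if i < Q \<and> l < N then 0 else 1 :: real) =
      (\<Sum>i<p. \<Sum>l<n. 1 - (if i < Q then 1 else 0) * (if l < N then 1 else 0))"
    by (intro sum.cong refl) auto
  also have "\<dots> = real p * real n - (\<Sum>i<p. if i < Q then 1 else 0) * (\<Sum>l<n. if l < N then 1 else 0 :: real)"
    unfolding sum_subtractf sum_product by simp
  finally show ?thesis using ind assms by simp
qed

text \<open>The three terms match three moves: entries outside the small rectangle are set to zero
  (Lipschitz estimate, at most \<open>C^2\<close> per cell), the zero rows and columns are dropped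
  (padding), and the shift goes from \<open>n t\<close> to \<open>N t\<close>.\<close>

lemma resolvent_trace_rectangle_diff:
  assumes y: "\<And>i l. cmod (y i l) \<le> C" and QN: "Q \<le> p" "N \<le> n" "N > 0" and t: "t > 0"
  shows "\<bar>resolvent_trace y p n (real n * t) - resolvent_trace y Q N (real N * t)\<bar> \<le>
    2 * sqrt (C\<^sup>2 * (real p * real n - real Q * real N)) * sqrt (real p / (real n * t) ^ 3) + real (p - Q) / (real n * t)
    + real Q * (real n - real N) / (real n * real N * t)"
proof -
  define y' where "y' = (\<lambda>i l. if i < Q \<and> l < N then y i l else 0)"
  have nt: "real n * t > 0" "real N * t > 0" using QN t by auto
  have "(\<Sum>i<p. \<Sum>l<n. (cmod (y i l - y' i l))\<^sup>2) \<le> (\<Sum>i<p. \<Sum>l<n. C\<^sup>2 * (if i < Q \<and> l < N then 0 else 1))"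
    by (intro sum_mono) (auto simp: y'_def intro!: power_mono y)
  also have "\<dots> = C\<^sup>2 * (real p * real n - real Q * real N)"
    unfolding sum_distrib_left[symmetric] sum_outside_rectangle[OF QN(1,2)] ..
  finally have "2 * sqrt (\<Sum>i<p. \<Sum>l<n. (cmod (y i l - y' i l))\<^sup>2) * sqrt (real p / (real n * t) ^ 3) \<le>
    2 * sqrt (C\<^sup>2 * (real p * real n - real Q * real N)) * sqrt (real p / (real n * t) ^ 3)"
    using nt by (intro mult_right_mono mult_left_mono real_sqrt_le_mono) auto
  with resolvent_trace_lipschitz[OF nt(1), of y p n y']
  have 1: "\<bar>resolvent_trace y p n (real n * t) - resolvent_trace y' p n (real n * t)\<bar> \<le>
    2 * sqrt (C\<^sup>2 * (real p * real n - real Q * real N)) * sqrt (real p / (real n * t) ^ 3)" by linarith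
  have "resolvent_trace y' p n (real n * t) = resolvent_trace y' Q N (real n * t) + real (p - Q) / (real n * t)"
    by (rule resolvent_trace_padding[OF nt(1) QN(1,2)]) (auto simp: y'_def)
  also have "resolvent_trace y' Q N (real n * t) = resolvent_trace y Q N (real n * t)"
    by (rule resolvent_trace_cong[OF nt(1)]) (auto simp: y'_def)
  finally have 2: "resolvent_trace y' p n (real n * t) = resolvent_trace y Q N (real n * t) + real (p - Q) / (real n * t)" .
  have "\<bar>resolvent_trace y Q N (real n * t) - resolvent_trace y Q N (real N * t)\<bar> \<le>
    real Q * \<bar>real n * t - real N * t\<bar> / (real n * t * (real N * t))"
    by (rule resolvent_trace_shift[OF nt])
  also have "\<bar>real n * t - real N * t\<bar> = (real n - real N) * t"
    using QN t by (simp add: left_diff_distrib[symmetric] abs_mult)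
  also have "real Q * ((real n - real N) * t) / (real n * t * (real N * t)) = real Q * (real n - real N) / (real n * real N * t)"
    using t by simp
  finally have 3: "\<bar>resolvent_trace y Q N (real n * t) - resolvent_trace y Q N (real N * t)\<bar> \<le>
    real Q * (real n - real N) / (real n * real N * t)" .
  have "0 \<le> real (p - Q) / (real n * t)" using nt by simp
  moreover have "\<bar>a - f\<bar> \<le> e + d + e'" if "\<bar>a - b\<bar> \<le> e" "b = c + d" "\<bar>c - f\<bar> \<le> e'" "0 \<le> d"
    for a b c d e e' f :: real using that by linarith
  ultimately show ?thesis using 1 2 3 by blast
qed

text \<open>\<open>p\<close> may fail to be monotone. With the smallest row count in the block, the
  rectangle of width \<open>k^2\<close> lies inside the rectangle of every \<open>n\<close> in the
  block.\<close>

definition block_min :: "(nat \<Rightarrow> nat) \<Rightarrow> nat \<Rightarrow> nat" where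
  "block_min p k = Min (p ` {k\<^sup>2..<(Suc k)\<^sup>2})"

lemma block_nonempty: "k\<^sup>2 < (Suc k)\<^sup>2"
  by (simp add: power2_eq_square)

lemma block_min_le: "n \<in> {k\<^sup>2..<(Suc k)\<^sup>2} \<Longrightarrow> block_min p k \<le> p n"
  unfolding block_min_def by (intro Min_le) auto

text \<open>The minimum is \<open>p n\<close> for some \<open>n\<close> of the block, and
  \<open>n/k^2\<close> tends to 1 whichever \<open>n\<close> it is.\<close>

lemma block_min_limit:
  assumes p: "(\<lambda>n. real (p n) / real n) \<longlonglongrightarrow> c"
  shows "(\<lambda>k. real (block_min p k) / real (k\<^sup>2)) \<longlonglongrightarrow> c"
proof -
  have "\<exists>n\<in>{k\<^sup>2..<(Suc k)\<^sup>2}. block_min p k = p n" for k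
  proof -
    have "block_min p k \<in> p ` {k\<^sup>2..<(Suc k)\<^sup>2}"
      unfolding block_min_def using block_nonempty[of k] by (intro Min_in) auto
    thus ?thesis by auto
  qed
  then obtain n0 where n0: "\<And>k. n0 k \<in> {k\<^sup>2..<(Suc k)\<^sup>2}" "\<And>k. block_min p k = p (n0 k)" by metis
  have "k \<le> n0 k" for k
  proof -
    have "k \<le> k\<^sup>2" by (simp add: power2_eq_square)
    thus ?thesis using n0(1)[of k] by simp
  qed
  hence "filterlim n0 at_top sequentially"
    by (intro filterlim_at_top_mono[OF filterlim_ident]) auto
  from filterlim_compose[OF p this] have 1: "(\<lambda>k. real (p (n0 k)) / real (n0 k)) \<longlonglongrightarrow> c" .
  have 2: "(\<lambda>k. real (n0 k) / real (k\<^sup>2)) \<longlonglongrightarrow> 1"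
  proof (rule tendsto_sandwich)
    show "\<forall>\<^sub>F k in sequentially. 1 \<le> real (n0 k) / real (k\<^sup>2)"
      using eventually_gt_at_top[of 0]
    proof eventually_elim
      case (elim k)
      have "real (k\<^sup>2) \<le> real (n0 k)" using n0(1)[of k] by (simp only: of_nat_le_iff) simp
      thus ?case using elim by (simp add: divide_simps)
    qed
    show "\<forall>\<^sub>F k in sequentially. real (n0 k) / real (k\<^sup>2) \<le> (real k + 1)\<^sup>2 / real (k\<^sup>2)"
      using eventually_gt_at_top[of 0]
    proof eventually_elim
      case (elim k)
      have "real (n0 k) \<le> real ((Suc k)\<^sup>2)" using n0(1)[of k] by (simp only: of_nat_le_iff) simp
      also have "\<dots> = (real k + 1)\<^sup>2" by simp
      finally show ?case by (intro divide_right_mono) auto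
    qed
    show "(\<lambda>k. (real k + 1)\<^sup>2 / real (k\<^sup>2)) \<longlonglongrightarrow> 1" by real_asymp
  qed simp
  have "(\<lambda>k. real (p (n0 k)) / real (n0 k) * (real (n0 k) / real (k\<^sup>2))) \<longlonglongrightarrow> c"
    using tendsto_mult[OF 1 2] by (simp only: mult_1_right)
  moreover have "\<forall>\<^sub>F k in sequentially. real (p (n0 k)) / real (n0 k) * (real (n0 k) / real (k\<^sup>2)) = real (block_min p k) / real (k\<^sup>2)"
    using eventually_gt_at_top[of 0]
  proof eventually_elim
    case (elim k)
    have "n0 k > 0" using n0(1)[of k] elim by (cases "n0 k") auto
    thus ?case by (simp add: n0(2))
  qed
  ultimately show ?thesis by (rule Lim_transform_eventually)
qed

lemma floor_sqrt_limits:
  shows "filterlim floor_sqrt at_top sequentially"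
    and "(\<lambda>n. real ((floor_sqrt n)\<^sup>2) / real n) \<longlonglongrightarrow> 1"
proof -
  show lim: "filterlim floor_sqrt at_top sequentially"
    unfolding filterlim_at_top
  proof
    fix Z
    show "\<forall>\<^sub>F n in sequentially. Z \<le> floor_sqrt n"
      using eventually_ge_at_top[of "Z\<^sup>2"] by eventually_elim (simp add: le_floor_sqrt_iff)
  qed
  show "(\<lambda>n. real ((floor_sqrt n)\<^sup>2) / real n) \<longlonglongrightarrow> 1"
  proof (rule tendsto_sandwich)
    have "(\<lambda>k. (real k)\<^sup>2 / (real k + 1)\<^sup>2) \<longlonglongrightarrow> 1" by real_asymp
    from filterlim_compose[OF this lim]
    show "(\<lambda>n. (real (floor_sqrt n))\<^sup>2 / (real (floor_sqrt n) + 1)\<^sup>2) \<longlonglongrightarrow> 1" .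
    show "\<forall>\<^sub>F n in sequentially. (real (floor_sqrt n))\<^sup>2 / (real (floor_sqrt n) + 1)\<^sup>2 \<le> real ((floor_sqrt n)\<^sup>2) / real n"
      using eventually_gt_at_top[of 0]
    proof eventually_elim
      case (elim n)
      have "real n \<le> real ((Suc (floor_sqrt n))\<^sup>2)"
        using Suc_floor_sqrt_power2_gt[of n] by (simp only: of_nat_le_iff less_imp_le)
      hence "real n \<le> (real (floor_sqrt n) + 1)\<^sup>2" by (simp add: add.commute)
      thus ?case using elim by (simp add: divide_left_mono)
    qed
    show "\<forall>\<^sub>F n in sequentially. real ((floor_sqrt n)\<^sup>2) / real n \<le> 1"
      using eventually_gt_at_top[of 0]
    proof eventually_elim
      case (elim n)
      have "real ((floor_sqrt n)\<^sup>2) \<le> real n" by (simp only: of_nat_le_iff) simp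
      thus ?case using elim by (simp add: divide_simps)
    qed
  qed simp
qed

text \<open>The cells gained within a block are negligible against \<open>n^2\<close>: their
  proportion \<open>P - R S\<close> tends to \<open>c - c = 0\<close>, and the other two terms of
  the rectangle estimate vanish likewise.\<close>

lemma resolvent_trace_interpolation:
  assumes y: "\<And>i l. cmod (y i l) \<le> C" and p: "(\<lambda>n. real (p n) / real n) \<longlonglongrightarrow> c" and t: "t > 0"
    and lim: "(\<lambda>k. resolvent_trace y (block_min p k) (k\<^sup>2) (real (k\<^sup>2) * t)) \<longlonglongrightarrow> L"
  shows "(\<lambda>n. resolvent_trace y (p n) n (real n * t)) \<longlonglongrightarrow> L"
proof -
  define Q where "Q = (\<lambda>n. block_min p (floor_sqrt n))"
  define N where "N = (\<lambda>n. (floor_sqrt n)\<^sup>2)"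
  define P where "P = (\<lambda>n. real (p n) / real n)"
  define S where "S = (\<lambda>n. real (N n) / real n)"
  \<comment> \<open>This is \<open>Q n / n\<close>, written as a product whose two factors have
    known limits.\<close>
  define R where "R = (\<lambda>n. real (block_min p (floor_sqrt n)) / real ((floor_sqrt n)\<^sup>2) * S n)"
  define E where "E = (\<lambda>n. 2 * sqrt (C\<^sup>2 * (P n - R n * S n) * (P n / t ^ 3)) + (P n - R n) / t + R n * (1 - S n) / (S n * t))"
  have Plim: "P \<longlonglongrightarrow> c" using p by (simp add: P_def)
  have Slim: "S \<longlonglongrightarrow> 1" using floor_sqrt_limits(2) by (simp add: S_def N_def)
  have "(\<lambda>n. real (block_min p (floor_sqrt n)) / real ((floor_sqrt n)\<^sup>2)) \<longlonglongrightarrow> c"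
    using filterlim_compose[OF block_min_limit[OF p] floor_sqrt_limits(1)] .
  from tendsto_mult[OF this Slim] have Rlim: "R \<longlonglongrightarrow> c" by (simp add: R_def)
  have "E \<longlonglongrightarrow> 2 * sqrt (C\<^sup>2 * (c - c * 1) * (c / t ^ 3)) + (c - c) / t + c * (1 - 1) / (1 * t)"
    unfolding E_def using t by (intro tendsto_intros Plim Slim Rlim) auto
  hence E: "E \<longlonglongrightarrow> 0" by simp
  have bound: "\<bar>resolvent_trace y (p n) n (real n * t) - resolvent_trace y (Q n) (N n) (real (N n) * t)\<bar> \<le> E n" if n: "n > 0" for n
  proof -
    have block: "n \<in> {(floor_sqrt n)\<^sup>2..<(Suc (floor_sqrt n))\<^sup>2}"
      using Suc_floor_sqrt_power2_gt[of n] by simp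
    have le: "Q n \<le> p n" "N n \<le> n" unfolding Q_def N_def using block_min_le[OF block] by auto
    have N: "N n > 0" using n by (simp add: N_def)
    have "a / z * (z / b) = a / b" if "z \<noteq> 0" for a b z :: real using that by simp
    moreover have "real ((floor_sqrt n)\<^sup>2) \<noteq> 0" using N unfolding N_def by (metis less_irrefl of_nat_eq_0_iff)
    ultimately have R: "R n = real (Q n) / real n" unfolding R_def S_def Q_def N_def by blast
    have "sqrt (C\<^sup>2 * (real (p n) * real n - real (Q n) * real (N n))) * sqrt (real (p n) / (real n * t) ^ 3) =
      sqrt (C\<^sup>2 * (P n - R n * S n) * (P n / t ^ 3))"
      unfolding real_sqrt_mult[symmetric] R P_def S_def using n t
      by (intro arg_cong[of _ _ sqrt]) (simp add: power3_eq_cube field_simps)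
    moreover have "real (p n - Q n) / (real n * t) = (P n - R n) / t"
      unfolding R P_def using le n t by (simp add: of_nat_diff field_simps)
    moreover have "real (Q n) * (real n - real (N n)) / (real n * real (N n) * t) = R n * (1 - S n) / (S n * t)"
      unfolding R S_def using N n t by (simp add: field_simps)
    ultimately show ?thesis
      using resolvent_trace_rectangle_diff[OF y le N t] unfolding E_def by (simp only: mult.assoc)
  qed
  have "(\<lambda>n. resolvent_trace y (p n) n (real n * t) - resolvent_trace y (Q n) (N n) (real (N n) * t)) \<longlonglongrightarrow> 0"
    by (rule Lim_null_comparison[OF _ E], rule eventually_mono[OF eventually_gt_at_top[of 0]]) (use bound in auto)
  moreover have "(\<lambda>n. resolvent_trace y (Q n) (N n) (real (N n) * t)) \<longlonglongrightarrow> L"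
    using filterlim_compose[OF lim floor_sqrt_limits(1)] by (simp add: Q_def N_def)
  ultimately have "(\<lambda>n. (resolvent_trace y (p n) n (real n * t) - resolvent_trace y (Q n) (N n) (real (N n) * t))
     + resolvent_trace y (Q n) (N n) (real (N n) * t)) \<longlonglongrightarrow> 0 + L"
    by (rule tendsto_add)
  thus ?thesis by simp
qed

lemma (in prob_space) AE_resolvent_trace_bounded:
  fixes Y :: "nat \<times> nat \<Rightarrow> 'a \<Rightarrow> complex" and p :: "nat \<Rightarrow> nat"
  assumes ind: "indep_vars (\<lambda>_. borel) Y UNIV"
    and bound: "\<And>a w. w \<in> space M \<Longrightarrow> cmod (Y a w) \<le> C"
    and mean: "\<And>a. expectation (Y a) = 0"
    and var: "\<And>a. expectation (\<lambda>w. (cmod (Y a w))\<^sup>2) = 1"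
    and t: "t > 0" and c: "c > 0" and p: "(\<lambda>n. real (p n) / real n) \<longlonglongrightarrow> c"
  shows "AE w in M. (\<lambda>n. resolvent_trace (\<lambda>i l. Y (i, l) w) (p n) n (real n * t)) \<longlonglongrightarrow> mp_root c t"
proof -
  note q = block_min_limit[OF p]
  obtain A where A: "\<And>k. norm (real (block_min p k) / real (k\<^sup>2)) \<le> A"
    using convergent_imp_Bseq[OF convergentI[OF q]] unfolding Bseq_def by blast
  have "real (block_min p k) \<le> A * real (k\<^sup>2)" if "k > 0" for k
    using A[of k] that by (simp add: divide_simps split: if_splits)
  from AE_column_defect[OF ind bound mean var t this]
  have "AE w in M. (\<lambda>k. (\<Sum>l<k\<^sup>2. (column_defect (\<lambda>i l. Y (i, l) w) (block_min p k) (k\<^sup>2) (real (k\<^sup>2) * t) l)\<^sup>2) / real (k\<^sup>2)) \<longlonglongrightarrow> 0" .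
  with AE_space show ?thesis
  proof eventually_elim
    case (elim w)
    show ?case
      by (rule resolvent_trace_interpolation[OF _ p t resolvent_trace_limit_of_defect[OF c t q elim(2)]])
        (rule bound[OF elim(1)])
  qed
qed

section \<open>Laws of large numbers for rectangular arrays\<close>

text \<open>A geometric sum dominated by its largest term. Integrated, it bounds the sum of the
  \<open>4^k P(f > 4^k)\<close> by a multiple of the mean of \<open>f\<close>.\<close>

lemma sum_powers_below:
  fixes y :: real
  assumes "y \<ge> 0"
  shows "(\<Sum>k<n. 4 ^ k * (if 4 ^ k < y then 1 else 0)) \<le> 4 / 3 * y"
proof (induction n)
  case (Suc n)
  show ?case
  proof (cases "4 ^ n < y")
    case True
    have "(\<Sum>k<n. 4 ^ k * (if 4 ^ k < y then 1 else 0 :: real)) \<le> (\<Sum>k<n. 4 ^ k)" by (intro sum_mono) auto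
    also have "\<dots> \<le> 4 ^ n / 3" by (induction n) auto
    finally show ?thesis using True by simp
  qed (use Suc in simp)
qed (use assms in simp)

text \<open>A geometric tail that starts where \<open>4^k\<close> reaches \<open>y\<close>. It makes
  the truncated second moments summable with weights \<open>4^(-k)\<close> when just the first
  moment is finite.\<close>

lemma sum_inverse_powers_above:
  fixes y :: real
  assumes "y \<ge> 0"
  shows "(\<Sum>k<n. inverse (4 ^ k) * (y\<^sup>2 * (if y \<le> 4 ^ k then 1 else 0))) \<le> 4 / 3 * y"
proof -
  define T where "T = (\<lambda>n. \<Sum>k<n. y / 4 ^ k * (if y \<le> 4 ^ k then 1 else 0))"
  \<comment> \<open>Once \<open>y <= 4^n\<close>, the added term is the whole remaining geometric
    tail; the partial sums alone would not carry the induction.\<close>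
  have "T n + 4 / 3 * (y / 4 ^ n * (if y \<le> 4 ^ n then 1 else 0)) \<le> 4 / 3" for n
  proof (induction n)
    case 0
    thus ?case by (simp add: T_def)
  next
    case (Suc n)
    show ?case
    proof (cases "y \<le> 4 ^ n")
      case True
      moreover have "(4 :: real) ^ n \<le> 4 ^ Suc n" by simp
      ultimately have "y \<le> 4 ^ Suc n" by linarith
      with True Suc show ?thesis by (simp add: T_def)
    next
      case False
      have "y \<noteq> 0" using False by auto
      have "T (Suc n) = 0" unfolding T_def
      proof (intro sum.neutral ballI)
        fix k assume "k \<in> {..<Suc n}"
        hence "(4 :: real) ^ k \<le> 4 ^ n" by (intro power_increasing) auto
        hence "\<not> y \<le> 4 ^ k" using False by linarith
        thus "y / 4 ^ k * (if y \<le> 4 ^ k then 1 else 0) = 0" by simp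
      qed
      hence "T (Suc n) + 4 / 3 * q \<le> 4 / 3" if "q \<le> 1" for q using that by linarith
      moreover have "y / 4 ^ Suc n * (if y \<le> 4 ^ Suc n then 1 else 0) \<le> 1" by (auto simp: divide_simps)
      ultimately show ?thesis by blast
    qed
  qed
  note this[of n]
  moreover have "0 \<le> 4 / 3 * (y / 4 ^ n * (if y \<le> 4 ^ n then 1 else 0))" using assms by simp
  ultimately have T: "T n \<le> 4 / 3" by linarith
  have "(\<Sum>k<n. inverse (4 ^ k) * (y\<^sup>2 * (if y \<le> 4 ^ k then 1 else 0))) = y * T n"
    unfolding T_def sum_distrib_left by (intro sum.cong refl) (simp add: power2_eq_square divide_inverse)
  also have "\<dots> \<le> y * (4 / 3)" using T assms by (intro mult_left_mono)
  finally show ?thesis by simp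
qed

locale iid_array = prob_space M for M :: "'a measure" +
  fixes X :: "nat \<times> nat \<Rightarrow> 'a \<Rightarrow> complex" and x0 :: "nat \<times> nat"
  assumes ind: "indep_vars (\<lambda>_. borel) X UNIV"
    and ident: "\<And>a. distr M borel (X a) = distr M borel (X x0)"
begin

lemma X_measurable [measurable]: "random_variable borel (X a)"
  using ind unfolding indep_vars_def by blast

lemma expectation_ident:
  fixes g :: "complex \<Rightarrow> 'b::{banach, second_countable_topology}"
  assumes [measurable]: "g \<in> borel_measurable borel"
  shows "expectation (\<lambda>w. g (X a w)) = expectation (\<lambda>w. g (X x0 w))"
proof -
  have "expectation (\<lambda>w. g (X a w)) = integral\<^sup>L (distr M borel (X a)) g" by (subst integral_distr) auto
  also have "\<dots> = integral\<^sup>L (distr M borel (X x0)) g" by (simp only: ident[of a])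
  also have "\<dots> = expectation (\<lambda>w. g (X x0 w))" by (subst integral_distr) auto
  finally show ?thesis .
qed

lemma expectation_sum_square:
  fixes f :: "complex \<Rightarrow> real"
  assumes f [measurable]: "f \<in> borel_measurable borel" and F: "\<And>z. \<bar>f z\<bar> \<le> F"
    and zero: "expectation (\<lambda>w. f (X x0 w)) = 0" and A: "finite A"
  shows "integrable M (\<lambda>w. (\<Sum>a\<in>A. f (X a w))\<^sup>2)"
    "expectation (\<lambda>w. (\<Sum>a\<in>A. f (X a w))\<^sup>2) = real (card A) * expectation (\<lambda>w. (f (X x0 w))\<^sup>2)"
proof -
  have F0: "F \<ge> 0" by (rule order_trans[OF abs_ge_zero F])
  have int: "integrable M (\<lambda>w. f (X a w) * f (X b w))" for a b
  proof (rule integrable_const_bound[of _ "F * F"])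
    have "\<bar>f (X a w) * f (X b w)\<bar> \<le> F * F" for w
      unfolding abs_mult using F F0 by (intro mult_mono) auto
    thus "AE w in M. norm (f (X a w) * f (X b w)) \<le> F * F" by simp
  qed measurable
  have eq: "(\<Sum>a\<in>A. f (X a w))\<^sup>2 = (\<Sum>a\<in>A. \<Sum>b\<in>A. f (X a w) * f (X b w))" for w
    by (simp add: power2_eq_square sum_product)
  show "integrable M (\<lambda>w. (\<Sum>a\<in>A. f (X a w))\<^sup>2)"
    unfolding eq by (intro Bochner_Integration.integrable_sum int)
  have cross: "expectation (\<lambda>w. f (X a w) * f (X b w)) = (if b = a then expectation (\<lambda>w. (f (X x0 w))\<^sup>2) else 0)" for a b
  proof (cases "b = a")
    case True
    thus ?thesis using expectation_ident[of "\<lambda>z. (f z)\<^sup>2" a] by (simp add: power2_eq_square)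
  next
    case False
    \<comment> \<open>Complex values allow \<open>expectation_generated_zero\<close> to kill the
      cross terms.\<close>
    have "expectation (\<lambda>w. complex_of_real (f (X a w)) * complex_of_real (f (X b w))) = 0"
    proof (rule expectation_generated_zero[OF ind])
      have "X b \<in> borel_measurable (generated M X (- {a}))"
        using False by (intro measurable_generated) auto
      thus "(\<lambda>w. complex_of_real (f (X b w))) \<in> borel_measurable (generated M X (- {a}))" by measurable
      show "expectation (\<lambda>w. complex_of_real (f (X a w))) = 0"
        using zero expectation_ident[OF f, of a] by simp
    qed (use F in auto)
    hence "complex_of_real (expectation (\<lambda>w. f (X a w) * f (X b w))) = 0"
      by (simp only: integral_complex_of_real[symmetric] of_real_mult)
    thus ?thesis using False by simp
  qed
  have "expectation (\<lambda>w. (\<Sum>a\<in>A. f (X a w))\<^sup>2) = (\<Sum>a\<in>A. \<Sum>b\<in>A. expectation (\<lambda>w. f (X a w) * f (X b w)))"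
    unfolding eq using int by (simp add: Bochner_Integration.integral_sum)
  also have "\<dots> = (\<Sum>a\<in>A. expectation (\<lambda>w. (f (X x0 w))\<^sup>2))"
    unfolding cross using A by (intro sum.cong refl) simp
  finally show "expectation (\<lambda>w. (\<Sum>a\<in>A. f (X a w))\<^sup>2) = real (card A) * expectation (\<lambda>w. (f (X x0 w))\<^sup>2)"
    by simp
qed

text \<open>The average runs over about \<open>c n^2\<close> cells, so its variance is
  \<open>O(1/n^2)\<close>, which is summable over all \<open>n\<close> without passing to a
  subsequence.\<close>

lemma AE_average_bounded:
  fixes g :: "complex \<Rightarrow> real"
  assumes g [measurable]: "g \<in> borel_measurable borel" and G: "\<And>z. \<bar>g z\<bar> \<le> G"
    and c: "c > 0" and p: "(\<lambda>n. real (p n) / real n) \<longlonglongrightarrow> c"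
  shows "AE w in M. (\<lambda>n. (\<Sum>i<p n. \<Sum>l<n. g (X (i, l) w)) / (real (p n) * real n)) \<longlonglongrightarrow> expectation (\<lambda>w. g (X x0 w))"
proof -
  define \<mu> where "\<mu> = expectation (\<lambda>w. g (X x0 w))"
  define f where "f = (\<lambda>z. g z - \<mu>)"
  define A where "A = (\<lambda>n. {..<p n} \<times> {..<n})"
  have cA: "finite (A n)" "real (card (A n)) = real (p n) * real n" for n by (auto simp: A_def)
  have f [measurable]: "f \<in> borel_measurable borel" unfolding f_def by measurable
  have F: "\<bar>f z\<bar> \<le> G + \<bar>\<mu>\<bar>" for z unfolding f_def using G[of z] by linarith
  have gi: "integrable M (\<lambda>w. g (X x0 w))" by (rule integrable_const_bound[of _ G]) (use G in auto)
  have zero: "expectation (\<lambda>w. f (X x0 w)) = 0" unfolding f_def using gi by (simp add: \<mu>_def prob_space)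
  define v where "v = expectation (\<lambda>w. (f (X x0 w))\<^sup>2)"
  have v: "v \<ge> 0" by (simp add: v_def)
  define U where "U = (\<lambda>n w. ((\<Sum>a\<in>A n. f (X a w)) / (real (p n) * real n))\<^sup>2)"
  have "\<forall>\<^sub>F n in sequentially. real (p n) / real n > c / 2"
    using p c by (intro order_tendstoD(1)[OF p]) auto
  hence ev: "\<forall>\<^sub>F n in sequentially. norm (v / (real (p n) * real n)) \<le> v * (2 / c) * inverse (real n ^ 2)"
    using eventually_gt_at_top[of 0]
  proof eventually_elim
    case (elim n)
    have pn: "0 < real (p n)" using elim c by (cases "p n = 0") auto
    from elim have "c / 2 * real n * real n \<le> real (p n) * real n" by (intro mult_right_mono) (simp_all add: field_simps)
    hence "v / (real (p n) * real n) \<le> v / (c / 2 * real n * real n)"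
      using v c elim pn by (intro divide_left_mono mult_pos_pos) auto
    also have "\<dots> = v * (2 / c) * inverse (real n ^ 2)" using c elim by (simp add: power2_eq_square field_simps)
    finally show ?case using v by simp
  qed
  have "AE w in M. (\<lambda>n. U n w) \<longlonglongrightarrow> 0"
  proof (rule AE_tendsto_zero_of_summable)
    show "integrable M (U n)" for n
      unfolding U_def power_divide by (intro integrable_divide expectation_sum_square[OF f F zero cA(1)])
    show "0 \<le> U n w" for n w by (simp add: U_def)
    show "expectation (U n) \<le> v / (real (p n) * real n)" for n
    proof -
      have "expectation (U n) = (real (p n) * real n) * v / (real (p n) * real n)\<^sup>2"
        unfolding U_def power_divide v_def using expectation_sum_square(2)[OF f F zero cA(1)[of n]] cA(2) by simp
      also have "\<dots> \<le> v / (real (p n) * real n)" by (simp add: power2_eq_square)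
      finally show ?thesis .
    qed
    show "summable (\<lambda>n. v / (real (p n) * real n))"
      by (rule summable_comparison_test_ev[OF ev]) (intro summable_mult inverse_power_summable, simp)
  qed
  thus ?thesis
  proof (rule AE_mp, intro AE_I2 impI)
    fix w assume "(\<lambda>n. U n w) \<longlonglongrightarrow> 0"
    hence "(\<lambda>n. sqrt (U n w)) \<longlonglongrightarrow> sqrt 0" by (rule tendsto_real_sqrt)
    hence "(\<lambda>n. \<bar>(\<Sum>a\<in>A n. f (X a w)) / (real (p n) * real n)\<bar>) \<longlonglongrightarrow> 0" by (simp add: U_def)
    hence 0: "(\<lambda>n. (\<Sum>a\<in>A n. f (X a w)) / (real (p n) * real n)) \<longlonglongrightarrow> 0" by (rule tendsto_rabs_zero_cancel)
    have "\<forall>\<^sub>F n in sequentially. (\<Sum>a\<in>A n. f (X a w)) / (real (p n) * real n) + \<mu> =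
        (\<Sum>i<p n. \<Sum>l<n. g (X (i, l) w)) / (real (p n) * real n)"
      using eventually_gt_at_top[of 0] \<open>\<forall>\<^sub>F n in sequentially. real (p n) / real n > c / 2\<close>
    proof eventually_elim
      case (elim n)
      have "p n \<noteq> 0" using elim c by (auto intro!: Nat.gr0I)
      have "(\<Sum>a\<in>A n. f (X a w)) = (\<Sum>i<p n. \<Sum>l<n. g (X (i, l) w)) - real (p n) * real n * \<mu>"
        unfolding f_def A_def sum_subtractf by (simp add: sum.cartesian_product case_prod_unfold)
      thus ?case using elim \<open>p n \<noteq> 0\<close> by (simp add: diff_divide_distrib)
    qed
    with tendsto_add[OF 0 tendsto_const[of \<mu>]]
    show "(\<lambda>n. (\<Sum>i<p n. \<Sum>l<n. g (X (i, l) w)) / (real (p n) * real n)) \<longlonglongrightarrow> expectation (\<lambda>w. g (X x0 w))"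
      unfolding \<mu>_def[symmetric] by (simp add: Lim_transform_eventually)
  qed
qed

text \<open>Along dyadic squares, truncation at the size \<open>4\<^sup>k\<close> of the square reduces the bound to
  the Borel--Cantelli lemma and a summable variance; monotonicity fills in the other sizes.\<close>

lemma AE_sum_upper_bound:
  fixes f :: "complex \<Rightarrow> real" and b :: nat
  assumes f [measurable]: "f \<in> borel_measurable borel" and f0: "\<And>z. f z \<ge> 0"
    and int: "integrable M (\<lambda>w. f (X x0 w))" and e: "e > 0"
    and p: "\<And>n. n > 0 \<Longrightarrow> p n \<le> b * n"
  shows "AE w in M. \<forall>\<^sub>F n in sequentially.
    (\<Sum>i<p n. \<Sum>l<n. f (X (i, l) w)) \<le> 4 * real n ^ 2 * (real b * expectation (\<lambda>w. f (X x0 w)) + e)"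
proof -
  define m where "m = expectation (\<lambda>w. f (X x0 w))"
  \<comment> \<open>The rectangle has \<open>b 4^k\<close> cells, and \<open>4^k\<close> is also the
    truncation level; this balance makes both series below converge under a first moment
    alone.\<close>
  define A where "A = (\<lambda>k :: nat. {..<b * 2 ^ k} \<times> {..<2 ^ k :: nat})"
  have fA: "finite (A k)" and cA: "real (card (A k)) = real b * 4 ^ k" for k
  proof -
    show "finite (A k)" by (simp add: A_def)
    have "(4 :: real) ^ k = 2 ^ k * 2 ^ k" by (simp flip: power_mult_distrib)
    thus "real (card (A k)) = real b * 4 ^ k" by (simp add: A_def card_cartesian_product)
  qed
  define g where "g = (\<lambda>k z. f z * (if f z \<le> 4 ^ k then 1 else 0 :: real))"
  define \<mu> where "\<mu> = (\<lambda>k. expectation (\<lambda>w. g k (X x0 w)))"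
  define h where "h = (\<lambda>k z. g k z - \<mu> k)"
  have g [measurable]: "g k \<in> borel_measurable borel" for k unfolding g_def by measurable
  have h [measurable]: "h k \<in> borel_measurable borel" for k unfolding h_def by measurable
  have gb: "0 \<le> g k z" "g k z \<le> 4 ^ k" "g k z \<le> f z" for k z using f0[of z] by (auto simp: g_def)
  have gi: "integrable M (\<lambda>w. g k (X x0 w))" for k
    by (rule integrable_const_bound[of _ "4 ^ k"]) (use gb in auto)
  have \<mu>m: "\<mu> k \<le> m" for k unfolding \<mu>_def m_def using gb by (intro integral_mono gi int)
  have \<mu>0: "\<mu> k \<ge> 0" for k unfolding \<mu>_def using gb by simp
  have hb: "\<bar>h k z\<bar> \<le> 4 ^ k + \<mu> k" for k z using gb[of k z] \<mu>0[of k] by (auto simp: h_def abs_if)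
  have h0: "expectation (\<lambda>w. h k (X x0 w)) = 0" for k unfolding h_def using gi by (simp add: \<mu>_def prob_space)
  define v where "v = (\<lambda>k. expectation (\<lambda>w. (g k (X x0 w))\<^sup>2))"
  have g2i: "integrable M (\<lambda>w. (g k (X x0 w))\<^sup>2)" for k
    by (rule integrable_const_bound[of _ "(4 ^ k)\<^sup>2"]) (use gb in \<open>auto intro!: AE_I2 power_mono\<close>)
  have h2: "expectation (\<lambda>w. (h k (X x0 w))\<^sup>2) \<le> v k" for k
  proof -
    have "expectation (\<lambda>w. (h k (X x0 w))\<^sup>2) = v k - (\<mu> k)\<^sup>2"
      unfolding h_def v_def \<mu>_def by (rule variance_eq[OF gi g2i])
    thus ?thesis by simp
  qed
  have v0: "v k \<ge> 0" for k by (simp add: v_def)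
  have sumv: "summable (\<lambda>k. inverse (4 ^ k) * v k)"
  proof (rule bounded_imp_summable)
    show "0 \<le> inverse (4 ^ k) * v k" for k using v0 by simp
    show "(\<Sum>k\<le>n. inverse (4 ^ k) * v k) \<le> 4 / 3 * m" for n
    proof -
      have "(\<Sum>k\<le>n. inverse (4 ^ k) * v k) = expectation (\<lambda>w. \<Sum>k<Suc n. inverse (4 ^ k) * (g k (X x0 w))\<^sup>2)"
        unfolding v_def using g2i by (simp add: Bochner_Integration.integral_sum lessThan_Suc_atMost)
      also have "\<dots> \<le> expectation (\<lambda>w. 4 / 3 * f (X x0 w))"
      proof (intro integral_mono Bochner_Integration.integrable_sum integrable_mult_right g2i int)
        fix w
        have "(\<Sum>k<Suc n. inverse (4 ^ k) * (g k (X x0 w))\<^sup>2) =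
          (\<Sum>k<Suc n. inverse (4 ^ k) * ((f (X x0 w))\<^sup>2 * (if f (X x0 w) \<le> 4 ^ k then 1 else 0)))"
          by (intro sum.cong refl) (simp add: g_def power_mult_distrib)
        also have "\<dots> \<le> 4 / 3 * f (X x0 w)" by (rule sum_inverse_powers_above[OF f0])
        finally show "(\<Sum>k<Suc n. inverse (4 ^ k) * (g k (X x0 w))\<^sup>2) \<le> 4 / 3 * f (X x0 w)" .
      qed
      finally show ?thesis by (simp add: m_def)
    qed
  qed
  define U where "U = (\<lambda>k w. ((\<Sum>a\<in>A k. h k (X a w)) / 4 ^ k)\<^sup>2)"
  have AU: "AE w in M. (\<lambda>k. U k w) \<longlonglongrightarrow> 0"
  proof (rule AE_tendsto_zero_of_summable[where b = "\<lambda>k. real b * (inverse (4 ^ k) * v k)"])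
    show "integrable M (U k)" for k
      unfolding U_def power_divide by (intro integrable_divide expectation_sum_square[OF h hb h0 fA])
    show "0 \<le> U k w" for k w by (simp add: U_def)
    show "expectation (U k) \<le> real b * (inverse (4 ^ k) * v k)" for k
    proof -
      have "expectation (U k) = real b * 4 ^ k * expectation (\<lambda>w. (h k (X x0 w))\<^sup>2) / (4 ^ k)\<^sup>2"
        unfolding U_def power_divide using expectation_sum_square(2)[OF h hb h0 fA[of k]] cA by simp
      also have "\<dots> = real b * (inverse (4 ^ k) * expectation (\<lambda>w. (h k (X x0 w))\<^sup>2))"
        by (simp add: power2_eq_square divide_inverse)
      also have "\<dots> \<le> real b * (inverse (4 ^ k) * v k)" by (intro mult_left_mono h2) auto
      finally show ?thesis .
    qed
    show "summable (\<lambda>k. real b * (inverse (4 ^ k) * v k))" by (intro summable_mult sumv)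
  qed
  define I where "I = (\<lambda>k z. if 4 ^ k < f z then 1 else 0 :: real)"
  have I [measurable]: "I k \<in> borel_measurable borel" for k unfolding I_def by measurable
  have Ii: "integrable M (\<lambda>w. I k (X a w))" for k a
    by (rule integrable_const_bound[of _ 1]) (auto simp: I_def)
  define \<pi> where "\<pi> = (\<lambda>k. expectation (\<lambda>w. I k (X x0 w)))"
  have sum\<pi>: "summable (\<lambda>k. 4 ^ k * \<pi> k)"
  proof (rule bounded_imp_summable)
    show "0 \<le> 4 ^ k * \<pi> k" for k by (simp add: \<pi>_def I_def)
    show "(\<Sum>k\<le>n. 4 ^ k * \<pi> k) \<le> 4 / 3 * m" for n
    proof -
      have "(\<Sum>k\<le>n. 4 ^ k * \<pi> k) = expectation (\<lambda>w. \<Sum>k<Suc n. 4 ^ k * I k (X x0 w))"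
        unfolding \<pi>_def using Ii by (simp add: Bochner_Integration.integral_sum lessThan_Suc_atMost)
      also have "\<dots> \<le> expectation (\<lambda>w. 4 / 3 * f (X x0 w))"
        unfolding I_def[abs_def]
        using Ii[unfolded I_def]
        by (intro integral_mono Bochner_Integration.integrable_sum integrable_mult_right int sum_powers_below f0)
      finally show ?thesis by (simp add: m_def)
    qed
  qed
  \<comment> \<open>Counts the cells above the truncation level. Once it is below 1, no cell of the
    rectangle is affected by truncation.\<close>
  define Z where "Z = (\<lambda>k w. \<Sum>a\<in>A k. I k (X a w))"
  have AZ: "AE w in M. (\<lambda>k. Z k w) \<longlonglongrightarrow> 0"
  proof (rule AE_tendsto_zero_of_summable[where b = "\<lambda>k. real b * (4 ^ k * \<pi> k)"])
    show "integrable M (Z k)" for k unfolding Z_def by (intro Bochner_Integration.integrable_sum Ii)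
    show "0 \<le> Z k w" for k w by (auto simp: Z_def I_def intro!: sum_nonneg)
    show "expectation (Z k) \<le> real b * (4 ^ k * \<pi> k)" for k
    proof -
      have "expectation (Z k) = (\<Sum>a\<in>A k. expectation (\<lambda>w. I k (X a w)))"
        unfolding Z_def using Ii by (simp add: Bochner_Integration.integral_sum)
      also have "\<dots> = (\<Sum>a\<in>A k. \<pi> k)" unfolding \<pi>_def by (intro sum.cong refl expectation_ident) simp
      finally show ?thesis using cA[of k] by simp
    qed
    show "summable (\<lambda>k. real b * (4 ^ k * \<pi> k))" by (intro summable_mult sum\<pi>)
  qed
  from AU AZ show ?thesis
  proof eventually_elim
    case (elim w)
    have "\<forall>\<^sub>F k in sequentially. U k w < e\<^sup>2" using elim(1) e by (intro order_tendstoD) auto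
    moreover have "\<forall>\<^sub>F k in sequentially. Z k w < 1" using elim(2) by (intro order_tendstoD) auto
    ultimately have "\<forall>\<^sub>F k in sequentially. (\<Sum>a\<in>A k. f (X a w)) \<le> 4 ^ k * (real b * m + e)"
    proof eventually_elim
      case (elim k)
      have "f (X a w) \<le> 4 ^ k" if "a \<in> A k" for a
      proof -
        have "I k (X a w) \<le> Z k w" unfolding Z_def
          by (rule member_le_sum[OF that]) (auto simp: I_def fA)
        thus ?thesis using elim(2) by (auto simp: I_def split: if_splits)
      qed
      hence "(\<Sum>a\<in>A k. f (X a w)) = (\<Sum>a\<in>A k. g k (X a w))"
        by (intro sum.cong refl) (simp add: g_def)
      also have "\<dots> = (\<Sum>a\<in>A k. h k (X a w)) + real b * 4 ^ k * \<mu> k"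
        unfolding h_def using cA[of k] by (simp add: sum_subtractf)
      also have "(\<Sum>a\<in>A k. h k (X a w)) \<le> 4 ^ k * e"
      proof -
        have "(\<Sum>a\<in>A k. h k (X a w)) / 4 ^ k \<le> e"
        proof (rule power2_le_imp_le)
          show "((\<Sum>a\<in>A k. h k (X a w)) / 4 ^ k)\<^sup>2 \<le> e\<^sup>2" using elim(1) by (simp add: U_def)
        qed (use e in simp)
        thus ?thesis by (simp add: divide_simps mult.commute)
      qed
      also have "real b * 4 ^ k * \<mu> k \<le> real b * 4 ^ k * m" by (intro mult_left_mono \<mu>m) simp
      finally show ?case by (simp add: algebra_simps)
    qed
    then obtain k0 where k0: "\<And>k. k \<ge> k0 \<Longrightarrow> (\<Sum>a\<in>A k. f (X a w)) \<le> 4 ^ k * (real b * m + e)"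
      unfolding eventually_sequentially by blast
    have m0: "m \<ge> 0" unfolding m_def using f0 by simp
    show ?case
      unfolding m_def[symmetric] eventually_sequentially
    proof (intro exI[of _ "2 ^ k0"] allI impI)
      fix n :: nat assume n: "2 ^ k0 \<le> n"
      have npos: "n > 0" using n by (metis gr0I le_zero_eq power_not_zero zero_neq_numeral)
      \<comment> \<open>The rectangle of \<open>n\<close> sits inside the one of
        \<open>k + 1\<close>, and \<open>4^(k+1) <= 4 n^2\<close> explains the factor 4 of the
        statement. Such a loss is tolerable because the bound is applied to functions of small
        mean.\<close>
      obtain k where k: "2 ^ k \<le> n" "n < 2 ^ (k + 1)" using ex_power_ivl1[of 2 n] npos by auto
      have "k0 < k + 1" using n k(2) by (metis le_less_trans nat_power_less_imp_less pos2)
      hence kk: "k + 1 \<ge> k0" by simp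
      have "p n \<le> b * 2 ^ (k + 1)" using p[OF npos] k(2) by (meson le_trans less_imp_le mult_le_mono2)
      hence sub: "{..<p n} \<times> {..<n} \<subseteq> A (k + 1)" using k(2) unfolding A_def by auto
      have "(\<Sum>i<p n. \<Sum>l<n. f (X (i, l) w)) = (\<Sum>a\<in>{..<p n} \<times> {..<n}. f (X a w))"
        by (simp add: sum.cartesian_product case_prod_unfold)
      also have "\<dots> \<le> (\<Sum>a\<in>A (k + 1). f (X a w))"
        by (rule sum_mono2[OF fA sub]) (rule f0)
      also have "\<dots> \<le> 4 ^ (k + 1) * (real b * m + e)" by (rule k0[OF kk])
      also have "\<dots> \<le> 4 * real n ^ 2 * (real b * m + e)"
      proof (rule mult_right_mono)
        have "real (2 ^ k) \<le> real n" using k(1) by (simp only: of_nat_le_iff)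
        hence "(2 :: real) ^ k \<le> real n" by simp
        hence "(2 ^ k)\<^sup>2 \<le> (real n)\<^sup>2" by (rule power_mono) simp
        moreover have "(4 :: real) ^ k = (2 ^ k)\<^sup>2" by (simp add: power2_eq_square flip: power_mult_distrib)
        ultimately have "(4 :: real) ^ k \<le> (real n)\<^sup>2" by simp
        thus "(4 :: real) ^ (k + 1) \<le> 4 * real n ^ 2" by simp
        show "0 \<le> real b * m + e" using m0 e by simp
      qed
      finally show "(\<Sum>i<p n. \<Sum>l<n. f (X (i, l) w)) \<le> 4 * real n ^ 2 * (real b * m + e)" .
    qed
  qed
qed

end

section \<open>Truncation\<close>

locale standardized_array = iid_array +
  assumes mean: "expectation (X x0) = 0" and var: "expectation (\<lambda>w. (cmod (X x0 w))\<^sup>2) = 1"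
begin

lemma square_integrable: "integrable M (\<lambda>w. (cmod (X x0 w))\<^sup>2)"
  using var not_integrable_integral_eq by fastforce

lemma norm_integrable: "integrable M (\<lambda>w. cmod (X x0 w))"
proof (rule Bochner_Integration.integrable_bound)
  show "integrable M (\<lambda>w. 1 + (cmod (X x0 w))\<^sup>2)" using square_integrable by simp
  have "x \<le> 1 + x\<^sup>2" for x :: real using zero_le_power2[of "x - 1 / 2"] by (simp add: power2_eq_square algebra_simps)
  thus "AE w in M. norm (cmod (X x0 w)) \<le> norm (1 + (cmod (X x0 w))\<^sup>2)" by simp
qed measurable

text \<open>Cut off at \<open>L\<close>, recentre, renormalize. By dominated convergence the mean of
  the cut variable tends to 0 and the second moment of the recentred one to 1, so the corrections
  fade as \<open>L\<close> grows and the result approaches the original in mean square.\<close>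

lemma truncation:
  assumes e: "e > 0"
  obtains \<phi> :: "complex \<Rightarrow> complex" and C where "\<phi> \<in> borel_measurable borel" "\<And>z. cmod (\<phi> z) \<le> C"
    "expectation (\<lambda>w. \<phi> (X x0 w)) = 0" "expectation (\<lambda>w. (cmod (\<phi> (X x0 w)))\<^sup>2) = 1"
    "integrable M (\<lambda>w. (cmod (X x0 w - \<phi> (X x0 w)))\<^sup>2)"
    "expectation (\<lambda>w. (cmod (X x0 w - \<phi> (X x0 w)))\<^sup>2) \<le> e"
proof -
  let ?X = "X x0"
  define \<tau> where "\<tau> = (\<lambda>(L :: nat) z :: complex. if cmod z \<le> real L then z else 0)"
  have \<tau>m [measurable]: "\<tau> L \<in> borel_measurable borel" for L unfolding \<tau>_def by measurable
  have \<tau>b: "cmod (\<tau> L z) \<le> real L" "cmod (\<tau> L z) \<le> cmod z" for L z by (auto simp: \<tau>_def)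
  have \<tau>lim: "(\<lambda>L. \<tau> L z) \<longlonglongrightarrow> z" for z
  proof (rule tendsto_eventually)
    show "\<forall>\<^sub>F L in sequentially. \<tau> L z = z"
      using eventually_ge_at_top[of "nat \<lceil>cmod z\<rceil>"] by eventually_elim (simp add: \<tau>_def nat_ceiling_le_eq)
  qed
  define m where "m = (\<lambda>L. expectation (\<lambda>w. \<tau> L (?X w)))"
  define B where "B = expectation (\<lambda>w. cmod (?X w))"
  have B: "B \<ge> 0" by (simp add: B_def)
  have \<tau>i: "integrable M (\<lambda>w. \<tau> L (?X w))" for L
    by (rule integrable_const_bound[of _ "real L"]) (use \<tau>b in auto)
  have mB: "cmod (m L) \<le> B" for L
  proof -
    have "cmod (m L) \<le> expectation (\<lambda>w. cmod (\<tau> L (?X w)))" unfolding m_def by (rule integral_norm_bound)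
    also have "\<dots> \<le> B" unfolding B_def using \<tau>i \<tau>b(2) by (intro integral_mono integrable_norm norm_integrable) auto
    finally show ?thesis .
  qed
  have "m \<longlonglongrightarrow> expectation ?X"
    unfolding m_def
    by (rule integral_dominated_convergence[where w = "\<lambda>w. cmod (?X w)"])
      (use norm_integrable \<tau>lim \<tau>b in auto)
  hence mlim: "m \<longlonglongrightarrow> 0" by (simp add: mean)
  \<comment> \<open>The dominating function comes from \<open>|X - \<phi>| <= |X| + 2 |d|\<close>
    and \<open>|d| <= |X| + B\<close>; the 2 is the inverse of the lower bound imposed on
    \<sigma>.\<close>
  have quad: "integrable M (\<lambda>w. (3 * cmod (?X w) + 2 * B)\<^sup>2)"
  proof -
    have eq: "(3 * cmod (?X w) + 2 * B)\<^sup>2 = 9 * (cmod (?X w))\<^sup>2 + (12 * B * cmod (?X w) + 4 * B\<^sup>2)" for w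
      by (simp add: power2_eq_square algebra_simps)
    show ?thesis unfolding eq using square_integrable norm_integrable
      by (intro Bochner_Integration.integrable_add integrable_mult_right) auto
  qed
  define d where "d = (\<lambda>L z. \<tau> L z - m L)"
  have dm [measurable]: "d L \<in> borel_measurable borel" for L unfolding d_def by measurable
  have db: "cmod (d L z) \<le> cmod z + B" "cmod (d L z) \<le> real L + B" for L z
    unfolding d_def using norm_triangle_ineq4[of "\<tau> L z" "m L"] \<tau>b[of L z] mB[of L] by linarith+
  have dlim: "(\<lambda>L. d L z) \<longlonglongrightarrow> z" for z
    unfolding d_def using tendsto_diff[OF \<tau>lim mlim] by simp
  define v where "v = (\<lambda>L. expectation (\<lambda>w. (cmod (d L (?X w)))\<^sup>2))"
  have "v \<longlonglongrightarrow> expectation (\<lambda>w. (cmod (?X w))\<^sup>2)"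
    unfolding v_def
  proof (rule integral_dominated_convergence[where w = "\<lambda>w. (3 * cmod (?X w) + 2 * B)\<^sup>2"])
    show "AE w in M. norm ((cmod (d L (?X w)))\<^sup>2) \<le> (3 * cmod (?X w) + 2 * B)\<^sup>2" for L
    proof (intro AE_I2)
      fix w
      have "cmod (d L (?X w)) \<le> 3 * cmod (?X w) + 2 * B" using db(1)[of L "?X w"] B norm_ge_zero[of "?X w"] by linarith
      hence "(cmod (d L (?X w)))\<^sup>2 \<le> (3 * cmod (?X w) + 2 * B)\<^sup>2" by (intro power_mono) auto
      thus "norm ((cmod (d L (?X w)))\<^sup>2) \<le> (3 * cmod (?X w) + 2 * B)\<^sup>2" by simp
    qed
  qed (use quad in \<open>auto intro!: tendsto_power tendsto_norm dlim\<close>)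
  hence vlim: "v \<longlonglongrightarrow> 1" by (simp add: var)
  \<comment> \<open>The maximum keeps the divisor away from 0 for small \<open>L\<close>, so one
    dominating function serves every \<open>L\<close>. As \<open>v\<close> tends to 1, it is
    eventually \<open>sqrt (v L)\<close>.\<close>
  define \<sigma> where "\<sigma> = (\<lambda>L. max (1 / 2) (sqrt (v L)))"
  have "\<sigma> \<longlonglongrightarrow> max (1 / 2) (sqrt 1)" unfolding \<sigma>_def by (intro tendsto_max tendsto_const tendsto_real_sqrt vlim)
  hence \<sigma>lim: "\<sigma> \<longlonglongrightarrow> 1" by simp
  have \<sigma>: "\<sigma> L \<ge> 1 / 2" for L by (simp add: \<sigma>_def)
  define \<phi> where "\<phi> = (\<lambda>L z. d L z / of_real (\<sigma> L))"
  have \<phi>m [measurable]: "\<phi> L \<in> borel_measurable borel" for L unfolding \<phi>_def by measurable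
  have \<phi>d: "cmod (\<phi> L z) \<le> 2 * cmod (d L z)" for L z
  proof -
    have "cmod (\<phi> L z) = cmod (d L z) / \<sigma> L" using \<sigma>[of L] by (simp add: \<phi>_def norm_divide)
    also have "\<dots> \<le> cmod (d L z) / (1 / 2)" using \<sigma>[of L] by (intro divide_left_mono) auto
    finally show ?thesis by simp
  qed
  have dom: "(cmod (?X w - \<phi> L (?X w)))\<^sup>2 \<le> (3 * cmod (?X w) + 2 * B)\<^sup>2" for w L
  proof (rule power_mono)
    show "cmod (?X w - \<phi> L (?X w)) \<le> 3 * cmod (?X w) + 2 * B"
      using norm_triangle_ineq4[of "?X w" "\<phi> L (?X w)"] \<phi>d[of L "?X w"] db(1)[of L "?X w"] by linarith
  qed simp
  have "(\<lambda>L. expectation (\<lambda>w. (cmod (?X w - \<phi> L (?X w)))\<^sup>2)) \<longlonglongrightarrow> expectation (\<lambda>w. 0)"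
  proof (rule integral_dominated_convergence[where w = "\<lambda>w. (3 * cmod (?X w) + 2 * B)\<^sup>2"])
    have "(\<lambda>L. (cmod (z - \<phi> L z))\<^sup>2) \<longlonglongrightarrow> (cmod (z - z / of_real 1))\<^sup>2" for z
      unfolding \<phi>_def by (intro tendsto_intros dlim \<sigma>lim) auto
    thus "AE w in M. (\<lambda>L. (cmod (?X w - \<phi> L (?X w)))\<^sup>2) \<longlonglongrightarrow> 0" by simp
  qed (use quad dom in auto)
  hence "\<forall>\<^sub>F L in sequentially. expectation (\<lambda>w. (cmod (?X w - \<phi> L (?X w)))\<^sup>2) < e"
    using e by (intro order_tendstoD) auto
  moreover have "\<forall>\<^sub>F L in sequentially. v L > 1 / 4" using vlim by (intro order_tendstoD) auto
  ultimately have "\<forall>\<^sub>F L in sequentially. expectation (\<lambda>w. (cmod (?X w - \<phi> L (?X w)))\<^sup>2) < e \<and> v L > 1 / 4"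
    by (rule eventually_conj)
  then obtain L where L: "expectation (\<lambda>w. (cmod (?X w - \<phi> L (?X w)))\<^sup>2) < e" "v L > 1 / 4"
    unfolding eventually_sequentially by blast
  have "sqrt (v L) \<ge> 1 / 2" using L(2) by (intro real_le_rsqrt) (simp add: power2_eq_square)
  hence \<sigma>2: "(\<sigma> L)\<^sup>2 = v L" using L(2) by (simp add: \<sigma>_def max_def)
  show ?thesis
  proof (rule that[of "\<phi> L" "2 * (real L + B)"])
    show "cmod (\<phi> L z) \<le> 2 * (real L + B)" for z using db(2)[of L z] by (intro order_trans[OF \<phi>d]) simp
    have "expectation (\<lambda>w. d L (?X w)) = 0" unfolding d_def using \<tau>i[of L] by (simp add: m_def prob_space)
    thus "expectation (\<lambda>w. \<phi> L (?X w)) = 0" by (simp add: \<phi>_def)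
    have "(cmod (\<phi> L z))\<^sup>2 = (cmod (d L z))\<^sup>2 / v L" for z by (simp add: \<phi>_def norm_divide power_divide \<sigma>2)
    thus "expectation (\<lambda>w. (cmod (\<phi> L (?X w)))\<^sup>2) = 1" using L(2) by (simp add: v_def)
    show "integrable M (\<lambda>w. (cmod (?X w - \<phi> L (?X w)))\<^sup>2)"
      by (rule Bochner_Integration.integrable_bound[OF quad]) (use dom in auto)
    show "expectation (\<lambda>w. (cmod (?X w - \<phi> L (?X w)))\<^sup>2) \<le> e" using L(1) by simp
  qed measurable
qed

text \<open>\<open>a\<close> is the trace of the truncated array, which converges by the bounded
  case. The square sum of the difference is of order \<open>e n^2\<close>, and the factor
  \<open>b n/(n t)^3\<close> of the Lipschitz estimate cancels \<open>n^2\<close>. The existential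
  hides the truncation, which changes with \<open>e\<close>.\<close>

lemma AE_resolvent_trace_truncated:
  fixes b :: nat
  assumes t: "t > 0" and c: "c > 0" and p: "(\<lambda>n. real (p n) / real n) \<longlonglongrightarrow> c"
    and pb: "\<And>n. n > 0 \<Longrightarrow> p n \<le> b * n" and e: "e > 0"
  shows "AE w in M. \<exists>a. a \<longlonglongrightarrow> mp_root c t \<and> (\<forall>\<^sub>F n in sequentially.
    \<bar>resolvent_trace (\<lambda>i l. X (i, l) w) (p n) n (real n * t) - a n\<bar> \<le> 2 * sqrt (4 * (real b * e + e) * (real b / t ^ 3)))"
proof -
  obtain \<phi> C where \<phi> [measurable]: "\<phi> \<in> borel_measurable borel" and \<phi>2: "\<And>z. cmod (\<phi> z) \<le> C"
    "expectation (\<lambda>w. \<phi> (X x0 w)) = 0" "expectation (\<lambda>w. (cmod (\<phi> (X x0 w)))\<^sup>2) = 1"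
    "integrable M (\<lambda>w. (cmod (X x0 w - \<phi> (X x0 w)))\<^sup>2)"
    "expectation (\<lambda>w. (cmod (X x0 w - \<phi> (X x0 w)))\<^sup>2) \<le> e"
    using truncation[OF e] by blast
  let ?f = "\<lambda>z. (cmod (z - \<phi> z))\<^sup>2"
  have lim: "AE w in M. (\<lambda>n. resolvent_trace (\<lambda>i l. \<phi> (X (i, l) w)) (p n) n (real n * t)) \<longlonglongrightarrow> mp_root c t"
  proof (rule AE_resolvent_trace_bounded[where Y = "\<lambda>a w. \<phi> (X a w)", OF _ _ _ _ t c p])
    show "indep_vars (\<lambda>_. borel) (\<lambda>a w. \<phi> (X a w)) UNIV"
      by (rule indep_vars_compose2[OF ind]) simp
    show "cmod (\<phi> (X a w)) \<le> C" for a w by (rule \<phi>2)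
    show "expectation (\<lambda>w. \<phi> (X a w)) = 0" for a using expectation_ident[OF \<phi>] \<phi>2 by simp
    show "expectation (\<lambda>w. (cmod (\<phi> (X a w)))\<^sup>2) = 1" for a
      using expectation_ident[of "\<lambda>z. (cmod (\<phi> z))\<^sup>2"] \<phi>2 by simp
  qed
  have "AE w in M. \<forall>\<^sub>F n in sequentially.
    (\<Sum>i<p n. \<Sum>l<n. ?f (X (i, l) w)) \<le> 4 * real n ^ 2 * (real b * expectation (\<lambda>w. ?f (X x0 w)) + e)"
    by (rule AE_sum_upper_bound[where f = ?f and b = b]) (use \<phi>2 e pb in auto)
  with lim show ?thesis
  proof eventually_elim
    case (elim w)
    show ?case
    proof (intro exI conjI, rule elim(1))
      show "\<forall>\<^sub>F n in sequentially. \<bar>resolvent_trace (\<lambda>i l. X (i, l) w) (p n) n (real n * t) -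
         resolvent_trace (\<lambda>i l. \<phi> (X (i, l) w)) (p n) n (real n * t)\<bar> \<le> 2 * sqrt (4 * (real b * e + e) * (real b / t ^ 3))"
        using elim(2) eventually_gt_at_top[of 0]
      proof eventually_elim
        case (elim n)
        have nt: "real n * t > 0" using elim t by simp
        have "(\<Sum>i<p n. \<Sum>l<n. ?f (X (i, l) w)) \<le> 4 * real n ^ 2 * (real b * e + e)"
          by (rule order_trans[OF elim(1)]) (intro mult_left_mono add_right_mono \<phi>2(5), auto)
        moreover have "real (p n) / (real n * t) ^ 3 \<le> real b * real n / (real n * t) ^ 3"
        proof (rule divide_right_mono)
          have "real (p n) \<le> real (b * n)" using pb[OF elim(2)] by (simp only: of_nat_le_iff)
          thus "real (p n) \<le> real b * real n" by simp
        qed (use nt in simp)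
        ultimately have "2 * sqrt (\<Sum>i<p n. \<Sum>l<n. ?f (X (i, l) w)) * sqrt (real (p n) / (real n * t) ^ 3) \<le>
          2 * sqrt (4 * real n ^ 2 * (real b * e + e)) * sqrt (real b * real n / (real n * t) ^ 3)"
          using nt e by (intro mult_mono real_sqrt_le_mono) (auto intro!: sum_nonneg)
        also have "\<dots> = 2 * sqrt (4 * real n ^ 2 * (real b * e + e) * (real b * real n / (real n * t) ^ 3))"
          by (simp only: real_sqrt_mult mult.assoc)
        also have "4 * real n ^ 2 * (real b * e + e) * (real b * real n / (real n * t) ^ 3) = 4 * (real b * e + e) * (real b / t ^ 3)"
          using elim(2) t by (simp add: power2_eq_square power3_eq_cube field_simps)
        finally show ?case using resolvent_trace_lipschitz[OF nt, of "\<lambda>i l. X (i, l) w" "p n" n "\<lambda>i l. \<phi> (X (i, l) w)"]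
          by linarith
      qed
    qed
  qed
qed

text \<open>Countably many levels \<open>e = 1/(j + 1)\<close> share one null set, and the error
  bound tends to 0 with \<open>j\<close>.\<close>

lemma AE_resolvent_trace:
  fixes b :: nat
  assumes t: "t > 0" and c: "c > 0" and p: "(\<lambda>n. real (p n) / real n) \<longlonglongrightarrow> c"
    and pb: "\<And>n. n > 0 \<Longrightarrow> p n \<le> b * n"
  shows "AE w in M. (\<lambda>n. resolvent_trace (\<lambda>i l. X (i, l) w) (p n) n (real n * t)) \<longlonglongrightarrow> mp_root c t"
proof -
  let ?r = "\<lambda>j. 2 * sqrt (4 * (real b * inverse (real (Suc j)) + inverse (real (Suc j))) * (real b / t ^ 3))"
  have r: "?r \<longlonglongrightarrow> 0"
  proof -
    have "?r \<longlonglongrightarrow> 2 * sqrt (4 * (real b * 0 + 0) * (real b / t ^ 3))"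
      using t by (intro tendsto_intros LIMSEQ_inverse_real_of_nat) auto
    thus ?thesis by simp
  qed
  have "AE w in M. \<forall>j. \<exists>a. a \<longlonglongrightarrow> mp_root c t \<and> (\<forall>\<^sub>F n in sequentially.
    \<bar>resolvent_trace (\<lambda>i l. X (i, l) w) (p n) n (real n * t) - a n\<bar> \<le> ?r j)"
    unfolding AE_all_countable by (intro allI AE_resolvent_trace_truncated[OF t c p pb]) auto
  thus ?thesis
  proof (rule AE_mp, intro AE_I2 impI)
    fix w assume *: "\<forall>j. \<exists>a. a \<longlonglongrightarrow> mp_root c t \<and> (\<forall>\<^sub>F n in sequentially.
      \<bar>resolvent_trace (\<lambda>i l. X (i, l) w) (p n) n (real n * t) - a n\<bar> \<le> ?r j)"
    show "(\<lambda>n. resolvent_trace (\<lambda>i l. X (i, l) w) (p n) n (real n * t)) \<longlonglongrightarrow> mp_root c t"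
    proof (rule tendstoI)
      fix d :: real assume d: "d > 0"
      have "\<forall>\<^sub>F j in sequentially. ?r j < d / 2" using d by (intro order_tendstoD(2)[OF r]) simp
      then obtain j where j: "?r j < d / 2" unfolding eventually_sequentially by blast
      from * obtain a where a: "a \<longlonglongrightarrow> mp_root c t" "\<forall>\<^sub>F n in sequentially.
        \<bar>resolvent_trace (\<lambda>i l. X (i, l) w) (p n) n (real n * t) - a n\<bar> \<le> ?r j" by blast
      have "\<forall>\<^sub>F n in sequentially. dist (a n) (mp_root c t) < d / 2" using d by (intro tendstoD[OF a(1)]) simp
      with a(2) show "\<forall>\<^sub>F n in sequentially. dist (resolvent_trace (\<lambda>i l. X (i, l) w) (p n) n (real n * t)) (mp_root c t) < d"
      proof eventually_elim
        case (elim n)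
        have tri: "\<bar>x - y\<bar> < d" if "\<bar>x - z\<bar> \<le> s" "\<bar>z - y\<bar> < d / 2" "s < d / 2" for x y z s :: real
          using that by linarith
        show ?case unfolding dist_real_def
          by (rule tri[OF elim(1) _ j]) (use elim(2) in \<open>simp only: dist_real_def\<close>)
      qed
    qed
  qed
qed

text \<open>\<open>|z|^2\<close> is split into its minimum with \<open>L\<close>, to which the
  bounded law applies, and a remainder of small mean \<gamma>, which
  \<open>AE_sum_upper_bound\<close> controls up to a constant factor. The factor is harmless as
  \<gamma> tends to 0.\<close>

lemma AE_square_sum:
  fixes b :: nat
  assumes c: "c > 0" and p: "(\<lambda>n. real (p n) / real n) \<longlonglongrightarrow> c"
    and pb: "\<And>n. n > 0 \<Longrightarrow> p n \<le> b * n"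
  shows "AE w in M. (\<lambda>n. square_sum (\<lambda>i l. X (i, l) w) (p n) n / (real (p n) * real n)) \<longlonglongrightarrow> 1"
proof -
  define f where "f = (\<lambda>L z. min ((cmod z)\<^sup>2) (real L))"
  define g where "g = (\<lambda>L z. (cmod z)\<^sup>2 - f L z)"
  have fm [measurable]: "f L \<in> borel_measurable borel" and gm [measurable]: "g L \<in> borel_measurable borel" for L
    unfolding f_def g_def by measurable
  have fb: "\<bar>f L z\<bar> \<le> real L" and g0: "0 \<le> g L z" and gb: "g L z \<le> (cmod z)\<^sup>2" for L z by (auto simp: f_def g_def)
  have gi: "integrable M (\<lambda>w. g L (X x0 w))" for L
    by (rule Bochner_Integration.integrable_bound[OF square_integrable]) (use g0 gb in auto)
  have fi: "integrable M (\<lambda>w. f L (X x0 w))" for L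
    by (rule integrable_const_bound[of _ "real L"]) (use fb in auto)
  define \<gamma> where "\<gamma> = (\<lambda>L. expectation (\<lambda>w. g L (X x0 w)))"
  have \<gamma>0: "\<gamma> L \<ge> 0" for L unfolding \<gamma>_def using g0 by simp
  have Ef: "expectation (\<lambda>w. f L (X x0 w)) = 1 - \<gamma> L" for L
    unfolding \<gamma>_def g_def using square_integrable fi by (simp add: var)
  have "\<gamma> \<longlonglongrightarrow> expectation (\<lambda>w. 0)"
    unfolding \<gamma>_def
  proof (rule integral_dominated_convergence[where w = "\<lambda>w. (cmod (X x0 w))\<^sup>2"])
    have "(\<lambda>L. g L z) \<longlonglongrightarrow> 0" for z
    proof (rule tendsto_eventually)
      show "\<forall>\<^sub>F L in sequentially. g L z = 0"
        using eventually_ge_at_top[of "nat \<lceil>(cmod z)\<^sup>2\<rceil>"]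
        by eventually_elim (simp add: g_def f_def nat_ceiling_le_eq)
    qed
    thus "AE w in M. (\<lambda>L. g L (X x0 w)) \<longlonglongrightarrow> 0" by simp
  qed (use square_integrable g0 gb in auto)
  hence \<gamma>: "\<gamma> \<longlonglongrightarrow> 0" by simp
  \<comment> \<open>Collects the deficit of the mean of the bounded part and the bound for the
    remainder; \<open>2/c\<close> eventually bounds \<open>n^2\<close> over the number of
    cells.\<close>
  define r where "r = (\<lambda>L. \<gamma> L + 4 * (2 / c) * (real b * \<gamma> L + inverse (real (Suc L))))"
  have "r \<longlonglongrightarrow> 0 + 4 * (2 / c) * (real b * 0 + 0)"
    unfolding r_def by (intro tendsto_intros \<gamma> LIMSEQ_inverse_real_of_nat)
  hence r: "r \<longlonglongrightarrow> 0" by simp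
  have 1: "AE w in M. \<forall>L. (\<lambda>n. (\<Sum>i<p n. \<Sum>l<n. f L (X (i, l) w)) / (real (p n) * real n)) \<longlonglongrightarrow> 1 - \<gamma> L"
    unfolding AE_all_countable Ef[symmetric] by (intro allI AE_average_bounded[OF fm fb c p])
  have 2: "AE w in M. \<forall>L. \<forall>\<^sub>F n in sequentially.
     (\<Sum>i<p n. \<Sum>l<n. g L (X (i, l) w)) \<le> 4 * real n ^ 2 * (real b * \<gamma> L + inverse (real (Suc L)))"
    unfolding AE_all_countable \<gamma>_def by (intro allI AE_sum_upper_bound gm g0 gi pb) auto
  have "\<forall>\<^sub>F n in sequentially. c / 2 < real (p n) / real n" using c by (intro order_tendstoD(1)[OF p]) simp
  hence pn: "\<forall>\<^sub>F n in sequentially. n > 0 \<and> real n ^ 2 / (real (p n) * real n) \<le> 2 / c"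
    using eventually_gt_at_top[of 0]
  proof eventually_elim
    case (elim n)
    have "real (p n) > 0" using elim c by (cases "p n = 0") auto
    thus ?case using elim c by (simp add: power2_eq_square divide_simps mult.commute)
  qed
  from 1 2 show ?thesis
  proof eventually_elim
    case (elim w)
    show ?case
    proof (rule tendstoI)
      fix d :: real assume d: "d > 0"
      have "\<forall>\<^sub>F L in sequentially. r L < d / 2" using d by (intro order_tendstoD(2)[OF r]) simp
      then obtain L where L: "r L < d / 2" unfolding eventually_sequentially by blast
      have "\<forall>\<^sub>F n in sequentially. dist ((\<Sum>i<p n. \<Sum>l<n. f L (X (i, l) w)) / (real (p n) * real n)) (1 - \<gamma> L) < d / 2"
        using d elim(1) by (intro tendstoD) auto
      with elim(2)[rule_format, of L] pn
      show "\<forall>\<^sub>F n in sequentially. dist (square_sum (\<lambda>i l. X (i, l) w) (p n) n / (real (p n) * real n)) 1 < d"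
      proof eventually_elim
        case (elim n)
        define F where "F = (\<Sum>i<p n. \<Sum>l<n. f L (X (i, l) w)) / (real (p n) * real n)"
        define G where "G = (\<Sum>i<p n. \<Sum>l<n. g L (X (i, l) w)) / (real (p n) * real n)"
        have "square_sum (\<lambda>i l. X (i, l) w) (p n) n / (real (p n) * real n) = F + G"
          unfolding F_def G_def square_sum_def add_divide_distrib[symmetric] sum.distrib[symmetric] by (simp add: g_def)
        moreover have "0 \<le> G" unfolding G_def using g0 by (intro divide_nonneg_nonneg sum_nonneg) auto
        moreover have "G \<le> 4 * (2 / c) * (real b * \<gamma> L + inverse (real (Suc L)))"
        proof -
          have "G \<le> 4 * real n ^ 2 * (real b * \<gamma> L + inverse (real (Suc L))) / (real (p n) * real n)"
            unfolding G_def by (intro divide_right_mono elim(1)) simp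
          also have "\<dots> = 4 * (real n ^ 2 / (real (p n) * real n)) * (real b * \<gamma> L + inverse (real (Suc L)))" by simp
          also have "\<dots> \<le> 4 * (2 / c) * (real b * \<gamma> L + inverse (real (Suc L)))"
            using elim(2) \<gamma>0[of L] by (intro mult_right_mono mult_left_mono) auto
          finally show ?thesis .
        qed
        moreover have "\<bar>F - (1 - \<gamma> L)\<bar> < d / 2" using elim(3) by (simp add: F_def dist_real_def)
        ultimately show ?case using L \<gamma>0[of L] unfolding r_def dist_real_def by linarith
      qed
    qed
  qed
qed

end

section \<open>The spectral distribution of the density matrix\<close>

text \<open>\<open>p 0\<close> is arbitrary and may be 0, in which case the empirical measure has no
  mass; the first term is therefore discarded.\<close>

lemma weak_conv_m_Suc: "weak_conv_m (\<lambda>n. N (Suc n)) L \<longleftrightarrow> weak_conv_m N L"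
  unfolding weak_conv_m_def weak_conv_def
  by (simp add: filterlim_sequentially_Suc[of "\<lambda>n. cdf (N n) _"])

text \<open>Convergence to a fixed limit is written with quantifiers over natural numbers only,
  hence with countable set operations.\<close>

lemma tendsto_measurable:
  fixes f :: "nat \<Rightarrow> 'a \<Rightarrow> real"
  assumes [measurable]: "\<And>n. f n \<in> borel_measurable M"
  shows "Measurable.pred M (\<lambda>w. (\<lambda>n. f n w) \<longlonglongrightarrow> a)"
proof -
  have "(\<lambda>n. f n w) \<longlonglongrightarrow> a \<longleftrightarrow> (\<forall>j. \<exists>k. \<forall>n. k \<le> n \<longrightarrow> \<bar>f n w - a\<bar> < inverse (real (Suc j)))" for w
    unfolding LIMSEQ_iff
  proof (intro iffI allI impI)
    fix j assume "\<forall>r>0. \<exists>no. \<forall>n\<ge>no. norm (f n w - a) < r"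
    from this[rule_format, of "inverse (real (Suc j))"]
    show "\<exists>k. \<forall>n. k \<le> n \<longrightarrow> \<bar>f n w - a\<bar> < inverse (real (Suc j))" by auto
  next
    fix r :: real assume *: "\<forall>j. \<exists>k. \<forall>n. k \<le> n \<longrightarrow> \<bar>f n w - a\<bar> < inverse (real (Suc j))" and "r > 0"
    then obtain j where j: "inverse (real (Suc j)) < r" using reals_Archimedean by blast
    from * obtain k where "\<forall>n. k \<le> n \<longrightarrow> \<bar>f n w - a\<bar> < inverse (real (Suc j))" by blast
    with j show "\<exists>no. \<forall>n\<ge>no. norm (f n w - a) < r" by (intro exI[of _ k]) (auto intro: less_trans)
  qed
  thus ?thesis by (simp only:) measurable
qed

text \<open>The Stieltjes transform of the empirical measure at \<open>- t\<close>: factoring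
  \<open>c n\<close> out of \<open>c n \<lambda> + t\<close> leaves a resolvent trace of the
  rescaled array at shift \<open>t/(c n)\<close>. In this form it is measurable in the entries
  without any study of ordered eigenvalues.\<close>

definition spectral_transform :: "real \<Rightarrow> (nat \<Rightarrow> nat \<Rightarrow> complex) \<Rightarrow> nat \<Rightarrow> nat \<Rightarrow> real \<Rightarrow> real" where
  "spectral_transform c x p n t = 1 / (real p * (c * real n)) *
     resolvent_trace (\<lambda>i l. of_real (1 / sqrt (square_sum x p n)) * x i l) p n (t / (c * real n))"

lemma integral_empirical_density:
  assumes c: "c > 0" and n: "n > 0" and p: "p > 0" and h: "h \<ge> 0"
  shows "(\<integral>z. inv_shift h z \<partial>empirical_measure p
      (\<lambda>j. c * real n * hermitian_eigenvalue j (density_matrix (array_matrix x p n))))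
    = spectral_transform c (shift_array x) p n (1 + h)"
proof -
  let ?l = "\<lambda>j. hermitian_eigenvalue j (density_matrix (array_matrix x p n))"
  have cn: "c * real n > 0" using c n by simp
  have "(\<integral>z. inv_shift h z \<partial>empirical_measure p (\<lambda>j. c * real n * ?l j)) = (\<Sum>j=1..p. inv_shift h (c * real n * ?l j)) / real p"
    by (rule integral_empirical_measure[OF p inv_shift_measurable])
  also have "(\<Sum>j=1..p. inv_shift h (c * real n * ?l j)) = (\<Sum>j=1..p. 1 / (c * real n) * (1 / (?l j + (1 + h) / (c * real n))))"
  proof (intro sum.cong refl)
    fix j assume j: "j \<in> {1..p}"
    have l: "?l j \<ge> 0" by (rule density_matrix_eigenvalue_nonneg) (use j in auto)
    have "k * (a + s / k) = k * a + s" if "k > 0" for k a s :: real using that by (simp add: distrib_left)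
    from this[OF cn, of "?l j" "1 + h"]
    have eq: "c * real n * ?l j + (1 + h) = c * real n * (?l j + (1 + h) / (c * real n))" ..
    have "max (c * real n * ?l j) 0 = c * real n * ?l j"
      by (rule max_absorb1[OF mult_nonneg_nonneg[OF less_imp_le[OF cn] l]])
    thus "inv_shift h (c * real n * ?l j) = 1 / (c * real n) * (1 / (?l j + (1 + h) / (c * real n)))"
      unfolding inv_shift_def by (simp only: eq times_divide_times_eq mult_1)
  qed
  also have "\<dots> = 1 / (c * real n) * (\<Sum>j=1..p. 1 / (?l j + (1 + h) / (c * real n)))"
    by (simp add: sum_distrib_left)
  also have "(\<Sum>j=1..p. 1 / (?l j + (1 + h) / (c * real n))) =
    resolvent_trace (\<lambda>i l. of_real (1 / sqrt (square_sum (shift_array x) p n)) * shift_array x i l) p n ((1 + h) / (c * real n))"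
    by (rule density_matrix_sum_inverse) (use h cn in auto)
  finally show ?thesis by (simp add: spectral_transform_def)
qed

lemma spectral_transform_measurable:
  assumes [measurable]: "\<And>i l. (\<lambda>w. x w i l) \<in> borel_measurable M"
  shows "(\<lambda>w. spectral_transform c (x w) p n t) \<in> borel_measurable M"
proof -
  have [measurable]: "(\<lambda>w. square_sum (x w) p n) \<in> borel_measurable M"
    unfolding square_sum_def by measurable
  have "(\<lambda>w. of_real (1 / sqrt (square_sum (x w) p n)) * x w i l) \<in> borel_measurable M" for i l
    by measurable
  from resolvent_trace_measurable[of p n "\<lambda>w i l. of_real (1 / sqrt (square_sum (x w) p n)) * x w i l" M, OF this]
  show ?thesis unfolding spectral_transform_def by (intro borel_measurable_times borel_measurable_const)
qed

text \<open>By homogeneity the normalization by the square sum \<open>S\<close> turns into the shift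
  \<open>\<theta> t\<close> with \<open>\<theta> = S/(c n)\<close>. Since \<open>S\<close> is
  asymptotic to \<open>p n\<close>, hence to \<open>c n^2\<close>, the ratio
  \<open>\<theta>/n\<close> tends to 1 and \<open>resolvent_trace_shift\<close> replaces the shift
  by \<open>n t\<close>.\<close>

lemma spectral_transform_limit:
  assumes c: "c > 0" and t: "t > 0" and p: "(\<lambda>n. real (p n) / real n) \<longlonglongrightarrow> c"
    and T: "(\<lambda>n. square_sum x (p n) n / (real (p n) * real n)) \<longlonglongrightarrow> 1"
    and a: "(\<lambda>n. resolvent_trace x (p n) n (real n * t)) \<longlonglongrightarrow> mp_root c t"
  shows "(\<lambda>n. spectral_transform c x (p n) n t) \<longlonglongrightarrow> mp_root c t / c"
proof -
  define S where "S = (\<lambda>n. square_sum x (p n) n)"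
  define \<theta> where "\<theta> = (\<lambda>n. S n / (c * real n))"
  define u where "u = (\<lambda>n. S n / (real (p n) * real n))"
  have u: "u \<longlonglongrightarrow> 1" using T by (simp add: u_def S_def)
  have pc: "\<forall>\<^sub>F n in sequentially. 0 < real (p n) / real n" using c by (intro order_tendstoD(1)[OF p])
  have uc: "\<forall>\<^sub>F n in sequentially. 0 < u n" by (intro order_tendstoD(1)[OF u]) simp
  have ev: "\<forall>\<^sub>F n in sequentially. n > 0 \<and> p n > 0 \<and> S n > 0"
    using pc uc by eventually_elim (auto simp: u_def zero_less_divide_iff S_def square_sum_nonneg not_less mult_less_0_iff intro!: gr0I)
  have "(\<lambda>n. u n * (real (p n) / real n) / c) \<longlonglongrightarrow> 1 * c / c"
    using c by (intro tendsto_intros u p) auto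
  moreover have "\<forall>\<^sub>F n in sequentially. u n * (real (p n) / real n) / c = \<theta> n / real n"
    using ev by eventually_elim (simp add: u_def \<theta>_def)
  ultimately have \<theta>: "(\<lambda>n. \<theta> n / real n) \<longlonglongrightarrow> 1" using c by (simp add: Lim_transform_eventually)
  have "(\<lambda>n. real (p n) / real n * \<bar>\<theta> n / real n - 1\<bar> / (\<theta> n / real n * t)) \<longlonglongrightarrow> c * \<bar>1 - 1\<bar> / (1 * t)"
    using t by (intro tendsto_intros p \<theta>) auto
  hence lim0: "(\<lambda>n. real (p n) / real n * \<bar>\<theta> n / real n - 1\<bar> / (\<theta> n / real n * t)) \<longlonglongrightarrow> 0" by simp
  have "(\<lambda>n. resolvent_trace x (p n) n (\<theta> n * t) - resolvent_trace x (p n) n (real n * t)) \<longlonglongrightarrow> 0"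
  proof (rule Lim_null_comparison[OF _ lim0])
    show "\<forall>\<^sub>F n in sequentially. norm (resolvent_trace x (p n) n (\<theta> n * t) - resolvent_trace x (p n) n (real n * t))
        \<le> real (p n) / real n * \<bar>\<theta> n / real n - 1\<bar> / (\<theta> n / real n * t)"
      using ev
    proof eventually_elim
      case (elim n)
      have pos: "\<theta> n > 0" "real n > 0" using elim c by (auto simp: \<theta>_def)
      have "\<bar>\<theta> n * t - real n * t\<bar> = \<bar>\<theta> n - real n\<bar> * t" using t by (simp add: left_diff_distrib[symmetric] abs_mult)
      also have "\<theta> n - real n = (\<theta> n / real n - 1) * real n" using pos by (simp add: field_simps)
      also have "\<bar>(\<theta> n / real n - 1) * real n\<bar> = \<bar>\<theta> n / real n - 1\<bar> * real n" by (simp add: abs_mult)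
      finally have d: "\<bar>\<theta> n * t - real n * t\<bar> = \<bar>\<theta> n / real n - 1\<bar> * real n * t" .
      have "norm (resolvent_trace x (p n) n (\<theta> n * t) - resolvent_trace x (p n) n (real n * t))
        \<le> real (p n) * (\<bar>\<theta> n / real n - 1\<bar> * real n * t) / (\<theta> n * t * (real n * t))"
        unfolding d[symmetric] real_norm_def by (rule resolvent_trace_shift) (use pos t in auto)
      also have "\<dots> = real (p n) / real n * \<bar>\<theta> n / real n - 1\<bar> / (\<theta> n / real n * t)"
        using pos t by (simp add: divide_simps)
      finally show ?case .
    qed
  qed
  from tendsto_add[OF this a] have A: "(\<lambda>n. resolvent_trace x (p n) n (\<theta> n * t)) \<longlonglongrightarrow> mp_root c t" by simp
  have "(\<lambda>n. u n / c * resolvent_trace x (p n) n (\<theta> n * t)) \<longlonglongrightarrow> 1 / c * mp_root c t"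
    using c by (intro tendsto_intros u A) auto
  moreover have "\<forall>\<^sub>F n in sequentially. u n / c * resolvent_trace x (p n) n (\<theta> n * t) = spectral_transform c x (p n) n t"
    using ev
  proof eventually_elim
    case (elim n)
    define y where "y = (\<lambda>i l. of_real (1 / sqrt (S n)) * x i l)"
    have s: "sqrt (S n) > 0" "(sqrt (S n))\<^sup>2 = S n" using elim by auto
    have tc: "t / (c * real n) > 0" using t c elim by simp
    have "of_real (sqrt (S n)) * y i l = x i l" for i l using s(1) by (simp add: y_def)
    hence "resolvent_trace x (p n) n (S n * (t / (c * real n))) = resolvent_trace y (p n) n (t / (c * real n)) / S n"
      using resolvent_trace_scale[OF tc s(1), of y "p n" n] by (simp only: s(2))
    moreover have "S n * (t / (c * real n)) = \<theta> n * t" by (simp add: \<theta>_def)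
    ultimately have "resolvent_trace y (p n) n (t / (c * real n)) = S n * resolvent_trace x (p n) n (\<theta> n * t)"
      using elim by simp
    thus ?case unfolding spectral_transform_def y_def S_def u_def by simp
  qed
  ultimately show ?thesis by (simp add: Lim_transform_eventually)
qed

text \<open>Serves to pass from indices starting at 1 to indices starting at 0; the family is
  grouped into disjoint singletons.\<close>

lemma (in prob_space) indep_vars_reindex_inj:
  assumes ind: "indep_vars (\<lambda>_. borel) Y I" and \<sigma>: "inj \<sigma>" "range \<sigma> \<subseteq> I"
  shows "indep_vars (\<lambda>_. borel) (\<lambda>j. Y (\<sigma> j) :: 'a \<Rightarrow> complex) UNIV"
proof -
  have "indep_vars (\<lambda>j. PiM {\<sigma> j} (\<lambda>_. borel)) (\<lambda>j w. restrict (\<lambda>i. Y i w) {\<sigma> j}) UNIV"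
    using \<sigma> by (intro indep_vars_restrict[OF ind]) (auto simp: disjoint_family_on_def inj_def)
  from indep_vars_compose2[OF this, of "\<lambda>j g. g (\<sigma> j)" "\<lambda>_. borel"]
  show ?thesis by (simp add: measurable_component_singleton)
qed

theorem theorem1:
  fixes M :: "'a measure"
    and x :: "nat \<Rightarrow> nat \<Rightarrow> 'a \<Rightarrow> complex"
    and c :: real
    and p :: "nat \<Rightarrow> nat"
  assumes "prob_space M"
    and indep: "prob_space.indep_vars M (\<lambda>_. borel) (\<lambda>(k, l). x k l) ({1..} \<times> {1..})"
    and ident: "\<And>k l. k \<ge> 1 \<Longrightarrow> l \<ge> 1 \<Longrightarrow> distr M borel (x k l) = distr M borel (x 1 1)"
    and mean: "\<And>k l. k \<ge> 1 \<Longrightarrow> l \<ge> 1 \<Longrightarrow> (\<integral>\<omega>. x k l \<omega> \<partial>M) = 0"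
    and pseudo_var: "\<And>k l. k \<ge> 1 \<Longrightarrow> l \<ge> 1 \<Longrightarrow> (\<integral>\<omega>. (x k l \<omega>)\<^sup>2 \<partial>M) = 0"
    and var: "\<And>k l. k \<ge> 1 \<Longrightarrow> l \<ge> 1 \<Longrightarrow> (\<integral>\<omega>. (cmod (x k l \<omega>))\<^sup>2 \<partial>M) = 1"
    and "c > 0"
    and "\<And>n. n \<ge> 1 \<Longrightarrow> p n > 0"
    and "(\<lambda>n. real (p n) / real n) \<longlonglongrightarrow> c"
  defines "X \<equiv> (\<lambda>n \<omega>. array_matrix (\<lambda>k l. x k l \<omega>) (p n) n)"
  defines "\<rho> \<equiv> (\<lambda>n \<omega>. density_matrix (X n \<omega>))"
  defines "\<mu> \<equiv> (\<lambda>n \<omega>. empirical_measure (p n)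
                   (\<lambda>j. c * real n * hermitian_eigenvalue j (\<rho> n \<omega>)))"
  shows "measure M {\<omega> \<in> space M. weak_conv_m (\<lambda>n. \<mu> n \<omega>) (marchenko_pastur c)} = 1"
proof -
  interpret prob_space M by fact
  note c = \<open>c > 0\<close> and plim = \<open>(\<lambda>n. real (p n) / real n) \<longlonglongrightarrow> c\<close>
  define Y where "Y = (\<lambda>(i, l). x (Suc i) (Suc l))"
  have indY: "indep_vars (\<lambda>_. borel) Y UNIV"
  proof -
    have "indep_vars (\<lambda>_. borel) (\<lambda>a. (\<lambda>(k, l). x k l) (map_prod Suc Suc a)) UNIV"
      by (rule indep_vars_reindex_inj[OF indep]) (auto simp: inj_def)
    thus ?thesis by (simp add: Y_def case_prod_unfold)
  qed
  interpret standardized_array M Y "(0, 0)"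
  proof unfold_locales
    show "indep_vars (\<lambda>_. borel) Y UNIV" by (rule indY)
    show "distr M borel (Y a) = distr M borel (Y (0, 0))" for a
      using ident[of "Suc (fst a)" "Suc (snd a)"] by (simp add: Y_def case_prod_unfold)
    show "expectation (Y (0, 0)) = 0" using mean[of 1 1] by (simp add: Y_def)
    show "expectation (\<lambda>w. (cmod (Y (0, 0) w))\<^sup>2) = 1" using var[of 1 1] by (simp add: Y_def)
  qed
  define y where "y = (\<lambda>\<omega> i l. Y (i, l) \<omega>)"
  have y: "shift_array (\<lambda>k l. x k l \<omega>) = y \<omega>" for \<omega>
    by (intro ext) (simp add: shift_array_def y_def Y_def)
  \<comment> \<open>A convergent sequence is bounded; an integer bound on \<open>p n / n\<close>
    fixes the aspect ratio of the dyadic rectangles.\<close>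
  obtain b :: nat where b: "\<And>n. n > 0 \<Longrightarrow> p n \<le> b * n"
  proof -
    from convergent_imp_Bseq[OF convergentI[OF plim]]
    obtain K where K: "\<And>n. norm (real (p n) / real n) \<le> K" unfolding Bseq_def by blast
    show ?thesis
    proof (rule that[of "nat \<lceil>K\<rceil>"])
      fix n :: nat assume n: "n > 0"
      have "real (p n) \<le> K * real n" using K[of n] n by (simp add: divide_simps)
      also have "\<dots> \<le> real (nat \<lceil>K\<rceil>) * real n" by (intro mult_right_mono real_nat_ceiling_ge) simp
      finally show "p n \<le> nat \<lceil>K\<rceil> * n" by (simp only: of_nat_mult[symmetric] of_nat_le_iff)
    qed
  qed
  define h where "h = (\<lambda>k. 1 / real (Suc k))"
  have h: "h k \<ge> 0" "1 + h k > 0" for k by (auto simp: h_def add_pos_nonneg)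
  define G where "G = (\<lambda>k \<omega>. (\<lambda>n. spectral_transform c (y \<omega>) (p n) n (1 + h k)) \<longlonglongrightarrow> mp_root c (1 + h k) / c)"
  \<comment> \<open>The equivalence holds for every outcome and not just almost surely, so it
    identifies the two sets exactly.\<close>
  have event: "weak_conv_m (\<lambda>n. \<mu> n \<omega>) (marchenko_pastur c) \<longleftrightarrow> (\<forall>k. G k \<omega>)" for \<omega>
  proof -
    have p: "p (Suc n) > 0" for n using assms(8)[of "Suc n"] by simp
    have "weak_conv_m (\<lambda>n. \<mu> n \<omega>) (marchenko_pastur c) \<longleftrightarrow> weak_conv_m (\<lambda>n. \<mu> (Suc n) \<omega>) (marchenko_pastur c)"
      by (rule weak_conv_m_Suc[symmetric])
    also have "\<dots> \<longleftrightarrow> (\<forall>k. (\<lambda>n. integral\<^sup>L (\<mu> (Suc n) \<omega>) (inv_shift (1 / real (Suc k))))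
     \<longlonglongrightarrow> integral\<^sup>L (marchenko_pastur c) (inv_shift (1 / real (Suc k))))"
    proof (rule weak_conv_m_inv_shift)
      show "real_distribution (\<mu> (Suc n) \<omega>)" for n
        unfolding \<mu>_def by (rule real_distribution_empirical_measure[OF p])
      show "real_distribution (marchenko_pastur c)" by (rule real_distribution_marchenko_pastur[OF c])
      show "AE z in marchenko_pastur c. 0 \<le> z" by (rule AE_marchenko_pastur_nonneg[OF c])
      show "AE z in \<mu> (Suc n) \<omega>. 0 \<le> z" for n
        unfolding \<mu>_def \<rho>_def X_def using c
        by (intro AE_empirical_measure_nonneg[OF p] mult_nonneg_nonneg density_matrix_eigenvalue_nonneg) auto
    qed
    also have "\<dots> \<longleftrightarrow> (\<forall>k. (\<lambda>n. spectral_transform c (y \<omega>) (p (Suc n)) (Suc n) (1 + h k)) \<longlonglongrightarrow> mp_root c (1 + h k) / c)"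
    proof (intro arg_cong[of _ _ All] ext)
      fix k
      have hk: "1 / real (Suc k) = h k" by (simp add: h_def)
      have "integral\<^sup>L (\<mu> (Suc n) \<omega>) (inv_shift (1 / real (Suc k))) = spectral_transform c (y \<omega>) (p (Suc n)) (Suc n) (1 + h k)" for n
        unfolding \<mu>_def \<rho>_def X_def y[symmetric] h_def
        by (rule integral_empirical_density[OF c _ p]) auto
      moreover have "integral\<^sup>L (marchenko_pastur c) (inv_shift (1 / real (Suc k))) = mp_root c (1 + h k) / c"
        unfolding inv_shift_def hk by (rule integral_marchenko_pastur_resolvent[OF c]) (rule h)
      ultimately show "(\<lambda>n. integral\<^sup>L (\<mu> (Suc n) \<omega>) (inv_shift (1 / real (Suc k))))
          \<longlonglongrightarrow> integral\<^sup>L (marchenko_pastur c) (inv_shift (1 / real (Suc k))) \<longleftrightarrow>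
        (\<lambda>n. spectral_transform c (y \<omega>) (p (Suc n)) (Suc n) (1 + h k)) \<longlonglongrightarrow> mp_root c (1 + h k) / c"
        by simp
    qed
    also have "\<dots> \<longleftrightarrow> (\<forall>k. G k \<omega>)"
      unfolding G_def by (simp add: filterlim_sequentially_Suc[of "\<lambda>n. spectral_transform c (y \<omega>) (p n) n (1 + h _)"])
    finally show ?thesis .
  qed
  have "AE \<omega> in M. \<forall>k. G k \<omega>"
    unfolding AE_all_countable
  proof
    fix k
    show "AE \<omega> in M. G k \<omega>"
    proof -
      have "AE \<omega> in M. (\<lambda>n. square_sum (\<lambda>i l. Y (i, l) \<omega>) (p n) n / (real (p n) * real n)) \<longlonglongrightarrow> 1"
        by (rule AE_square_sum[OF c plim]) (rule b)
      moreover have "AE \<omega> in M. (\<lambda>n. resolvent_trace (\<lambda>i l. Y (i, l) \<omega>) (p n) n (real n * (1 + h k))) \<longlonglongrightarrow> mp_root c (1 + h k)"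
        by (rule AE_resolvent_trace[OF h(2) c plim]) (rule b)
      ultimately show ?thesis
      proof eventually_elim
        case (elim \<omega>)
        show ?case unfolding G_def using elim
          by (intro spectral_transform_limit[OF c h(2) plim]) (simp_all add: y_def)
      qed
    qed
  qed
  \<comment> \<open>An almost sure statement becomes a value of \<open>measure\<close> only for a
    measurable set.\<close>
  moreover have "Measurable.pred M (\<lambda>\<omega>. \<forall>k. G k \<omega>)"
  proof -
    have "Measurable.pred M (G k)" for k
      unfolding G_def by (intro tendsto_measurable spectral_transform_measurable) (simp add: y_def)
    thus ?thesis by measurable
  qed
  ultimately have "prob {\<omega> \<in> space M. \<forall>k. G k \<omega>} = 1"
    by (subst prob_eq_1) (auto simp: pred_def)
  thus ?thesis by (simp only: event)
qed

end
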